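(* Let $\mathbb{K}$ be a subfield of $\mathbb{C}$, $p\ge1$, and $A_1,\dots,A_p,n_1,\dots,n_p,r_1,\dots,r_p$ non-negative integers. Let $P\in\mathbb{K}[k_1,\dots,k_p]$ satisfy $\sum_{i=1}^j\deg_{k_i}P\le\big(\sum_{i=1}^jA_i(n_i+1)\big)-j-1$ for every $j\in\{1,\dots,p\}$, and let $S=\sum_{k_1\ge\dots\ge k_p\ge1}P(k_1,\dots,k_p)/\prod_{i=1}^p(k_i+r_i)_{n_i+1}^{A_i}$. Assume that for some integers $e_1,\dots,e_p$, $$P(k_1,\dots,k_{i-1},-k_i-2r_i-n_i,k_{i+1},\dots,k_p)=(-1)^{A_i(n_i+1)+e_i}P(k_1,\dots,k_p)$$ for every $i\in\{1,\dots,p\}$. Then there exists an admissible representation $(\lambda[s_1,\dots,s_q])$ of $S$ such that every tuple $(s_1,\dots,s_p)$ of length $p$ with $\lambda[s_1,\dots,s_p]\ne0$ satisfies $s_i\equiv e_i\pmod 2$ for every $i\in\{1,\dots,p\}$.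
   Context: $(k)_\alpha=k(k+1)\cdots(k+\alpha-1)$; $\zeta(s_1,\dots,s_q)=\sum_{k_1>\dots>k_q\ge1}k_1^{-s_1}\cdots k_q^{-s_q}$ ($s_1\ge2$), $\zeta(\emptyset)=1$. Admissible representation of $S$: coefficients $\lambda[s_1,\dots,s_q]\in\mathbb{K}$, indexed by tuples of positive integers with $0\le q\le p$ and $s_1\ge2$ when $q\ge1$, finitely many nonzero, with $S=\sum\lambda[s_1,\dots,s_q]\zeta(s_1,\dots,s_q)$, such that whenever $\lambda[s_1,\dots,s_q]\ne0$, $q\ge1$: (a) there exist $1=\ell_0<\dots<\ell_q=p+1$ with $s_j\le A_{\ell_{j-1}}+\dots+A_{\ell_j-1}$ for all $j$; (b) if $r_i\ge r_{i+1}+n_{i+1}+1$ for all $i\le p-1$, there exist $1\le i_1<\dots<i_q\le p$ with $1\le s_\ell\le A_{i_\ell}$ for all $\ell$, and the number of $\ell$ with $s_\ell=1$ is at most the number of $i$ with $\deg_{k_i}P\ge A_i(n_i+1)-1$. *)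

theory Defs
  imports "HOL-Analysis.Analysis" "HOL-Library.Poly_Mapping" "HOL-Number_Theory.Cong"
begin

text \<open>Families such as \<open>A\<^sub>1, \<dots>, A\<^sub>p\<close> are functions on \<open>nat\<close> of which only the values on
  \<open>{1..p}\<close> matter; tuples \<open>(s\<^sub>1, \<dots>, s\<^sub>q)\<close> of variable length are lists, with \<open>s\<^sub>j = s ! (j - 1)\<close>.\<close>

definition complex_subfield :: "complex set \<Rightarrow> bool" where
  "complex_subfield K \<longleftrightarrow> 0 \<in> K \<and> 1 \<in> K \<and>
     (\<forall>x\<in>K. \<forall>y\<in>K. x + y \<in> K \<and> x * y \<in> K) \<and> (\<forall>x\<in>K. - x \<in> K \<and> inverse x \<in> K)"

text \<open>A polynomial maps each monomial, itself a finitely supported map from variable indices to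
  exponents, to its coefficient.\<close>

type_synonym cpoly = "(nat \<Rightarrow>\<^sub>0 nat) \<Rightarrow>\<^sub>0 complex"

definition polys_over :: "complex set \<Rightarrow> nat \<Rightarrow> cpoly set" where
  "polys_over K p = {P. (\<forall>m. Poly_Mapping.lookup P m \<in> K) \<and>
     (\<forall>m\<in>Poly_Mapping.keys P. Poly_Mapping.keys m \<subseteq> {1..p})}"

definition peval :: "cpoly \<Rightarrow> (nat \<Rightarrow> complex) \<Rightarrow> complex" where
  "peval P x = (\<Sum>m\<in>Poly_Mapping.keys P. Poly_Mapping.lookup P m *
     (\<Prod>i\<in>Poly_Mapping.keys m. x i ^ Poly_Mapping.lookup m i))"

text \<open>The partial degree is extended-real valued, so that the zero polynomial has degree
  \<open>-\<infinity>\<close> (the supremum of the empty set).\<close>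

definition deg_in :: "nat \<Rightarrow> cpoly \<Rightarrow> ereal" where
  "deg_in i P = (SUP m\<in>Poly_Mapping.keys P. ereal (real (Poly_Mapping.lookup m i)))"

definition mzeta :: "nat list \<Rightarrow> real" where
  "mzeta s = (\<Sum>\<^sub>\<infinity> k \<in> {k \<in> {1..length s} \<rightarrow>\<^sub>E {1::nat..}. \<forall>j\<in>{1..<length s}. k j > k (j + 1)}.
     \<Prod>j=1..length s. 1 / real (k j) ^ (s ! (j - 1)))"

definition hyp_index :: "nat \<Rightarrow> (nat \<Rightarrow> nat) set" where
  "hyp_index p = {k \<in> {1..p} \<rightarrow>\<^sub>E {1::nat..}. \<forall>i\<in>{1..<p}. k i \<ge> k (i + 1)}"

definition hyp_term ::
  "nat \<Rightarrow> (nat \<Rightarrow> nat) \<Rightarrow> (nat \<Rightarrow> nat) \<Rightarrow> (nat \<Rightarrow> nat) \<Rightarrow> cpoly \<Rightarrow> (nat \<Rightarrow> nat) \<Rightarrow> complex" where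
  "hyp_term p A n r P k = peval P (\<lambda>i. of_nat (k i)) /
     (\<Prod>i=1..p. pochhammer (of_nat (k i + r i)) (n i + 1) ^ A i)"

definition admissible_representation ::
  "complex set \<Rightarrow> nat \<Rightarrow> (nat \<Rightarrow> nat) \<Rightarrow> (nat \<Rightarrow> nat) \<Rightarrow> (nat \<Rightarrow> nat) \<Rightarrow> cpoly \<Rightarrow>
     complex \<Rightarrow> (nat list \<Rightarrow> complex) \<Rightarrow> bool" where
  "admissible_representation K p A n r P S lam \<longleftrightarrow>
     (\<forall>s. lam s \<in> K) \<and>
     finite {s. lam s \<noteq> 0} \<and>
     (\<forall>s. lam s \<noteq> 0 \<longrightarrow>
        length s \<le> p \<and> (\<forall>j\<in>{1..length s}. s ! (j - 1) \<ge> 1) \<and> (s \<noteq> [] \<longrightarrow> s ! 0 \<ge> 2)) \<and>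
     S = (\<Sum>s | lam s \<noteq> 0. lam s * of_real (mzeta s)) \<and>
     (\<forall>s. lam s \<noteq> 0 \<and> length s \<ge> 1 \<longrightarrow>
        (\<exists>l :: nat \<Rightarrow> nat. l 0 = 1 \<and> l (length s) = p + 1 \<and>
           (\<forall>j\<in>{1..length s}. l (j - 1) < l j) \<and>
           (\<forall>j\<in>{1..length s}. s ! (j - 1) \<le> (\<Sum>i = l (j - 1)..<l j. A i))) \<and>
        ((\<forall>i\<in>{1..<p}. r i \<ge> r (i + 1) + n (i + 1) + 1) \<longrightarrow>
           (\<exists>t :: nat \<Rightarrow> nat. strict_mono_on {1..length s} t \<and> t ` {1..length s} \<subseteq> {1..p} \<and>
              (\<forall>j\<in>{1..length s}. 1 \<le> s ! (j - 1) \<and> s ! (j - 1) \<le> A (t j))) \<and>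
           card {j \<in> {1..length s}. s ! (j - 1) = 1} \<le>
             card {i \<in> {1..p}. deg_in i P \<ge> ereal (real (A i * (n i + 1)) - 1)}))"

end

theory Submission
  imports Defs "HOL-Library.Sublist" "HOL-Computational_Algebra.Polynomial"
begin

text \<open>Expanding \<open>P\<close> into monomials and averaging each factor over the reflection
  \<open>k\<^sub>i \<mapsto> - k\<^sub>i - 2 r\<^sub>i - n\<^sub>i\<close> reduces the series to sums over \<open>k\<^sub>1 \<ge> \<dots> \<ge> k\<^sub>p \<ge> 1\<close> of products
  \<open>R\<^sub>1(k\<^sub>1) \<dots> R\<^sub>p(k\<^sub>p)\<close> with \<open>R\<^sub>i(- k - 2 r\<^sub>i - n\<^sub>i) = (-1)\<^sup>e\<^sup>i R\<^sub>i(k)\<close>. Any difference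
  \<open>R\<^sub>i(k) = U(k + 1) - U(k)\<close> telescopes, which multiplies a neighbouring factor by a value of
  \<open>U\<close> and lowers the depth. Polynomial parts are such differences and are removed first,
  because only afterwards do the individual terms of the partial fractions converge. Then, from the
  last variable to the first, all poles of \<open>R\<^sub>i\<close> are moved to \<open>- (p - i)\<close> modulo differences,
  and the remaining product of the \<open>C\<^sub>i\<^sub>,\<^sub>s / (k\<^sub>i + p - i)\<^sup>s\<close> sums to multiple zeta values.
  Tuples of length \<open>p\<close> arise only from products without any merging, where the reflection forces
  \<open>C\<^sub>i\<^sub>,\<^sub>s = 0\<close> unless \<open>s \<equiv> e\<^sub>i\<close> modulo 2. Merging two variables adds the pole orders, or takes their
  maximum when the poles are disjoint, which the hypothesis of (b) guarantees throughout.\<close>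

section \<open>Partial fractions with coefficients in a subfield\<close>

text \<open>All splittings take place on the truncated sums \<open>nested_sum\<close> with k_1 <= N,
  where telescoping is an exact identity; each piece is then shown to converge. The obstacle is that
  a series may converge while its partial fractions separately diverge, and two accounts control
  this. Growth: an antidifference of a polynomial has degree one more, but the merge that uses it
  removes one variable, so \<open>conv_ok\<close> is preserved exactly. Residues: when poles are
  moved, only the sum over all poles of the coefficients of 1 / (z + x)^s survives; for s = 1 this
  sum is the limit of k f(k) and vanishes as soon as f(k) = O(k^-2). This is what excludes s_1 = 1
  and bounds the number of ones. The target poles are dictated by the passage from weakly to
  strictly decreasing indices. The effect of merges on exponents is recorded in the relation
  \<open>adm\<close>, from which (a), (b) and the parity statement are extracted by rule
  induction.\<close>

locale subfield =
  fixes K :: "complex set"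
  assumes subfield: "complex_subfield K"
begin

lemma K_0 [simp, intro]: "0 \<in> K" and K_1 [simp, intro]: "1 \<in> K"
  using subfield by (auto simp: complex_subfield_def)

lemma K_add [intro]: "x \<in> K \<Longrightarrow> y \<in> K \<Longrightarrow> x + y \<in> K"
  and K_mult [intro]: "x \<in> K \<Longrightarrow> y \<in> K \<Longrightarrow> x * y \<in> K"
  and K_minus [intro]: "x \<in> K \<Longrightarrow> - x \<in> K"
  and K_inverse [intro]: "x \<in> K \<Longrightarrow> inverse x \<in> K"
  using subfield by (auto simp: complex_subfield_def)

lemma K_diff [intro]: "x \<in> K \<Longrightarrow> y \<in> K \<Longrightarrow> x - y \<in> K"
  using K_add[of x "- y"] by auto

lemma K_divide [intro]: "x \<in> K \<Longrightarrow> y \<in> K \<Longrightarrow> x / y \<in> K"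
  by (auto simp: divide_inverse)

lemma K_of_nat [simp, intro]: "of_nat m \<in> K"
  by (induction m) auto

lemma K_numeral [simp, intro]: "numeral m \<in> K"
  using K_of_nat[of "numeral m"] by simp

lemma K_power [intro]: "x \<in> K \<Longrightarrow> x ^ m \<in> K"
  by (induction m) auto

lemma K_sum [intro]: "(\<And>i. i \<in> I \<Longrightarrow> f i \<in> K) \<Longrightarrow> sum f I \<in> K"
  by (induction I rule: infinite_finite_induct) auto

definition poly_over :: "complex poly \<Rightarrow> bool" where
  "poly_over q \<longleftrightarrow> (\<forall>i. coeff q i \<in> K)"

lemma poly_over_0 [simp, intro]: "poly_over 0" and poly_over_1 [simp, intro]: "poly_over 1"
  by (auto simp: poly_over_def coeff_1)

lemma poly_over_pCons [simp]: "poly_over (pCons c q) \<longleftrightarrow> c \<in> K \<and> poly_over q"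
  by (auto simp: poly_over_def coeff_pCons split: nat.splits)

lemma poly_over_add [intro]: "poly_over q \<Longrightarrow> poly_over q' \<Longrightarrow> poly_over (q + q')"
  and poly_over_diff [intro]: "poly_over q \<Longrightarrow> poly_over q' \<Longrightarrow> poly_over (q - q')"
  and poly_over_smult [intro]: "c \<in> K \<Longrightarrow> poly_over q \<Longrightarrow> poly_over (smult c q)"
  by (auto simp: poly_over_def)

lemma poly_over_mult [intro]: "poly_over q \<Longrightarrow> poly_over q' \<Longrightarrow> poly_over (q * q')"
  by (auto simp: poly_over_def coeff_mult)

lemma poly_over_power [intro]: "poly_over q \<Longrightarrow> poly_over (q ^ m)"
  by (induction m) auto

lemma poly_over_pcompose [intro]: "poly_over q \<Longrightarrow> poly_over q' \<Longrightarrow> poly_over (pcompose q q')"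
  by (induction q) (auto simp: pcompose_pCons)

lemma poly_over_value: "poly_over q \<Longrightarrow> x \<in> K \<Longrightarrow> poly q x \<in> K"
  by (induction q) auto

lemma poly_over_monom [intro]: "c \<in> K \<Longrightarrow> poly_over (monom c d)"
  by (auto simp: poly_over_def)

end

text \<open>Division by zero yields 0 in HOL, so identities between rational functions are asserted
  only away from the allowed poles. Positive integers, the points where the series evaluates its
  factors, always qualify.\<close>

definition nonpole :: "(nat \<Rightarrow> nat) \<Rightarrow> complex \<Rightarrow> bool" where
  "nonpole a z \<longleftrightarrow> (\<forall>x. a x > 0 \<longrightarrow> z + of_nat x \<noteq> 0)"

lemma nonpoleD: "nonpole a z \<Longrightarrow> a x > 0 \<Longrightarrow> z + of_nat x \<noteq> 0"
  by (auto simp: nonpole_def)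

lemma nonpole_mono: "nonpole b z \<Longrightarrow> (\<And>x. a x \<le> b x) \<Longrightarrow> nonpole a z"
  by (meson nonpole_def order_less_le_trans)

lemma of_nat_add_neq_0: "k \<ge> 1 \<Longrightarrow> of_nat k + of_nat x \<noteq> (0 :: complex)"
  by (metis add_is_0 of_nat_add of_nat_eq_0_iff not_one_le_zero)

lemma nonpole_of_nat [simp]: "k \<ge> 1 \<Longrightarrow> nonpole a (of_nat k)"
  unfolding nonpole_def using of_nat_add_neq_0 by blast

text \<open>\<open>pf a f C\<close>: \<open>f\<close> is a \<open>K\<close>-combination of the functions \<open>1 / (z + x)\<^sup>s\<close> with \<open>1 \<le> s \<le> a x\<close>,
  and \<open>C s\<close> is the sum over \<open>x\<close> of the coefficients of \<open>1 / (z + x)\<^sup>s\<close>.\<close>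

inductive (in subfield) pf :: "(nat \<Rightarrow> nat) \<Rightarrow> (complex \<Rightarrow> complex) \<Rightarrow> (nat \<Rightarrow> complex) \<Rightarrow> bool"
  for a :: "nat \<Rightarrow> nat" where
  pf_zero: "(\<And>z. nonpole a z \<Longrightarrow> f z = 0) \<Longrightarrow> pf a f (\<lambda>_. 0)"
| pf_step: "pf a f C \<Longrightarrow> c \<in> K \<Longrightarrow> 1 \<le> s \<Longrightarrow> s \<le> a x \<Longrightarrow>
    (\<And>z. nonpole a z \<Longrightarrow> g z = f z + c / (z + of_nat x) ^ s) \<Longrightarrow> pf a g (C(s := C s + c))"

context subfield
begin

lemma pf_cong:
  assumes "pf a f C" and "\<And>z. nonpole a z \<Longrightarrow> g z = f z"
  shows "pf a g C"
  using assms
proof (induction rule: pf.induct)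
  case (pf_zero f)
  then show ?case by (intro pf.pf_zero) auto
next
  case (pf_step f C c s x h)
  show ?case
    by (rule pf.pf_step[OF pf_step.hyps(1-4)]) (use pf_step in auto)
qed

lemma pf_mono:
  assumes "pf a f C" and le: "\<And>x. a x \<le> b x"
  shows "pf b f C"
  using assms(1)
proof (induction rule: pf.induct)
  case (pf_zero f)
  then show ?case by (intro pf.pf_zero) (use le nonpole_mono in blast)
next
  case (pf_step f C c s x h)
  show ?case
    by (rule pf.pf_step[OF pf_step.IH pf_step.hyps(2,3)])
       (use pf_step le nonpole_mono in \<open>blast intro: order_trans\<close>)+
qed

lemma pf_term:
  assumes "c \<in> K" "1 \<le> s" "s \<le> a x"
  shows "pf a (\<lambda>z. c / (z + of_nat x) ^ s) ((\<lambda>_. 0)(s := c))"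
  using pf_step[OF pf_zero[of a "\<lambda>_. 0"], of c s x] assms by auto

lemma pf_add:
  assumes "pf a f C" and "pf a g D"
  shows "pf a (\<lambda>z. f z + g z) (\<lambda>s. C s + D s)"
  using assms(1)
proof (induction rule: pf.induct)
  case (pf_zero f)
  then show ?case using pf_cong[OF assms(2)] by simp
next
  case (pf_step f C c s x h)
  have "pf a (\<lambda>z. h z + g z) ((\<lambda>s. C s + D s)(s := (C s + D s) + c))"
    by (rule pf.pf_step[OF pf_step.IH pf_step.hyps(2-4)]) (use pf_step in auto)
  also have "(\<lambda>s. C s + D s)(s := (C s + D s) + c) = (\<lambda>t. (C(s := C s + c)) t + D t)"
    by auto
  finally show ?case .
qed

lemma pf_smult:
  assumes "pf a f C" and "d \<in> K"
  shows "pf a (\<lambda>z. d * f z) (\<lambda>s. d * C s)"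
  using assms(1)
proof (induction rule: pf.induct)
  case (pf_zero f)
  then show ?case using pf.pf_zero[of a "\<lambda>z. d * f z"] by simp
next
  case (pf_step f C c s x h)
  have "pf a (\<lambda>z. d * h z) ((\<lambda>s. d * C s)(s := d * C s + d * c))"
    by (rule pf.pf_step[OF pf_step.IH _ pf_step.hyps(3,4)])
       (use pf_step assms in \<open>auto simp: algebra_simps\<close>)
  also have "(\<lambda>s. d * C s)(s := d * C s + d * c) = (\<lambda>t. d * (C(s := C s + c)) t)"
    by (auto simp: algebra_simps)
  finally show ?case .
qed

lemma pf_value: "pf a f C \<Longrightarrow> k \<ge> 1 \<Longrightarrow> f (of_nat k) \<in> K"
  by (induction rule: pf.induct) (auto intro!: K_add K_divide K_power)

lemma pf_coeff_bound: "pf a f C \<Longrightarrow> (\<And>x. a x \<le> A) \<Longrightarrow> C s \<noteq> 0 \<Longrightarrow> 1 \<le> s \<and> s \<le> A"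
  by (induction arbitrary: s rule: pf.induct) (auto split: if_splits intro: order_trans)

lemma pf_coeff_in: "pf a f C \<Longrightarrow> C s \<in> K"
  by (induction arbitrary: s rule: pf.induct) auto

definition mf :: "(nat \<Rightarrow> nat) \<Rightarrow> (complex \<Rightarrow> complex) \<Rightarrow> (nat \<Rightarrow> complex) \<Rightarrow> bool" where
  "mf a f C \<longleftrightarrow> (\<exists>q g. poly_over q \<and> pf a g C \<and> (\<forall>z. nonpole a z \<longrightarrow> f z = poly q z + g z))"

text \<open>Products have no manageable formula for the coefficients \<open>C\<close>, so they are
  tracked with \<open>C\<close> forgotten; the facts needed about \<open>C\<close> come afterwards
  from growth or from the reflection.\<close>

definition mero :: "(nat \<Rightarrow> nat) \<Rightarrow> (complex \<Rightarrow> complex) \<Rightarrow> bool" where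
  "mero a f \<longleftrightarrow> (\<exists>C. mf a f C)"

lemma mf_cong: "mf a f C \<Longrightarrow> (\<And>z. nonpole a z \<Longrightarrow> g z = f z) \<Longrightarrow> mf a g C"
  unfolding mf_def by metis

lemma mf_mono:
  assumes "mf a f C" and "\<And>x. a x \<le> b x"
  shows "mf b f C"
  using assms pf_mono nonpole_mono unfolding mf_def by metis

lemma mf_add: "mf a f C \<Longrightarrow> mf a g D \<Longrightarrow> mf a (\<lambda>z. f z + g z) (\<lambda>s. C s + D s)"
proof -
  assume "mf a f C" "mf a g D"
  then obtain q f' r g' where "poly_over q" "pf a f' C" "poly_over r" "pf a g' D"
    and "\<forall>z. nonpole a z \<longrightarrow> f z = poly q z + f' z" "\<forall>z. nonpole a z \<longrightarrow> g z = poly r z + g' z"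
    by (auto simp: mf_def)
  then show ?thesis
    unfolding mf_def
    by (intro exI[of _ "q + r"] exI[of _ "\<lambda>z. f' z + g' z"]) (auto intro: pf_add)
qed

lemma mf_smult: "mf a f C \<Longrightarrow> d \<in> K \<Longrightarrow> mf a (\<lambda>z. d * f z) (\<lambda>s. d * C s)"
proof -
  assume d: "d \<in> K" and "mf a f C"
  then obtain q f' where "poly_over q" "pf a f' C" "\<forall>z. nonpole a z \<longrightarrow> f z = poly q z + f' z"
    by (auto simp: mf_def)
  then show ?thesis
    unfolding mf_def using d
    by (intro exI[of _ "smult d q"] exI[of _ "\<lambda>z. d * f' z"])
       (auto intro: pf_smult simp: algebra_simps)
qed

lemma mf_pf: "pf a f C \<Longrightarrow> mf a f C"
  unfolding mf_def by (intro exI[of _ 0] exI[of _ f]) auto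

lemma mero_cong: "mero a f \<Longrightarrow> (\<And>z. nonpole a z \<Longrightarrow> g z = f z) \<Longrightarrow> mero a g"
  unfolding mero_def using mf_cong by metis

lemma mero_mono: "mero a f \<Longrightarrow> (\<And>x. a x \<le> b x) \<Longrightarrow> mero b f"
  unfolding mero_def using mf_mono by metis

lemma mero_add: "mero a f \<Longrightarrow> mero a g \<Longrightarrow> mero a (\<lambda>z. f z + g z)"
  unfolding mero_def using mf_add by metis

lemma mero_smult: "mero a f \<Longrightarrow> d \<in> K \<Longrightarrow> mero a (\<lambda>z. d * f z)"
  unfolding mero_def using mf_smult by metis

lemma mero_pf: "pf a f C \<Longrightarrow> mero a f"
  unfolding mero_def using mf_pf by metis

lemma mero_poly: "poly_over q \<Longrightarrow> mero a (poly q)"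
  unfolding mero_def mf_def
  by (intro exI[of _ "\<lambda>_. 0"] exI[of _ q] exI[of _ "\<lambda>_. 0"]) (auto intro: pf_zero)

lemma mero_const: "c \<in> K \<Longrightarrow> mero a (\<lambda>_. c)"
  using mero_poly[of "[:c:]" a] by (simp add: mero_cong)

lemma mero_term:
  assumes "c \<in> K" "s \<le> a x"
  shows "mero a (\<lambda>z. c / (z + of_nat x) ^ s)"
proof (cases s)
  case 0
  then show ?thesis using mero_const[OF assms(1)] by simp
next
  case (Suc s')
  then show ?thesis using mero_pf[OF pf_term[OF assms(1), of s a x]] assms by simp
qed

text \<open>Uses z / (z + x)^s = 1 / (z + x)^(s-1) - x / (z + x)^s; for s = 1 the first summand is a
  constant and joins the polynomial part.\<close>

lemma mero_mult_id:
  assumes "mero a f"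
  shows "mero a (\<lambda>z. z * f z)"
proof -
  obtain q g C where q: "poly_over q" and g: "pf a g C"
    and f: "\<And>z. nonpole a z \<Longrightarrow> f z = poly q z + g z"
    using assms by (auto simp: mero_def mf_def)
  have "mero a (\<lambda>z. z * g z)"
    using g
  proof (induction rule: pf.induct)
    case (pf_zero f)
    then show ?case using mero_const[of 0 a] by (auto intro: mero_cong)
  next
    case (pf_step f C c s x h)
    have "mero a (\<lambda>z. z * f z + (c / (z + of_nat x) ^ (s - 1) + (- (c * of_nat x)) / (z + of_nat x) ^ s))"
      using pf_step by (intro mero_add mero_term) auto
    then show ?case
    proof (rule mero_cong)
      fix z assume z: "nonpole a z"
      have nz: "z + of_nat x \<noteq> 0" using nonpoleD[OF z, of x] pf_step by auto
      obtain s' where s': "s = Suc s'" using pf_step by (cases s) auto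
      have "z * c / (z + of_nat x) ^ s = c / (z + of_nat x) ^ (s - 1) + (- (c * of_nat x)) / (z + of_nat x) ^ s"
        using nz by (simp add: s' divide_simps) (simp add: algebra_simps)
      then show "z * h z = z * f z + (c / (z + of_nat x) ^ (s - 1) + (- (c * of_nat x)) / (z + of_nat x) ^ s)"
        using pf_step.hyps(5)[OF z] by (simp add: algebra_simps)
    qed
  qed
  then have "mero a (\<lambda>z. poly (pCons 0 q) z + z * g z)"
    using q by (intro mero_add mero_poly) auto
  then show ?thesis by (rule mero_cong) (auto simp: f algebra_simps)
qed

lemma mero_mult_poly:
  assumes "mero a f" and "poly_over q"
  shows "mero a (\<lambda>z. poly q z * f z)"
  using assms(2)
proof (induction q)
  case 0
  then show ?case using mero_const[of 0 a] by simp
next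
  case (pCons c q)
  then have "mero a (\<lambda>z. c * f z + z * (poly q z * f z))"
    using assms by (intro mero_add mero_smult mero_mult_id) auto
  then show ?case by (rule mero_cong) (simp add: algebra_simps)
qed

text \<open>For distinct poles, with u = z + x, v = z + y and d = v - u, the product 1 / (u v^(s+1))
  equals (1 / (u v^s) - 1 / v^(s+1)) / d, so induction on \<open>s\<close> raises the order at
  neither pole. For x = y the order becomes s + 1, for which the last assumption leaves
  room.\<close>

lemma mero_simple_mult_term:
  assumes "c \<in> K" "s \<le> b y" "0 < b x" and "x = y \<Longrightarrow> s < b x"
  shows "mero b (\<lambda>z. c / (z + of_nat y) ^ s * (1 / (z + of_nat x)))"
proof (cases "x = y")
  case True
  have "mero b (\<lambda>z. c / (z + of_nat x) ^ Suc s)"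
    using assms True by (intro mero_term) auto
  then show ?thesis by (rule mero_cong) (auto simp: True)
next
  case False
  show ?thesis
    using assms(2)
  proof (induction s)
    case 0
    show ?case using mero_term[OF assms(1), of 1 b x] assms by simp
  next
    case (Suc s)
    define d where "d = (of_nat y - of_nat x :: complex)"
    have d0: "d \<noteq> 0" using False by (simp add: d_def)
    have dK: "d \<in> K" by (auto simp: d_def)
    have "mero b (\<lambda>z. inverse d * (c / (z + of_nat y) ^ s * (1 / (z + of_nat x))
            + (- 1) * (c / (z + of_nat y) ^ Suc s)))"
      using Suc assms dK by (intro mero_smult mero_add mero_term) (auto intro: K_inverse K_minus)
    then show ?case
    proof (rule mero_cong)
      fix z assume z: "nonpole b z"
      define u where "u = z + of_nat x"
      define v where "v = z + of_nat y"
      have nz: "u \<noteq> 0" "v \<noteq> 0"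
        using nonpoleD[OF z, of x] nonpoleD[OF z, of y] assms Suc by (auto simp: u_def v_def)
      have d: "d = v - u" by (simp add: u_def v_def d_def)
      have "c / v ^ Suc s * (1 / u) = inverse d * (c / v ^ s * (1 / u) + (- 1) * (c / v ^ Suc s))"
        using nz d0 unfolding d by (simp add: divide_simps) (simp add: algebra_simps)
      then show "c / (z + of_nat y) ^ Suc s * (1 / (z + of_nat x)) =
          inverse d * (c / (z + of_nat y) ^ s * (1 / (z + of_nat x)) + (- 1) * (c / (z + of_nat y) ^ Suc s))"
        by (simp add: u_def v_def)
    qed
  qed
qed

lemma mero_mult_simple:
  assumes "mero a f"
  shows "mero (a(x := Suc (a x))) (\<lambda>z. f z * (1 / (z + of_nat x)))" (is "mero ?b _")
proof -
  obtain q g C where q: "poly_over q" and g: "pf a g C"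
    and f: "\<And>z. nonpole a z \<Longrightarrow> f z = poly q z + g z"
    using assms by (auto simp: mero_def mf_def)
  have np: "nonpole a z" if "nonpole ?b z" for z
    using nonpole_mono[OF that, of a] by auto
  have "mero ?b (\<lambda>z. g z * (1 / (z + of_nat x)))"
    using g
  proof (induction rule: pf.induct)
    case (pf_zero f)
    show ?case by (rule mero_cong[OF mero_const[of 0]]) (simp_all only: np pf_zero K_0 mult_zero_left)
  next
    case (pf_step f C c s y h)
    have "mero ?b (\<lambda>z. f z * (1 / (z + of_nat x)) + c / (z + of_nat y) ^ s * (1 / (z + of_nat x)))"
      by (rule mero_add[OF pf_step.IH mero_simple_mult_term]) (use pf_step.hyps in auto)
    then show ?case
      by (rule mero_cong) (use np pf_step in \<open>auto simp: algebra_simps\<close>)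
  qed
  moreover have "mero ?b (\<lambda>z. poly q z * (1 / (z + of_nat x) ^ 1))"
    using q by (intro mero_mult_poly mero_term) auto
  ultimately have "mero ?b (\<lambda>z. g z * (1 / (z + of_nat x)) + poly q z * (1 / (z + of_nat x) ^ 1))"
    by (rule mero_add)
  then show ?thesis
    by (rule mero_cong) (use np f in \<open>auto simp: algebra_simps add_divide_distrib\<close>)
qed

lemma mero_mult_term:
  assumes "mero a f" "s \<le> m"
  shows "mero (a(x := a x + m)) (\<lambda>z. f z * (1 / (z + of_nat x) ^ s))"
proof -
  have "mero (a(x := a x + s)) (\<lambda>z. f z * (1 / (z + of_nat x) ^ s))"
  proof (induction s)
    case 0
    then show ?case using assms by simp
  next
    case (Suc s)
    have "mero (a(x := a x + Suc s)) (\<lambda>z. f z * (1 / (z + of_nat x) ^ s) * (1 / (z + of_nat x)))"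
      by (rule mero_mono[OF mero_mult_simple[OF Suc, of x]]) auto
    then show ?case by (rule mero_cong) (simp add: field_simps)
  qed
  then show ?thesis by (rule mero_mono) (use assms in auto)
qed

lemma mero_mult:
  assumes "mero a f" and "mero b g"
  shows "mero (\<lambda>x. a x + b x) (\<lambda>z. f z * g z)" (is "mero ?b _")
proof -
  obtain q h C where q: "poly_over q" and h: "pf b h C"
    and g: "\<And>z. nonpole b z \<Longrightarrow> g z = poly q z + h z"
    using assms by (auto simp: mero_def mf_def)
  have np: "nonpole b z" if "nonpole ?b z" for z
    using nonpole_mono[OF that, of b] by auto
  have f': "mero ?b f" using mero_mono[OF assms(1)] by simp
  have "mero ?b (\<lambda>z. f z * h z)"
    using h
  proof (induction rule: pf.induct)
    case (pf_zero h)
    then show ?case using mero_const[of 0 ?b] np by (auto intro: mero_cong)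
  next
    case (pf_step h C c s y k)
    have "mero ?b (\<lambda>z. f z * (1 / (z + of_nat y) ^ s))"
      by (rule mero_mono[OF mero_mult_term[OF assms(1) pf_step.hyps(4)]]) auto
    then have "mero ?b (\<lambda>z. f z * h z + c * (f z * (1 / (z + of_nat y) ^ s)))"
      using pf_step by (intro mero_add mero_smult)
    then show ?case
      by (rule mero_cong) (use np pf_step in \<open>auto simp: algebra_simps\<close>)
  qed
  then have "mero ?b (\<lambda>z. f z * h z + poly q z * f z)"
    using q f' by (intro mero_add mero_mult_poly)
  then show ?thesis
    by (rule mero_cong) (use np g in \<open>auto simp: algebra_simps\<close>)
qed

end

section \<open>Growth at infinity\<close>

text \<open>Growth is measured along the positive integers only; a negative \<open>\<sigma>\<close>
  permits polynomial growth.\<close>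

definition decay :: "(complex \<Rightarrow> complex) \<Rightarrow> int \<Rightarrow> bool" where
  "decay f \<sigma> \<longleftrightarrow> (\<exists>C. \<forall>k\<ge>1. norm (f (of_nat k)) \<le> C * real k powi (- \<sigma>))"

lemma decayI: "(\<And>k. k \<ge> 1 \<Longrightarrow> norm (f (of_nat k)) \<le> C * real k powi (- \<sigma>)) \<Longrightarrow> decay f \<sigma>"
  unfolding decay_def by blast

lemma decayE:
  assumes "decay f \<sigma>"
  obtains C where "C \<ge> 0" "\<And>k. k \<ge> 1 \<Longrightarrow> norm (f (of_nat k)) \<le> C * real k powi (- \<sigma>)"
proof -
  obtain C where C: "\<And>k. k \<ge> 1 \<Longrightarrow> norm (f (of_nat k)) \<le> C * real k powi (- \<sigma>)"
    using assms unfolding decay_def by blast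
  have "norm (f (of_nat 1)) \<le> C"
    using C[of 1] by simp
  then have "C \<ge> 0" using norm_ge_zero order_trans by blast
  then show ?thesis using C that by blast
qed

lemma decay_mono:
  assumes "decay f \<sigma>" "\<tau> \<le> \<sigma>"
  shows "decay f \<tau>"
proof -
  obtain C where C: "C \<ge> 0" "\<And>k. k \<ge> 1 \<Longrightarrow> norm (f (of_nat k)) \<le> C * real k powi (- \<sigma>)"
    using decayE assms by blast
  show ?thesis
  proof (rule decayI)
    fix k :: nat assume k: "k \<ge> 1"
    have "real k powi (- \<sigma>) \<le> real k powi (- \<tau>)"
      using k assms by (intro power_int_increasing) auto
    then show "norm (f (of_nat k)) \<le> C * real k powi (- \<tau>)"
      using C k by (meson mult_left_mono order_trans)
  qed
qed

lemma decay_cong: "decay f \<sigma> \<Longrightarrow> (\<And>k. k \<ge> 1 \<Longrightarrow> g (of_nat k) = f (of_nat k)) \<Longrightarrow> decay g \<sigma>"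
  unfolding decay_def by auto

lemma decay_add:
  assumes "decay f \<sigma>" "decay g \<sigma>"
  shows "decay (\<lambda>z. f z + g z) \<sigma>"
proof -
  obtain C D where *: "\<And>k. k \<ge> 1 \<Longrightarrow> norm (f (of_nat k)) \<le> C * real k powi (- \<sigma>)"
    "\<And>k. k \<ge> 1 \<Longrightarrow> norm (g (of_nat k)) \<le> D * real k powi (- \<sigma>)"
    using assms by (metis decayE)
  show ?thesis
    by (rule decayI[of _ "C + D"]) (auto intro!: norm_triangle_le add_mono * simp: distrib_right)
qed

lemma decay_mult:
  assumes "decay f \<sigma>" "decay g \<tau>"
  shows "decay (\<lambda>z. f z * g z) (\<sigma> + \<tau>)"
proof -
  obtain C where C: "C \<ge> 0" "\<And>k. k \<ge> 1 \<Longrightarrow> norm (f (of_nat k)) \<le> C * real k powi (- \<sigma>)"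
    using assms by (metis decayE)
  obtain D where D: "D \<ge> 0" "\<And>k. k \<ge> 1 \<Longrightarrow> norm (g (of_nat k)) \<le> D * real k powi (- \<tau>)"
    using assms by (metis decayE)
  show ?thesis
  proof (rule decayI)
    fix k :: nat assume k: "k \<ge> 1"
    have "norm (f (of_nat k) * g (of_nat k)) \<le> (C * real k powi (- \<sigma>)) * (D * real k powi (- \<tau>))"
      unfolding norm_mult using C D k by (intro mult_mono) auto
    also have "\<dots> = C * D * (real k powi (- \<sigma> + - \<tau>))"
      using k by (subst power_int_add) auto
    finally show "norm (f (of_nat k) * g (of_nat k)) \<le> C * D * real k powi (- (\<sigma> + \<tau>))"
      by (simp add: algebra_simps)
  qed
qed

lemma decay_const: "decay (\<lambda>_. c) 0"
  by (rule decayI[of _ "norm c"]) auto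

lemma decay_smult: "decay f \<sigma> \<Longrightarrow> decay (\<lambda>z. c * f z) \<sigma>"
  using decay_mult[OF decay_const[of c]] by simp

lemma decay_power: "decay f \<sigma> \<Longrightarrow> decay (\<lambda>z. f z ^ m) (int m * \<sigma>)"
proof (induction m)
  case 0
  then show ?case using decay_const[of 1] by simp
next
  case (Suc m)
  then have "decay (\<lambda>z. f z * f z ^ m) (\<sigma> + int m * \<sigma>)" by (intro decay_mult)
  then show ?case by (simp add: algebra_simps)
qed

lemma decay_id: "decay (\<lambda>z. z) (- 1)"
  by (rule decayI[of _ 1]) auto

lemma decay_term: "decay (\<lambda>z. 1 / (z + of_nat x)) 1"
proof (rule decayI)
  fix k :: nat assume k: "k \<ge> 1"
  have "norm (1 / (of_nat k + of_nat x :: complex)) = 1 / real (k + x)"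
    unfolding of_nat_add[symmetric] norm_divide norm_one norm_of_nat ..
  also have "\<dots> \<le> 1 / real k"
    using k by (intro divide_left_mono) auto
  finally show "norm (1 / (of_nat k + of_nat x :: complex)) \<le> 1 * real k powi (- 1)"
    by (simp add: power_int_minus field_simps)
qed

lemma decay_term_power: "s \<ge> 1 \<Longrightarrow> decay (\<lambda>z. c / (z + of_nat x) ^ s) (int s)"
  using decay_smult[OF decay_power[OF decay_term[of x], of s], of c] by (simp add: power_divide)

lemma decay_poly: "degree q \<le> d \<Longrightarrow> decay (poly q) (- int d)"
proof (induction q arbitrary: d)
  case 0
  then show ?case by (intro decayI[of _ 0]) auto
next
  case (pCons c q)
  have c: "decay (\<lambda>_. c) (- int d)" by (rule decay_mono[OF decay_const]) simp
  show ?case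
  proof (cases "q = 0")
    case True
    then show ?thesis using c by (auto intro: decay_cong)
  next
    case False
    then obtain d' where d: "d = Suc d'" "degree q \<le> d'" using pCons.prems by (cases d) auto
    have "decay (\<lambda>z. c + z * poly q z) (- int d)"
      using decay_add[OF c, of "\<lambda>z. z * poly q z"] decay_mult[OF decay_id pCons.IH[OF d(2)]] d(1) by simp
    then show ?thesis by simp
  qed
qed

lemma poly_over_power_tendsto:
  fixes q :: "complex poly"
  assumes "degree q \<le> d"
  shows "(\<lambda>k. poly q (of_nat k) / of_nat k ^ d) \<longlonglongrightarrow> coeff q d"
proof -
  have *: "(\<lambda>k. coeff q i * (of_nat k ^ i / of_nat k ^ d)) \<longlonglongrightarrow> (if i = d then coeff q i else 0)"
    if "i \<in> {..d}" for i
  proof (cases "i = d")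
    case True
    have "(\<lambda>k. coeff q i * (of_nat k ^ i / of_nat k ^ d)) \<longlonglongrightarrow> coeff q i"
      by (rule tendsto_eventually) (auto simp: True intro: eventually_sequentiallyI[of 1])
    then show ?thesis by (simp add: True)
  next
    case False
    then have i: "i < d" using that by auto
    have "(\<lambda>k. inverse (of_nat k :: complex) ^ (d - i)) \<longlonglongrightarrow> 0 ^ (d - i)"
      by (intro tendsto_intros lim_inverse_n)
    then have "(\<lambda>k. coeff q i * inverse (of_nat k :: complex) ^ (d - i)) \<longlonglongrightarrow> coeff q i * 0"
      using i by (intro tendsto_mult_left) (auto simp: zero_power)
    moreover have "eventually (\<lambda>k. coeff q i * (of_nat k ^ i / of_nat k ^ d)
        = coeff q i * inverse (of_nat k :: complex) ^ (d - i)) sequentially"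
      using i by (intro eventually_sequentiallyI[of 1]) (simp add: power_diff field_simps)
    ultimately show ?thesis using False by (simp add: tendsto_cong)
  qed
  have "(\<lambda>k. \<Sum>i\<le>d. coeff q i * (of_nat k ^ i / of_nat k ^ d)) \<longlonglongrightarrow> (\<Sum>i\<le>d. if i = d then coeff q i else 0)"
    using * by (intro tendsto_sum) auto
  moreover have "poly q z = (\<Sum>i\<le>d. coeff q i * z ^ i)" for z
    unfolding poly_altdef using assms by (intro sum.mono_neutral_left) (auto simp: coeff_eq_0)
  ultimately show ?thesis by (simp add: sum_divide_distrib)
qed

text \<open>The leading coefficient is the limit of q(k) / k^(deg q), which the growth bound would
  force to 0 if the degree exceeded \<open>m\<close>.\<close>

lemma degree_le_of_decay:
  assumes "decay (poly q) (- int m)"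
  shows "degree q \<le> m"
proof (rule ccontr)
  assume "\<not> degree q \<le> m"
  then have m: "m < degree q" by simp
  obtain C where C: "\<And>k. k \<ge> 1 \<Longrightarrow> norm (poly q (of_nat k)) \<le> C * real k powi (- (- int m))"
    using decayE assms by metis
  have "(\<lambda>k. C * inverse (real k) ^ (degree q - m)) \<longlonglongrightarrow> C * 0 ^ (degree q - m)"
    by (intro tendsto_intros lim_inverse_n)
  then have lim: "(\<lambda>k. C * inverse (real k) ^ (degree q - m)) \<longlonglongrightarrow> 0"
    using m by (simp add: zero_power)
  have "(\<lambda>k. poly q (of_nat k) / of_nat k ^ degree q) \<longlonglongrightarrow> 0"
  proof (rule Lim_null_comparison[OF _ lim])
    show "eventually (\<lambda>k. norm (poly q (of_nat k) / of_nat k ^ degree q) \<le> C * inverse (real k) ^ (degree q - m)) sequentially"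
    proof (rule eventually_sequentiallyI[of 1])
      fix k :: nat assume k: "1 \<le> k"
      have "norm (poly q (of_nat k) / of_nat k ^ degree q) \<le> C * real k ^ m / real k ^ degree q"
        using C[OF k] by (simp add: norm_divide norm_power divide_right_mono)
      also have "\<dots> = C * inverse (real k) ^ (degree q - m)"
        using k m by (simp add: power_diff field_simps)
      finally show "norm (poly q (of_nat k) / of_nat k ^ degree q) \<le> C * inverse (real k) ^ (degree q - m)" .
    qed
  qed
  then have "coeff q (degree q) = 0"
    using poly_over_power_tendsto[of q "degree q"] LIMSEQ_unique by blast
  then show False using m by auto
qed

context subfield
begin

lemma pf_decay: "pf a f C \<Longrightarrow> decay f 1"
proof (induction rule: pf.induct)
  case (pf_zero f)
  show ?case by (rule decayI[of _ 0]) (use pf_zero in auto)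
next
  case (pf_step f C c s x g)
  have "decay (\<lambda>z. f z + c / (z + of_nat x) ^ s) 1"
    by (rule decay_add[OF pf_step.IH decay_mono[OF decay_term_power]]) (use pf_step in auto)
  then show ?case by (rule decay_cong) (use pf_step in auto)
qed

text \<open>Multiplied by k, a term c / (k + x)^s tends to c for s = 1 and to 0 otherwise. The sum
  of the residues can thus be read off the growth of \<open>f\<close>.\<close>

lemma pf_limit: "pf a f C \<Longrightarrow> (\<lambda>k. of_nat k * f (of_nat k)) \<longlonglongrightarrow> C 1"
proof (induction rule: pf.induct)
  case (pf_zero f)
  show ?case
    by (rule tendsto_eventually, rule eventually_sequentiallyI[of 1]) (use pf_zero in auto)
next
  case (pf_step f C c s x g)
  have one: "(\<lambda>k. of_nat k / (of_nat k + of_nat x :: complex)) \<longlonglongrightarrow> 1"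
  proof -
    have "(\<lambda>k. 1 - of_nat x * (inverse (of_nat (k + x)) :: complex)) \<longlonglongrightarrow> 1 - of_nat x * 0"
      by (intro tendsto_intros LIMSEQ_ignore_initial_segment lim_inverse_n)
    then have "(\<lambda>k. 1 - of_nat x * (inverse (of_nat (k + x)) :: complex)) \<longlonglongrightarrow> 1" by simp
    then show ?thesis
    proof (rule Lim_transform_eventually)
      show "eventually (\<lambda>k. 1 - of_nat x * (inverse (of_nat (k + x)) :: complex)
          = of_nat k / (of_nat k + of_nat x)) sequentially"
      proof (rule eventually_sequentiallyI[of 1])
        fix k :: nat assume "1 \<le> k"
        then show "1 - of_nat x * (inverse (of_nat (k + x)) :: complex) = of_nat k / (of_nat k + of_nat x)"
          using of_nat_add_neq_0[of k x] by (simp add: field_simps)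
      qed
    qed
  qed
  have zero: "(\<lambda>k. 1 / (of_nat k + of_nat x :: complex)) \<longlonglongrightarrow> 0"
    using LIMSEQ_ignore_initial_segment[OF lim_inverse_n, of x] by (simp add: divide_inverse)
  have "(\<lambda>k. c * ((of_nat k / (of_nat k + of_nat x :: complex)) * (1 / (of_nat k + of_nat x :: complex)) ^ (s - 1)))
      \<longlonglongrightarrow> c * (1 * 0 ^ (s - 1))"
    by (intro tendsto_intros one zero)
  moreover have "c * (1 * 0 ^ (s - 1)) = (if s = 1 then c else 0)" using pf_step by auto
  moreover have "(\<lambda>k. c * ((of_nat k / (of_nat k + of_nat x :: complex)) * (1 / (of_nat k + of_nat x :: complex)) ^ (s - 1)))
     = (\<lambda>k. of_nat k * (c / (of_nat k + of_nat x) ^ s))"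
    using pf_step by (cases s) (auto simp: power_divide)
  ultimately have "(\<lambda>k. of_nat k * f (of_nat k) + of_nat k * (c / (of_nat k + of_nat x) ^ s))
      \<longlonglongrightarrow> C 1 + (if s = 1 then c else 0)"
    using pf_step.IH by (intro tendsto_add) simp_all
  then have "(\<lambda>k. of_nat k * g (of_nat k)) \<longlonglongrightarrow> C 1 + (if s = 1 then c else 0)"
    by (rule Lim_transform_eventually)
       (use pf_step in \<open>auto intro!: eventually_sequentiallyI[of 1] simp: distrib_left\<close>)
  then show ?case by (auto split: if_splits)
qed

text \<open>This is the source of the flags: a factor of size O(k^-2) contributes no exponent
  1.\<close>

lemma pf_residue_zero:
  assumes "pf a f C" "decay f 2"
  shows "C 1 = 0"
proof -
  obtain D where D: "\<And>k. k \<ge> 1 \<Longrightarrow> norm (f (of_nat k)) \<le> D * real k powi (- 2)"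
    using decayE assms by metis
  have lim: "(\<lambda>k. D * inverse (real k)) \<longlonglongrightarrow> 0"
    using tendsto_mult_left[OF lim_inverse_n] by force
  have "(\<lambda>k. of_nat k * f (of_nat k)) \<longlonglongrightarrow> 0"
  proof (rule Lim_null_comparison[OF _ lim], rule eventually_sequentiallyI[of 1])
    fix k :: nat assume k: "1 \<le> k"
    have "norm (of_nat k * f (of_nat k)) \<le> real k * (D * real k powi (- 2))"
      unfolding norm_mult norm_of_nat by (intro mult_left_mono D k) auto
    also have "\<dots> = D * inverse (real k)"
      using k by (simp add: power_int_minus field_simps power2_eq_square)
    finally show "norm (of_nat k * f (of_nat k)) \<le> D * inverse (real k)" .
  qed
  then show ?thesis using pf_limit[OF assms(1)] LIMSEQ_unique by blast
qed

text \<open>The fractional part is O(1/k), so the polynomial part grows no faster than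
  \<open>f\<close> itself.\<close>

lemma mf_split:
  assumes "mf a f C" "decay f (- int m)"
  obtains q g where "poly_over q" "degree q \<le> m" "pf a g C"
    "\<And>z. nonpole a z \<Longrightarrow> f z = poly q z + g z"
proof -
  obtain q g where qg: "poly_over q" "pf a g C" "\<And>z. nonpole a z \<Longrightarrow> f z = poly q z + g z"
    using assms by (auto simp: mf_def)
  have "decay g (- int m)" by (rule decay_mono[OF pf_decay[OF qg(2)]]) simp
  then have "decay (\<lambda>z. f z + (- 1) * g z) (- int m)"
    by (intro decay_add decay_smult assms)
  then have "decay (poly q) (- int m)"
    by (rule decay_cong) (use qg in auto)
  then show ?thesis using degree_le_of_decay qg that by blast
qed

lemma mf_proper:
  assumes "mf a f C" "decay f 1"
  shows "pf a f C"
proof -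
  have "decay f (- int 0)" by (rule decay_mono[OF assms(2)]) simp
  then obtain q g where qg: "poly_over q" "degree q \<le> 0" "pf a g C"
    "\<And>z. nonpole a z \<Longrightarrow> f z = poly q z + g z"
    using mf_split[OF assms(1)] by metis
  obtain c where c: "q = [:c:]" using qg(2) by (metis degree_0_id le_zero_eq)
  have "decay (\<lambda>z. f z + (- 1) * g z) 1"
    by (intro decay_add decay_smult assms pf_decay[OF qg(3)])
  then have "decay (\<lambda>_. c) 1" by (rule decay_cong) (use qg c in auto)
  then obtain D where D: "\<And>k. k \<ge> 1 \<Longrightarrow> norm c \<le> D * real k powi (- 1)" by (metis decayE)
  have "(\<lambda>k. D * inverse (real k)) \<longlonglongrightarrow> D * 0"
    by (intro tendsto_intros lim_inverse_n)
  then have "norm c \<le> D * 0"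
    by (rule tendsto_lowerbound) (auto intro!: eventually_sequentiallyI[of 1] dest: D simp: power_int_minus)
  then have "c = 0" by simp
  then show ?thesis using pf_cong[OF qg(3)] qg(4) c by simp
qed

text \<open>Induction on the degree bound: subtracting the difference of c z^(d+1) removes the
  coefficient of z^d. The gain of one in the degree is what the convergence count in
  \<open>represented_cells\<close> has to absorb.\<close>

lemma poly_antidifference_aux:
  assumes "poly_over q" "\<And>i. i \<ge> d \<Longrightarrow> coeff q i = 0"
  shows "\<exists>B. poly_over B \<and> degree B \<le> d \<and> (\<forall>z. poly B (z + 1) - poly B z = poly q z)"
  using assms
proof (induction d arbitrary: q)
  case 0
  then have "q = 0" by (auto intro: poly_eqI)
  then show ?case by (intro exI[of _ 0]) auto
next
  case (Suc d)
  \<comment> \<open>The leading coefficient of (z + 1)^(d+1) - z^(d+1) is d + 1, and division by it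
    stays inside \<open>K\<close>, which contains the rationals.\<close>
  define c where "c = coeff q d / of_nat (Suc d)"
  have c: "c \<in> K" using Suc.prems(1) by (auto simp: c_def poly_over_def simp del: of_nat_Suc)
  define M where "M = smult c ([:0, 1:] ^ Suc d)"
  define D where "D = smult c ([:1, 1:] ^ Suc d) - M"
  have coeffD: "coeff D i = c * (of_nat (Suc d choose i)) - (if i = Suc d then c else 0)" for i
  proof -
    have "coeff ([:0, 1:] ^ Suc d) i = (if i = Suc d then 1 else 0 :: complex)"
      by (metis coeff_monom monom_altdef smult_1_left)
    moreover have "coeff ([:1, 1:] ^ Suc d) i = (of_nat (Suc d choose i) :: complex)"
    proof (cases "i \<le> Suc d")
      case True
      then show ?thesis using coeff_linear_poly_power[of i "Suc d" "1::complex" 1] by (simp del: power_Suc binomial_Suc_Suc)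
    next
      case False
      then show ?thesis by (simp add: coeff_eq_0 degree_linear_power binomial_eq_0 del: power_Suc binomial_Suc_Suc)
    qed
    ultimately show ?thesis by (simp add: D_def M_def del: power_Suc)
  qed
  have K: "poly_over M" "poly_over D"
    using c by (auto simp: D_def M_def intro!: poly_over_smult poly_over_diff poly_over_power simp del: power_Suc)
  have "coeff (q - D) i = 0" if "i \<ge> d" for i
  proof -
    have "i = d \<or> i = Suc d \<or> i > Suc d" using that by linarith
    then show ?thesis
      by (elim disjE) (use Suc.prems(2)[of i] that in
        \<open>auto simp: coeffD c_def binomial_eq_0 simp del: of_nat_Suc binomial_Suc_Suc\<close>)
  qed
  then obtain B where B: "poly_over B" "degree B \<le> d" "\<And>z. poly B (z + 1) - poly B z = poly (q - D) z"
    using Suc.IH[of "q - D"] Suc.prems K by blast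
  have "degree M \<le> Suc d"
    unfolding M_def by (rule order_trans[OF degree_smult_le]) (simp add: degree_linear_power del: power_Suc)
  moreover have "poly M (z + 1) - poly M z = poly D z" for z
    by (simp add: D_def M_def add.commute del: power_Suc)
  ultimately show ?case using B K
    by (intro exI[of _ "B + M"]) (auto intro!: degree_add_le simp: algebra_simps)
qed

lemma poly_antidifference:
  assumes "poly_over q"
  obtains B where "poly_over B" "degree B \<le> Suc (degree q)" "\<And>z. poly B (z + 1) - poly B z = poly q z"
  using poly_antidifference_aux[OF assms, of "Suc (degree q)"] coeff_eq_0[of q] by (metis less_eq_Suc_le)

end

section \<open>Nested sums and series over chains\<close>

text \<open>The truncation at \<open>N\<close> turns telescoping into an exact identity with an
  explicit boundary term.\<close>

fun nested_sum :: "(nat \<Rightarrow> 'a::comm_ring_1) list \<Rightarrow> nat \<Rightarrow> 'a" where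
  "nested_sum [] N = 1"
| "nested_sum (f # fs) N = (\<Sum>k=1..N. f k * nested_sum fs k)"

lemma nested_sum_Suc: "nested_sum (f # fs) (Suc N) = nested_sum (f # fs) N + f (Suc N) * nested_sum fs (Suc N)"
  by simp

lemma nested_sum_cong:
  "list_all2 (\<lambda>f g. \<forall>k\<ge>1. f k = g k) fs gs \<Longrightarrow> nested_sum fs N = nested_sum gs N"
  by (induction arbitrary: N rule: list_all2_induct) (auto intro!: sum.cong)

text \<open>A nested sum depends linearly on the values of its tail at all upper bounds
  \<open>k\<close>, so an identity between tails passes through any prefix; the telescoping rules
  below need checking only near the head.\<close>

lemma nested_sum_prefix_add:
  "(\<And>k. nested_sum fs k = nested_sum gs k + nested_sum hs k) \<Longrightarrow> nested_sum (xs @ fs) N = nested_sum (xs @ gs) N + nested_sum (xs @ hs) N"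
  by (induction xs arbitrary: N) (simp_all add: distrib_left sum.distrib)

lemma nested_sum_prefix_smult:
  "(\<And>k. nested_sum fs k = c * nested_sum gs k) \<Longrightarrow> nested_sum (xs @ fs) N = c * nested_sum (xs @ gs) N"
  by (induction xs arbitrary: N) (auto simp: algebra_simps sum_distrib_left)

lemma nested_sum_prefix_diff:
  "(\<And>k. nested_sum fs k = nested_sum gs k - nested_sum hs k) \<Longrightarrow> nested_sum (xs @ fs) N = nested_sum (xs @ gs) N - nested_sum (xs @ hs) N"
  by (induction xs arbitrary: N) (simp_all add: right_diff_distrib sum_subtractf)

lemma nested_sum_add:
  "nested_sum (xs @ (\<lambda>k. f k + g k) # ys) N = nested_sum (xs @ f # ys) N + nested_sum (xs @ g # ys) N"
  by (rule nested_sum_prefix_add) (simp add: algebra_simps sum.distrib)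

lemma nested_sum_smult: "nested_sum (xs @ (\<lambda>k. c * f k) # ys) N = c * nested_sum (xs @ f # ys) N"
  by (rule nested_sum_prefix_smult) (simp add: algebra_simps sum_distrib_left)

lemma nested_sum_telescope_single: "nested_sum [\<lambda>k. U (Suc k) - U k] N = U (Suc N) - U 1"
  by (induction N) auto

text \<open>As k_1 runs from k_2 to \<open>N\<close>, the differences add up to U(N + 1) - U(k_2): a
  boundary term and a merge of \<open>U\<close> into the next factor.\<close>

lemma nested_sum_telescope:
  "nested_sum ((\<lambda>k. U (Suc k) - U k) # g # gs) N
     = U (Suc N) * nested_sum (g # gs) N - nested_sum ((\<lambda>k. U k * g k) # gs) N"
proof (induction N)
  case (Suc N)
  then show ?case
    unfolding nested_sum_Suc[of _ _ N] by (simp add: algebra_simps)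
qed simp

text \<open>The innermost index runs from 1 to its predecessor l and leaves U(l + 1) - U(1).\<close>

lemma nested_sum_telescope_last:
  "nested_sum (xs @ [f, \<lambda>k. U (Suc k) - U k]) N
     = nested_sum (xs @ [\<lambda>k. f k * U (Suc k)]) N - U 1 * nested_sum (xs @ [f]) N"
proof -
  have "nested_sum (xs @ [f, \<lambda>k. U (Suc k) - U k]) N
     = nested_sum (xs @ [\<lambda>k. f k * U (Suc k)]) N - nested_sum (xs @ [\<lambda>k. U 1 * f k]) N"
  proof (rule nested_sum_prefix_diff)
    fix k
    have "nested_sum [f, \<lambda>k. U (Suc k) - U k] k = (\<Sum>l=1..k. f l * (U (Suc l) - U 1))"
      using nested_sum_telescope_single[of U] by simp
    then show "nested_sum [f, \<lambda>k. U (Suc k) - U k] k = nested_sum [\<lambda>k. f k * U (Suc k)] k - nested_sum [\<lambda>k. U 1 * f k] k"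
      by (simp add: algebra_simps sum_subtractf)
  qed
  then show ?thesis by (simp add: nested_sum_smult)
qed

text \<open>Here the index runs between its two neighbours, k' below and l above, and leaves U(l +
  1) - U(k'). The asymmetric shift by one reappears in the two pole sets of
  \<open>pf_telescope\<close>.\<close>

lemma nested_sum_telescope_mid:
  "nested_sum (xs @ f # (\<lambda>k. U (Suc k) - U k) # g # gs) N
     = nested_sum (xs @ (\<lambda>k. f k * U (Suc k)) # g # gs) N - nested_sum (xs @ f # (\<lambda>k. U k * g k) # gs) N"
proof (rule nested_sum_prefix_diff)
  fix k
  have "nested_sum (f # (\<lambda>k. U (Suc k) - U k) # g # gs) k =
      (\<Sum>l=1..k. f l * (U (Suc l) * nested_sum (g # gs) l - nested_sum ((\<lambda>k. U k * g k) # gs) l))"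
    unfolding nested_sum.simps(2)[of f] nested_sum_telescope ..
  then show "nested_sum (f # (\<lambda>k. U (Suc k) - U k) # g # gs) k
     = nested_sum ((\<lambda>k. f k * U (Suc k)) # g # gs) k - nested_sum (f # (\<lambda>k. U k * g k) # gs) k"
    by (simp add: algebra_simps sum_subtractf)
qed

lemma sum_inverse_sqrt: "(\<Sum>k=1..N. 1 / sqrt (real k)) \<le> 2 * sqrt (real N)"
proof (induction N)
  case (Suc N)
  define a b where "a = sqrt (real N)" and "b = sqrt (real (Suc N))"
  have ab: "0 \<le> a" "a \<le> b" "0 < b" "b\<^sup>2 = a\<^sup>2 + 1" by (auto simp: a_def b_def)
  \<comment> \<open>Here (b - a)(b + a) = 1, while b + a is at most 2 b.\<close>
  have "(b - a) * (2 * b) \<ge> (b - a) * (b + a)"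
    using ab by (intro mult_left_mono) auto
  then have "(b - a) * (2 * b) \<ge> 1" using ab by (simp add: algebra_simps power2_eq_square)
  then have "1 / b \<le> 2 * b - 2 * a" using ab by (simp add: field_simps)
  then show ?case using Suc by (simp add: a_def b_def del: of_nat_Suc)
qed simp

text \<open>Each extra summation only costs a constant factor, since
  \<open>\<Sum>k\<le>N. k\<^sup>-\<^sup>1 k\<^sup>1\<^sup>/\<^sup>2 = O(N\<^sup>1\<^sup>/\<^sup>2)\<close>.\<close>

lemma nested_sum_sqrt_bound:
  fixes fs :: "(nat \<Rightarrow> 'a::{comm_ring_1, real_normed_algebra_1}) list"
  assumes "\<And>f. f \<in> set fs \<Longrightarrow> \<exists>C. \<forall>k\<ge>1. norm (f k) \<le> C / real k"
  shows "\<exists>C\<ge>0. \<forall>N\<ge>1. norm (nested_sum fs N) \<le> C * sqrt (real N)"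
  using assms
proof (induction fs)
  case Nil
  show ?case by (intro exI[of _ 1]) auto
next
  case (Cons f fs)
  obtain D where D: "D \<ge> 0" "\<And>N. N \<ge> 1 \<Longrightarrow> norm (nested_sum fs N) \<le> D * sqrt (real N)"
    using Cons by auto
  obtain C where C: "\<And>k. k \<ge> 1 \<Longrightarrow> norm (f k) \<le> C / real k"
    using Cons.prems[of f] by auto
  have C0: "C \<ge> 0" using C[of 1] norm_ge_zero[of "f 1"] by (simp del: norm_ge_zero)
  have "norm (nested_sum (f # fs) N) \<le> (2 * C * D) * sqrt (real N)" for N
  proof -
    have "norm (nested_sum (f # fs) N) \<le> (\<Sum>k=1..N. (C * D) * (1 / sqrt (real k)))"
      unfolding nested_sum.simps
    proof (rule sum_norm_le)
      fix k assume "k \<in> {1..N}"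
      then have k: "k \<ge> 1" by simp
      have "norm (f k * nested_sum fs k) \<le> (C / real k) * (D * sqrt (real k))"
        by (rule order_trans[OF norm_mult_ineq mult_mono[OF C[OF k] D(2)[OF k]]]) (use C0 in auto)
      also have "\<dots> = C * D * (1 / sqrt (real k))"
        using k by (simp add: field_simps)
      finally show "norm (f k * nested_sum fs k) \<le> C * D * (1 / sqrt (real k))" .
    qed
    also have "\<dots> = (C * D) * (\<Sum>k=1..N. 1 / sqrt (real k))" by (simp add: sum_distrib_left)
    also have "\<dots> \<le> (C * D) * (2 * sqrt (real N))"
      using C0 D by (intro mult_left_mono sum_inverse_sqrt) auto
    finally show ?thesis by simp
  qed
  then show ?case using C0 D by (intro exI[of _ "2 * C * D"]) auto
qed

text \<open>The outer factor O(k^-2) times the inner growth O(k^(1/2)) leaves the summable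
  O(k^(-3/2)).\<close>

lemma nested_sum_bounded:
  fixes fs :: "(nat \<Rightarrow> 'a::{comm_ring_1, real_normed_algebra_1}) list"
  assumes "\<And>g. g \<in> set fs \<Longrightarrow> \<exists>C. \<forall>k\<ge>1. norm (g k) \<le> C / real k"
    and "\<And>k. k \<ge> 1 \<Longrightarrow> norm (f k) \<le> C / (real k)\<^sup>2"
  shows "\<exists>B. \<forall>N. norm (nested_sum (f # fs) N) \<le> B"
proof -
  obtain D where D: "D \<ge> 0" "\<And>N. N \<ge> 1 \<Longrightarrow> norm (nested_sum fs N) \<le> D * sqrt (real N)"
    using nested_sum_sqrt_bound[of fs] assms(1) by blast
  have C0: "C \<ge> 0" using assms(2)[of 1] norm_ge_zero[of "f 1"] by (simp del: norm_ge_zero)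
  have sm: "summable (\<lambda>k. real k powr (- 3 / 2))"
    by (simp add: summable_real_powr_iff)
  have "norm (nested_sum (f # fs) N) \<le> C * D * suminf (\<lambda>k. real k powr (- 3 / 2))" for N
  proof -
    have "norm (nested_sum (f # fs) N) \<le> (\<Sum>k=1..N. (C * D) * real k powr (- 3 / 2))"
      unfolding nested_sum.simps
    proof (rule sum_norm_le)
      fix k assume "k \<in> {1..N}"
      then have k: "k \<ge> 1" by simp
      have "norm (f k * nested_sum fs k) \<le> (C / (real k)\<^sup>2) * (D * sqrt (real k))"
        by (rule order_trans[OF norm_mult_ineq mult_mono[OF assms(2)[OF k] D(2)[OF k]]]) (use C0 in auto)
      also have "\<dots> = C * D * (real k powr (1 / 2) / real k powr 2)"
        using k by (simp add: powr_half_sqrt)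
      also have "\<dots> = C * D * real k powr (- 3 / 2)"
        unfolding powr_diff[symmetric] by simp
      finally show "norm (f k * nested_sum fs k) \<le> C * D * real k powr (- 3 / 2)" .
    qed
    also have "\<dots> = (C * D) * (\<Sum>k=1..N. real k powr (- 3 / 2))" by (simp add: sum_distrib_left)
    also have "\<dots> \<le> (C * D) * suminf (\<lambda>k. real k powr (- 3 / 2))"
      using C0 D by (intro mult_left_mono sum_le_suminf sm) auto
    finally show ?thesis .
  qed
  then show ?thesis by blast
qed

section \<open>Unordered sums over chains as limits of nested sums\<close>

definition chains :: "nat \<Rightarrow> nat \<Rightarrow> nat \<Rightarrow> (nat \<Rightarrow> nat) set" where
  "chains i p N = {k \<in> {i..p} \<rightarrow>\<^sub>E {1..}. (\<forall>j\<in>{i..<p}. k j \<ge> k (j + 1)) \<and> (i \<le> p \<longrightarrow> k i \<le> N)}"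

lemma chains_empty: "p < i \<Longrightarrow> chains i p N = {\<lambda>_. undefined}"
  by (auto simp: chains_def)

lemma chains_bound: "k \<in> chains i p N \<Longrightarrow> j \<in> {i..p} \<Longrightarrow> k j \<le> N"
proof -
  assume k: "k \<in> chains i p N" and j: "j \<in> {i..p}"
  then have "i \<le> j" "j \<le> p" by auto
  then show ?thesis
  proof (induction rule: dec_induct)
    case base
    then show ?case using k by (auto simp: chains_def)
  next
    case (step m)
    then have "k (m + 1) \<le> k m" using k by (auto simp: chains_def)
    then show ?case using step by simp
  qed
qed

lemma finite_chains: "finite (chains i p N)"
proof (rule finite_subset)
  show "chains i p N \<subseteq> {i..p} \<rightarrow>\<^sub>E {1..N}"
  proof
    fix k assume k: "k \<in> chains i p N"
    then show "k \<in> {i..p} \<rightarrow>\<^sub>E {1..N}"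
      using chains_bound[OF k] by (auto simp: chains_def PiE_iff)
  qed
qed (auto intro: finite_PiE)

lemma sum_chains:
  fixes f :: "nat \<Rightarrow> nat \<Rightarrow> 'a::comm_ring_1"
  assumes "i \<le> p"
  shows "(\<Sum>k\<in>chains i p N. \<Prod>j=i..p. f j (k j))
    = (\<Sum>m=1..N. f i m * (\<Sum>k\<in>chains (Suc i) p m. \<Prod>j=Suc i..p. f j (k j)))"
    (is "?lhs = _")
proof -
  have "(\<Sum>m=1..N. f i m * (\<Sum>k\<in>chains (Suc i) p m. \<Prod>j=Suc i..p. f j (k j)))
     = (\<Sum>(m, k)\<in>(SIGMA m:{1..N}. chains (Suc i) p m). f i m * (\<Prod>j=Suc i..p. f j (k j)))"
    by (subst sum.Sigma[symmetric]) (auto simp: finite_chains sum_distrib_left)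
  also have "\<dots> = ?lhs"
  \<comment> \<open>The outermost index is split off; \<open>undefined\<close> is the value of
    extensional functions outside their domain.\<close>
  proof (rule sum.reindex_bij_witness[of _ "\<lambda>k. (k i, k(i := undefined))" "\<lambda>(m, k). k(i := m)"], goal_cases)
    case (1 a)
    then show ?case by (auto simp: chains_def PiE_iff extensional_def)
  next
    case (2 a)
    then obtain m k where a: "a = (m, k)" "m \<in> {1..N}" "k \<in> chains (Suc i) p m" by auto
    have k: "k \<in> extensional {Suc i..p}" "\<And>j. j \<in> {Suc i..p} \<Longrightarrow> k j \<ge> 1"
      "\<And>j. j \<in> {Suc i..<p} \<Longrightarrow> k (j + 1) \<le> k j" "Suc i \<le> p \<Longrightarrow> k (Suc i) \<le> m"
      using a by (auto simp: chains_def PiE_iff)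
    have "(k(i := m)) (j + 1) \<le> (k(i := m)) j" if "j \<in> {i..<p}" for j
      using k(3)[of j] k(4) that by (cases "j = i") auto
    moreover have "k(i := m) \<in> {i..p} \<rightarrow>\<^sub>E {1..}"
      using k(1,2) a(2) assms by (auto simp: PiE_iff extensional_def)
    ultimately show ?case using a(1,2) by (auto simp: chains_def)
  next
    case (3 k)
    then show ?case by auto
  next
    case (4 k)
    then have k: "k \<in> extensional {i..p}" "\<And>j. j \<in> {i..p} \<Longrightarrow> k j \<ge> 1"
      "\<And>j. j \<in> {i..<p} \<Longrightarrow> k (j + 1) \<le> k j" "k i \<le> N"
      using assms by (auto simp: chains_def PiE_iff)
    have "(k(i := undefined)) (j + 1) \<le> (k(i := undefined)) j" if "j \<in> {Suc i..<p}" for j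
      using k(3)[of j] that by auto
    moreover have "k(i := undefined) \<in> {Suc i..p} \<rightarrow>\<^sub>E {1..}"
      using k(1,2) by (auto simp: PiE_iff extensional_def)
    moreover have "k (Suc i) \<le> k i" if "Suc i \<le> p" using k(3)[of i] that by auto
    ultimately have "k(i := undefined) \<in> chains (Suc i) p (k i)" by (auto simp: chains_def)
    then show ?case using k(2)[of i] k(4) assms by auto
  next
    case (5 a)
    obtain m k where a: "a = (m, k)" by force
    have "(\<Prod>j=i..p. f j ((k(i := m)) j)) = f i m * (\<Prod>j=Suc i..p. f j ((k(i := m)) j))"
      using assms by (subst prod.atLeast_Suc_atMost) auto
    also have "(\<Prod>j=Suc i..p. f j ((k(i := m)) j)) = (\<Prod>j=Suc i..p. f j (k j))"
      by (intro prod.cong) auto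
    finally show ?case by (simp add: a)
  qed
  finally show ?thesis by simp
qed

lemma nested_sum_eq_sum_chains:
  fixes f :: "nat \<Rightarrow> nat \<Rightarrow> 'a::comm_ring_1"
  assumes "i \<le> p + 1"
  shows "nested_sum (map f [i..<p + 1]) N = (\<Sum>k\<in>chains i p N. \<Prod>j=i..p. f j (k j))"
  using assms
proof (induction i arbitrary: N rule: inc_induct)
  case base
  then show ?case by (simp add: chains_empty)
next
  case (step i)
  then have "i \<le> p" by simp
  then show ?case using step
    by (subst sum_chains) (auto simp: upt_conv_Cons simp del: upt_Suc)
qed

lemma hyp_index_chains: "k \<in> hyp_index p \<longleftrightarrow> (\<exists>N. k \<in> chains 1 p N)"
  by (auto simp: hyp_index_def chains_def)

text \<open>Domination by 1 / (k_1^2 k_2 ... k_p) gives absolute summability. The truncated chain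
  sets are finite, increasing and exhaust \<open>hyp_index p\<close>, so the unordered sum is the
  limit along them.\<close>

lemma prod_hyp_index_nested_sum:
  fixes f :: "nat \<Rightarrow> nat \<Rightarrow> complex"
  assumes bound: "\<And>k. k \<in> hyp_index p \<Longrightarrow>
      norm (\<Prod>j=1..p. f j (k j)) \<le> C * (\<Prod>j=1..p. 1 / real (k j) ^ (if j = 1 then 2 else 1))"
  shows "(\<lambda>k. \<Prod>j=1..p. f j (k j)) summable_on hyp_index p"
    and "(\<lambda>N. nested_sum (map f [1..<p + 1]) N) \<longlonglongrightarrow> (\<Sum>\<^sub>\<infinity>k\<in>hyp_index p. \<Prod>j=1..p. f j (k j))"
proof -
  define w where "w = (\<lambda>j k. 1 / real k ^ (if j = (1::nat) then 2 else 1))"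
  have mono: "chains 1 p M \<subseteq> chains 1 p N" if "M \<le> N" for M N
    using that by (auto simp: chains_def)
  have sub: "\<exists>M. F \<subseteq> chains 1 p M" if "finite F" "F \<subseteq> hyp_index p" for F
    using that
  proof (induction F rule: finite_induct)
    case (insert x F)
    then obtain M N where "F \<subseteq> chains 1 p M" "x \<in> chains 1 p N"
      by (auto simp: hyp_index_chains)
    then show ?case using mono[of M "max M N"] mono[of N "max M N"] by fastforce
  qed auto
  have "\<exists>B. \<forall>N. norm (nested_sum (map w [1..<p + 1]) N) \<le> B"
  proof (cases p)
    case (Suc p')
    have "\<exists>B. \<forall>N. norm (nested_sum (w 1 # map w [2..<p + 1]) N) \<le> B"
      by (rule nested_sum_bounded[of _ _ 1]) (auto simp: w_def power2_eq_square intro!: exI[of _ 1])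
    moreover have "[1..<p + 1] = 1 # [2..<p + 1]"
      by (subst upt_conv_Cons) (auto simp: Suc numeral_2_eq_2)
    ultimately show ?thesis by (metis list.simps(9))
  qed auto
  then obtain B where B: "\<And>N. norm (nested_sum (map w [1..<p + 1]) N) \<le> B" by blast
  have "(\<lambda>k. \<Prod>j=1..p. w j (k j)) summable_on hyp_index p"
  proof (rule nonneg_bdd_above_summable_on)
    show "(\<Prod>j=1..p. w j (k j)) \<ge> 0" for k by (intro prod_nonneg) (auto simp: w_def)
    have "(\<Sum>k\<in>F. \<Prod>j=1..p. w j (k j)) \<le> B" if F: "F \<subseteq> hyp_index p" "finite F" for F
    proof -
      obtain M where M: "F \<subseteq> chains 1 p M" using sub F by blast
      have "(\<Sum>k\<in>F. \<Prod>j=1..p. w j (k j)) \<le> (\<Sum>k\<in>chains 1 p M. \<Prod>j=1..p. w j (k j))"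
        by (intro sum_mono2 finite_chains M prod_nonneg) (auto simp: w_def)
      also have "\<dots> = nested_sum (map w [1..<p + 1]) M"
        by (rule nested_sum_eq_sum_chains[symmetric]) simp
      also have "\<dots> \<le> B" using B[of M] unfolding real_norm_def by linarith
      finally show ?thesis .
    qed
    then show "bdd_above (sum (\<lambda>k. \<Prod>j=1..p. w j (k j)) ` {F. F \<subseteq> hyp_index p \<and> finite F})"
      by (auto intro!: bdd_aboveI[of _ B])
  qed
  then have "(\<lambda>k. C * (\<Prod>j=1..p. w j (k j))) summable_on hyp_index p"
    by (rule summable_on_cmult_right)
  then have "(\<lambda>k. norm (\<Prod>j=1..p. f j (k j))) summable_on hyp_index p"
    by (rule summable_on_comparison_test) (use bound in \<open>auto simp: w_def\<close>)
  then show sm: "(\<lambda>k. \<Prod>j=1..p. f j (k j)) summable_on hyp_index p"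
    by (rule abs_summable_summable)
  have "filterlim (\<lambda>N. chains 1 p N) (finite_subsets_at_top (hyp_index p)) sequentially"
    unfolding filterlim_finite_subsets_at_top
  proof (intro allI impI)
    fix F assume F: "finite F \<and> F \<subseteq> hyp_index p"
    then obtain M where M: "F \<subseteq> chains 1 p M" using sub by blast
    show "eventually (\<lambda>N. finite (chains 1 p N) \<and> F \<subseteq> chains 1 p N \<and> chains 1 p N \<subseteq> hyp_index p) sequentially"
      by (rule eventually_sequentiallyI[of M]) (use M mono finite_chains hyp_index_chains in blast)
  qed
  then have "(\<lambda>N. \<Sum>k\<in>chains 1 p N. \<Prod>j=1..p. f j (k j)) \<longlonglongrightarrow> (\<Sum>\<^sub>\<infinity>k\<in>hyp_index p. \<Prod>j=1..p. f j (k j))"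
    using sm[THEN has_sum_infsum] unfolding has_sum_def by (rule filterlim_compose[rotated])
  then show "(\<lambda>N. nested_sum (map f [1..<p + 1]) N) \<longlonglongrightarrow> (\<Sum>\<^sub>\<infinity>k\<in>hyp_index p. \<Prod>j=1..p. f j (k j))"
    by (subst nested_sum_eq_sum_chains) simp_all
qed

text \<open>The substitution \<open>m\<^sub>j = k\<^sub>j + q - j\<close> turns weakly decreasing chains into strictly decreasing ones.\<close>

lemma mzeta_hyp_index:
  "mzeta s = (\<Sum>\<^sub>\<infinity>k\<in>hyp_index (length s).
     \<Prod>j=1..length s. 1 / real (k j + (length s - j)) ^ (s ! (j - 1)))"
proof -
  define q where "q = length s"
  define T where "T = {k \<in> {1..q} \<rightarrow>\<^sub>E {1::nat..}. \<forall>j\<in>{1..<q}. k j > k (j + 1)}"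
  \<comment> \<open>A strictly decreasing chain of positive integers has room for q - j smaller
    values after position j, so the truncated subtraction in the inverse map loses nothing and stays
    positive.\<close>
  have low: "m j \<ge> q - j + 1" if "m \<in> T" "j \<in> {1..q}" for m j
  proof -
    have "j \<le> q" using that by simp
    then show ?thesis using that(2)
    proof (induction rule: inc_induct)
      case base
      then show ?case using that(1) by (auto simp: T_def PiE_iff)
    next
      case (step i)
      then have "m i > m (Suc i)" using that(1) by (auto simp: T_def)
      moreover have "m (Suc i) \<ge> q - Suc i + 1" using step by simp
      ultimately show ?case using step by linarith
    qed
  qed
  have "bij_betw (\<lambda>k. \<lambda>j\<in>{1..q}. k j + (q - j)) (hyp_index q) T"
  proof (rule bij_betw_byWitness[where f' = "\<lambda>m. \<lambda>j\<in>{1..q}. m j - (q - j)"])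
    show "\<forall>k\<in>hyp_index q. (\<lambda>j\<in>{1..q}. (\<lambda>j\<in>{1..q}. k j + (q - j)) j - (q - j)) = k"
      by (auto simp: hyp_index_def PiE_iff extensional_def restrict_def)
    show "\<forall>m\<in>T. (\<lambda>j\<in>{1..q}. (\<lambda>j\<in>{1..q}. m j - (q - j)) j + (q - j)) = m"
    proof
      fix m assume m: "m \<in> T"
      show "(\<lambda>j\<in>{1..q}. (\<lambda>j\<in>{1..q}. m j - (q - j)) j + (q - j)) = m"
      proof
        fix j
        show "(\<lambda>j\<in>{1..q}. (\<lambda>j\<in>{1..q}. m j - (q - j)) j + (q - j)) j = m j"
          using low[OF m, of j] m by (auto simp: T_def PiE_iff extensional_def)
      qed
    qed
    show "(\<lambda>k. \<lambda>j\<in>{1..q}. k j + (q - j)) ` hyp_index q \<subseteq> T"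
    proof (clarify)
      fix k assume k: "k \<in> hyp_index q"
      have "k (j + 1) + (q - (j + 1)) < k j + (q - j)" if "j \<in> {1..<q}" for j
      proof -
        have "k (j + 1) \<le> k j" using k that unfolding hyp_index_def by blast
        moreover have "q - (j + 1) < q - j" using that by auto
        ultimately show ?thesis by (rule add_le_less_mono)
      qed
      moreover have "k j \<ge> 1" if "j \<in> {1..q}" for j
        using k that by (auto simp: hyp_index_def PiE_iff)
      ultimately show "(\<lambda>j\<in>{1..q}. k j + (q - j)) \<in> T"
        by (fastforce simp: T_def)
    qed
    show "(\<lambda>m. \<lambda>j\<in>{1..q}. m j - (q - j)) ` T \<subseteq> hyp_index q"
    proof (clarify)
      fix m assume m: "m \<in> T"
      have "m j - (q - j) \<ge> m (j + 1) - (q - (j + 1))" if "j \<in> {1..<q}" for j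
      proof -
        have "m (j + 1) < m j" using m that unfolding T_def by blast
        then show ?thesis using that by simp
      qed
      moreover have "m j - (q - j) \<ge> 1" if "j \<in> {1..q}" for j
        using low[OF m that] by simp
      ultimately show "(\<lambda>j\<in>{1..q}. m j - (q - j)) \<in> hyp_index q"
        by (fastforce simp: hyp_index_def)
    qed
  qed
  then have "(\<Sum>\<^sub>\<infinity>k\<in>hyp_index q. \<Prod>j=1..q. 1 / real ((\<lambda>j\<in>{1..q}. k j + (q - j)) j) ^ (s ! (j - 1)))
     = (\<Sum>\<^sub>\<infinity>m\<in>T. \<Prod>j=1..q. 1 / real (m j) ^ (s ! (j - 1)))"
    by (rule infsum_reindex_bij_betw)
  then show ?thesis
    by (simp add: mzeta_def T_def q_def)
qed

section \<open>Admissible exponents and the merging of neighbouring variables\<close>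

text \<open>An item \<open>(A, F, E)\<close> records which exponents \<open>s\<close> its variable may contribute: \<open>s \<le> A\<close>,
  \<open>s \<in> E\<close>, and \<open>s = 1\<close> only if \<open>F\<close>. The Boolean \<open>sep\<close> stands for the hypothesis of (b).\<close>

type_synonym item = "nat \<times> bool \<times> nat set"

definition merge_order :: "bool \<Rightarrow> nat \<Rightarrow> nat \<Rightarrow> nat" where
  "merge_order sep A B = (if sep then max A B else A + B)"

definition leaf_ok :: "item \<Rightarrow> nat \<Rightarrow> bool" where
  "leaf_ok it s = (case it of (A, F, E) \<Rightarrow> 1 \<le> s \<and> s \<le> A \<and> s \<in> E \<and> (s = 1 \<longrightarrow> F))"

lemma leaf_ok_ge_1: "list_all2 leaf_ok its ss \<Longrightarrow> \<forall>s\<in>set ss. s \<ge> 1"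
  by (induction rule: list_all2_induct) (auto simp: leaf_ok_def)

text \<open>The rules mirror the reductions: constants give the empty tuple, a finished product
  gives a leaf, and a telescoped difference gives a merge of neighbours. A merged item forgets its
  parity restriction, but it may carry a flag only if one of its parents did, and in first place
  only if the first parent did; so the number of flags never grows and an unflagged first item stays
  unflagged.\<close>

inductive adm :: "bool \<Rightarrow> item list \<Rightarrow> nat list \<Rightarrow> bool" for sep :: bool where
  adm_nil: "adm sep its []"
| adm_leaf: "list_all2 leaf_ok its s \<Longrightarrow> adm sep its s"
| adm_merge: "adm sep (xs @ (merge_order sep A A', F'', UNIV) # ys) s \<Longrightarrow> (F'' \<longrightarrow> F \<or> F') \<Longrightarrow>
    (xs = [] \<longrightarrow> F'' \<longrightarrow> F) \<Longrightarrow> adm sep (xs @ (A, F, E) # (A', F', E') # ys) s"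

text \<open>A cell is the factor \<open>cfn\<close> of one variable together with its item, an interval
  \<open>[clo, chi]\<close> containing the negatives of its poles (used only if \<open>sep\<close> holds) and an exponent
  \<open>csg\<close> with \<open>cfn k = O(k powr - csg)\<close>.\<close>

record cell =
  cfn :: "complex \<Rightarrow> complex"
  cord :: nat
  cflag :: bool
  cexp :: "nat set"
  clo :: nat
  chi :: nat
  csg :: int

definition item_of :: "cell \<Rightarrow> item" where
  "item_of c = (cord c, cflag c, cexp c)"

definition on_nat :: "(complex \<Rightarrow> complex) \<Rightarrow> nat \<Rightarrow> complex" where
  "on_nat f k = f (of_nat k)"

text \<open>The shift is the number of entries to the right, the q - j of the passage to strictly
  decreasing indices; prepending an exponent leaves the other factors unchanged.\<close>

fun shifted_powers :: "nat list \<Rightarrow> (complex \<Rightarrow> complex) list" where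
  "shifted_powers [] = []"
| "shifted_powers (s # ss) = (\<lambda>z. 1 / (z + of_nat (length ss)) ^ s) # shifted_powers ss"

lemma length_shifted_powers [simp]: "length (shifted_powers ss) = length ss"
  by (induction ss) auto

lemma nth_shifted_powers: "i < length ss \<Longrightarrow> shifted_powers ss ! i = (\<lambda>z. 1 / (z + of_nat (length ss - 1 - i)) ^ (ss ! i))"
  by (induction ss arbitrary: i) (auto simp: nth_Cons' fun_eq_iff)

text \<open>Both sides are 0 for families that are not summable, and summability transfers back
  through the real part.\<close>

lemma infsum_complex_of_real: "(\<Sum>\<^sub>\<infinity>x\<in>A. complex_of_real (f x)) = of_real (\<Sum>\<^sub>\<infinity>x\<in>A. f x)"
proof (rule infsum_bounded_linear_strong[OF _ bounded_linear_of_real])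
  have "f summable_on A" if "(\<lambda>x. complex_of_real (f x)) summable_on A"
    using summable_on_bounded_linear[OF bounded_linear_Re that] by simp
  then show "(\<lambda>x. complex_of_real (f x)) summable_on A \<longleftrightarrow> f summable_on A"
    using summable_on_of_real by blast
qed

lemma shifted_powers_tendsto:
  assumes "ss \<noteq> []" "hd ss \<ge> 2" "\<forall>s\<in>set ss. s \<ge> 1"
  shows "nested_sum (map on_nat (shifted_powers ss)) \<longlonglongrightarrow> of_real (mzeta ss)"
proof -
  define q where "q = length ss"
  define f where "f = (\<lambda>j k. 1 / (of_nat (k + (q - j)) :: complex) ^ (ss ! (j - 1)))"
  have "map on_nat (shifted_powers ss) = map f [1..<q + 1]"
    by (rule nth_equalityI)
       (auto simp: q_def f_def on_nat_def nth_shifted_powers fun_eq_iff simp del: upt_Suc)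
  moreover have "(\<lambda>N. nested_sum (map f [1..<q + 1]) N) \<longlonglongrightarrow> (\<Sum>\<^sub>\<infinity>k\<in>hyp_index q. \<Prod>j=1..q. f j (k j))"
  proof (rule prod_hyp_index_nested_sum(2)[of _ _ 1])
    fix k assume k: "k \<in> hyp_index q"
    have "norm (\<Prod>j=1..q. f j (k j)) = (\<Prod>j=1..q. 1 / real (k j + (q - j)) ^ (ss ! (j - 1)))"
      unfolding f_def by (simp only: prod_norm[symmetric] norm_divide norm_power norm_of_nat norm_one)
    also have "\<dots> \<le> (\<Prod>j=1..q. 1 / real (k j) ^ (if j = 1 then 2 else 1))"
    proof (rule prod_mono, safe)
      fix j assume j: "j \<in> {1..q}"
      have k1: "k j \<ge> 1" using k j by (auto simp: hyp_index_def PiE_iff)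
      have s: "ss ! (j - 1) \<ge> (if j = 1 then 2 else 1)"
        using assms j by (auto simp: hd_conv_nth q_def)
      have "real (k j) ^ (if j = 1 then 2 else 1) \<le> real (k j) ^ (ss ! (j - 1))"
        using k1 s by (intro power_increasing) auto
      also have "\<dots> \<le> real (k j + (q - j)) ^ (ss ! (j - 1))"
        by (intro power_mono) auto
      finally show "1 / real (k j + (q - j)) ^ (ss ! (j - 1)) \<le> 1 / real (k j) ^ (if j = 1 then 2 else 1)"
        using k1 by (intro divide_left_mono) auto
    qed auto
    finally show "norm (\<Prod>j=1..q. f j (k j)) \<le> 1 * (\<Prod>j=1..q. 1 / real (k j) ^ (if j = 1 then 2 else 1))"
      by simp
  qed
  moreover have "(\<Sum>\<^sub>\<infinity>k\<in>hyp_index q. \<Prod>j=1..q. f j (k j)) = of_real (mzeta ss)"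
  proof -
    have "(\<Sum>\<^sub>\<infinity>k\<in>hyp_index q. \<Prod>j=1..q. f j (k j)) =
        (\<Sum>\<^sub>\<infinity>k\<in>hyp_index q. of_real (\<Prod>j=1..q. 1 / real (k j + (q - j)) ^ (ss ! (j - 1))))"
      unfolding f_def by (simp only: of_real_prod of_real_divide of_real_power of_real_of_nat_eq of_real_1)
    also have "\<dots> = of_real (mzeta ss)"
      unfolding mzeta_hyp_index q_def by (rule infsum_complex_of_real)
    finally show ?thesis .
  qed
  ultimately show ?thesis by simp
qed

context subfield
begin

definition zspan :: "(nat list \<Rightarrow> bool) \<Rightarrow> complex \<Rightarrow> bool" where
  "zspan G S \<longleftrightarrow> (\<exists>lam. (\<forall>s. lam s \<in> K) \<and> finite {s. lam s \<noteq> 0} \<and> (\<forall>s. lam s \<noteq> 0 \<longrightarrow> G s) \<and>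
     S = (\<Sum>s | lam s \<noteq> 0. lam s * of_real (mzeta s)))"

lemma zspan_add:
  assumes "zspan G S" "zspan G T"
  shows "zspan G (S + T)"
proof -
  obtain l where l: "\<forall>s. l s \<in> K" "finite {s. l s \<noteq> 0}" "\<forall>s. l s \<noteq> 0 \<longrightarrow> G s"
    "S = (\<Sum>s | l s \<noteq> 0. l s * of_real (mzeta s))" using assms(1) by (auto simp: zspan_def)
  obtain m where m: "\<forall>s. m s \<in> K" "finite {s. m s \<noteq> 0}" "\<forall>s. m s \<noteq> 0 \<longrightarrow> G s"
    "T = (\<Sum>s | m s \<noteq> 0. m s * of_real (mzeta s))" using assms(2) by (auto simp: zspan_def)
  define U where "U = {s. l s \<noteq> 0} \<union> {s. m s \<noteq> 0}"
  have U: "finite U" using l m by (auto simp: U_def)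
  have sub: "{s. l s + m s \<noteq> 0} \<subseteq> U" by (auto simp: U_def)
  have "S = (\<Sum>s\<in>U. l s * of_real (mzeta s))" "T = (\<Sum>s\<in>U. m s * of_real (mzeta s))"
    unfolding l(4) m(4) using U by (intro sum.mono_neutral_left; auto simp: U_def)+
  moreover have "(\<Sum>s | l s + m s \<noteq> 0. (l s + m s) * complex_of_real (mzeta s)) = (\<Sum>s\<in>U. (l s + m s) * of_real (mzeta s))"
    using U sub by (intro sum.mono_neutral_left) auto
  ultimately have "S + T = (\<Sum>s | l s + m s \<noteq> 0. (l s + m s) * of_real (mzeta s))"
    by (simp add: sum.distrib distrib_right)
  then show ?thesis
    unfolding zspan_def using l m finite_subset[OF sub U]
    by (intro exI[of _ "\<lambda>s. l s + m s"]) (auto, metis add_0)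
qed

lemma zspan_0: "zspan G 0"
  unfolding zspan_def by (intro exI[of _ "\<lambda>_. 0"]) auto

lemma zspan_single: "c \<in> K \<Longrightarrow> G s \<Longrightarrow> zspan G (c * of_real (mzeta s))"
proof (cases "c = 0")
  case False
  assume "c \<in> K" "G s"
  moreover have "{t. (if t = s then c else 0) \<noteq> 0} = {s}" using False by auto
  ultimately show ?thesis
    unfolding zspan_def by (intro exI[of _ "\<lambda>t. if t = s then c else 0"]) auto
qed (simp add: zspan_0)

lemma zspan_smult:
  assumes "zspan G S" "d \<in> K"
  shows "zspan G (d * S)"
proof (cases "d = 0")
  case False
  obtain l where l: "\<forall>s. l s \<in> K" "finite {s. l s \<noteq> 0}" "\<forall>s. l s \<noteq> 0 \<longrightarrow> G s"
    "S = (\<Sum>s | l s \<noteq> 0. l s * of_real (mzeta s))" using assms(1) by (auto simp: zspan_def)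
  then show ?thesis
    unfolding zspan_def using assms(2) False
    by (intro exI[of _ "\<lambda>s. d * l s"]) (auto simp: sum_distrib_left mult.assoc)
qed (simp add: zspan_0)

lemma zspan_sum: "(\<And>t. t \<in> T \<Longrightarrow> zspan G (f t)) \<Longrightarrow> zspan G (sum f T)"
  by (induction T rule: infinite_finite_induct) (auto intro: zspan_0 zspan_add)

lemma zspan_mono: "zspan G S \<Longrightarrow> (\<And>s. G s \<Longrightarrow> G' s) \<Longrightarrow> zspan G' S"
  unfolding zspan_def by (elim exE conjE) (intro exI conjI, assumption+, blast, assumption)

text \<open>Existence of the limit is part of the notion, so every splitting must be into pieces
  that converge separately.\<close>

definition represented :: "bool \<Rightarrow> item list \<Rightarrow> (nat \<Rightarrow> complex) \<Rightarrow> bool" where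
  "represented sep its X \<longleftrightarrow> (\<exists>S. zspan (adm sep its) S \<and> X \<longlonglongrightarrow> S)"

lemma represented_add: "represented sep its X \<Longrightarrow> represented sep its Y \<Longrightarrow> represented sep its (\<lambda>N. X N + Y N)"
  unfolding represented_def using zspan_add tendsto_add by metis

lemma represented_smult: "represented sep its X \<Longrightarrow> d \<in> K \<Longrightarrow> represented sep its (\<lambda>N. d * X N)"
  unfolding represented_def using zspan_smult tendsto_mult_left by metis

lemma represented_diff: "represented sep its X \<Longrightarrow> represented sep its Y \<Longrightarrow> represented sep its (\<lambda>N. X N - Y N)"
  using represented_add[OF _ represented_smult[of sep its Y "- 1"]] by auto

lemma represented_cong: "represented sep its X \<Longrightarrow> (\<And>N. N \<ge> 1 \<Longrightarrow> Y N = X N) \<Longrightarrow> represented sep its Y"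
proof -
  assume *: "represented sep its X" "\<And>N. N \<ge> 1 \<Longrightarrow> Y N = X N"
  have "eventually (\<lambda>N. X N = Y N) sequentially"
    by (rule eventually_sequentiallyI[of 1]) (simp add: *)
  then show ?thesis using *(1) unfolding represented_def by (metis (mono_tags, lifting) Lim_transform_eventually)
qed

lemma represented_null: "X \<longlonglongrightarrow> 0 \<Longrightarrow> represented sep its X"
  unfolding represented_def using zspan_0 by blast

lemma mzeta_Nil: "mzeta [] = 1"
proof -
  have "{k \<in> {1..length ([]::nat list)} \<rightarrow>\<^sub>E {1::nat..}. \<forall>j\<in>{1..<length ([]::nat list)}. k j > k (j + 1)} = {\<lambda>_. undefined}"
    by auto
  then show ?thesis by (simp add: mzeta_def)
qed

text \<open>Constants are multiples of the value of the empty tuple, which is 1.\<close>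

lemma represented_const: "c \<in> K \<Longrightarrow> represented sep its (\<lambda>_. c)"
  unfolding represented_def using zspan_single[of c "adm sep its" "[]"] by (auto intro: adm_nil simp: mzeta_Nil)

lemma represented_mono: "represented sep its X \<Longrightarrow> (\<And>s. adm sep its s \<Longrightarrow> adm sep its' s) \<Longrightarrow> represented sep its' X"
  unfolding represented_def using zspan_mono by metis

lemma represented_sum:
  "finite T \<Longrightarrow> (\<And>t. t \<in> T \<Longrightarrow> represented sep its (X t)) \<Longrightarrow> represented sep its (\<lambda>N. \<Sum>t\<in>T. X t N)"
  by (induction T rule: finite_induct) (auto intro: represented_const represented_add)

lemma represented_merge:
  assumes "represented sep (xs @ (merge_order sep A A', F'', UNIV) # ys) X" "F'' \<longrightarrow> F \<or> F'" "xs = [] \<longrightarrow> F'' \<longrightarrow> F"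
  shows "represented sep (xs @ (A, F, E) # (A', F', E') # ys) X"
  by (rule represented_mono[OF assms(1)]) (rule adm_merge, use assms in auto)

text \<open>An unflagged first item excludes s_1 = 1, and this is what makes the series
  converge.\<close>

lemma represented_leaf:
  assumes "list_all2 leaf_ok its ss" "its \<noteq> [] \<longrightarrow> \<not> fst (snd (hd its))"
  shows "represented sep its (nested_sum (map on_nat (shifted_powers ss)))"
proof (cases "ss = []")
  case True
  then show ?thesis by (intro represented_cong[OF represented_const[of 1]]) auto
next
  case False
  then obtain s0 ss0 it0 its0 where ss: "ss = s0 # ss0" "its = it0 # its0"
    using assms(1) by (cases ss; cases its) auto
  have "hd ss \<ge> 2" using assms by (auto simp: ss leaf_ok_def)
  moreover have "\<forall>s\<in>set ss. s \<ge> 1"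
    using leaf_ok_ge_1[OF assms(1)] .
  ultimately have "nested_sum (map on_nat (shifted_powers ss)) \<longlonglongrightarrow> of_real (mzeta ss)"
    using False by (intro shifted_powers_tendsto)
  then show ?thesis
    unfolding represented_def using zspan_single[of 1 "adm sep its" ss, OF K_1 adm_leaf[OF assms(1)]] by auto
qed

section \<open>Moving poles by telescoping\<close>

lemma pf_sum_terms:
  assumes "finite T" "c \<in> K" "1 \<le> s" "\<And>t. t \<in> T \<Longrightarrow> s \<le> a (h t)"
  shows "\<exists>C. pf a (\<lambda>z. \<Sum>t\<in>T. c / (z + of_nat (h t)) ^ s) C"
  using assms
proof (induction T rule: finite_induct)
  case empty
  then show ?case by (auto intro: pf_zero)
next
  case (insert x T)
  then obtain C where "pf a (\<lambda>z. \<Sum>t\<in>T. c / (z + of_nat (h t)) ^ s) C" by auto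
  then show ?case using pf_add[OF pf_term[of c s a "h x"]] insert by auto
qed

text \<open>The difference of 1 / (z + x)^s and 1 / (z + b)^s telescopes through unit steps between
  \<open>b\<close> and \<open>x\<close>, so modulo a difference all poles move to
  \<open>- b\<close>, where only the total coefficient \<open>C s\<close> survives. The bounds
  \<open>aU\<close> and \<open>aS\<close> record that the poles of U lie in the gap without its
  larger end, those of U(z + 1) in the gap without its smaller end.\<close>

lemma pf_telescope:
  fixes a :: "nat \<Rightarrow> nat" and A b :: nat
  defines "aU \<equiv> (\<lambda>t. if \<exists>x. a x > 0 \<and> (b \<le> t \<and> t < x \<or> x \<le> t \<and> t < b) then A else 0)"
    and "aS \<equiv> (\<lambda>t. if \<exists>x. a x > 0 \<and> (b < t \<and> t \<le> x \<or> x < t \<and> t \<le> b) then A else 0)"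
  assumes "pf a f C" "\<And>x. a x \<le> A"
  shows "\<exists>U. (\<exists>D. pf aU U D) \<and> (\<exists>D. pf aS (\<lambda>z. U (z + 1)) D) \<and>
    (\<forall>k::nat\<ge>1. f (of_nat k) = (\<Sum>s=1..A. C s / (of_nat k + of_nat b) ^ s) + (U (of_nat k + 1) - U (of_nat k)))"
  using assms(3)
proof (induction rule: pf.induct)
  case (pf_zero f)
  show ?case
    by (intro exI[of _ "\<lambda>_. 0"]) (auto intro: pf.pf_zero simp: pf_zero)
next
  case (pf_step f C c s x g)
  then obtain U DU DS where U: "pf aU U DU" "pf aS (\<lambda>z. U (z + 1)) DS"
    "\<And>k. k \<ge> 1 \<Longrightarrow> f (of_nat k) = (\<Sum>s=1..A. C s / (of_nat k + of_nat b) ^ s) + (U (of_nat k + 1) - U (of_nat k))"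
    by auto
  have ax: "a x > 0" and sA: "s \<le> A" using pf_step assms(4)[of x] by auto
  \<comment> \<open>V(z + 1) - V(z) equals c' / (z + max b x)^s - c' / (z + min b x)^s; the sign in
    \<open>c'\<close> corrects the direction when x < b.\<close>
  define T where "T = (if b \<le> x then {b..<x} else {x..<b})"
  define c' where "c' = (if b \<le> x then c else - c)"
  define V where "V = (\<lambda>z. \<Sum>t\<in>T. c' / (z + of_nat t) ^ s)"
  have T: "finite T" and c': "c' \<in> K" using pf_step by (auto simp: T_def c'_def)
  have sT: "s \<le> aU t" "s \<le> aS (Suc t)" if "t \<in> T" for t
  proof -
    have "b \<le> t \<and> t < x \<or> x \<le> t \<and> t < b" using that by (auto simp: T_def split: if_splits)
    moreover from this have "b < Suc t \<and> Suc t \<le> x \<or> x < Suc t \<and> Suc t \<le> b" by auto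
    ultimately have "\<exists>x. a x > 0 \<and> (b \<le> t \<and> t < x \<or> x \<le> t \<and> t < b)"
      "\<exists>x. a x > 0 \<and> (b < Suc t \<and> Suc t \<le> x \<or> x < Suc t \<and> Suc t \<le> b)"
      using ax by blast+
    then show "s \<le> aU t" "s \<le> aS (Suc t)" using sA unfolding aU_def aS_def by simp_all
  qed
  have "\<exists>D. pf aU V D"
    unfolding V_def
    by (rule pf_sum_terms[of _ _ _ _ "\<lambda>t. t"]) (use T c' pf_step.hyps sT in auto)
  moreover have "\<exists>D. pf aS (\<lambda>z. V (z + 1)) D"
  proof -
    have "\<exists>D. pf aS (\<lambda>z. \<Sum>t\<in>T. c' / (z + of_nat (Suc t)) ^ s) D"
      by (rule pf_sum_terms) (use T c' pf_step.hyps sT in auto)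
    then show ?thesis by (simp add: V_def add.assoc)
  qed
  moreover have "c / (of_nat k + of_nat x) ^ s = c / (of_nat k + of_nat b) ^ s + (V (of_nat k + 1) - V (of_nat k))"
    if "k \<ge> 1" for k :: nat
  proof -
    define h where "h = (\<lambda>t::nat. c' / (of_nat k + of_nat t :: complex) ^ s)"
    have "V (of_nat k + 1) - V (of_nat k) = (\<Sum>t\<in>T. h (Suc t) - h t)"
      by (simp add: V_def h_def sum_subtractf add.assoc)
    also have "\<dots> = (if b \<le> x then h x - h b else h b - h x)"
      unfolding T_def by (auto simp: sum_Suc_diff')
    finally show ?thesis by (auto simp: h_def c'_def)
  qed
  moreover have "(\<Sum>t=1..A. (C(s := C s + c)) t / (of_nat k + of_nat b :: complex) ^ t)
      = (\<Sum>t=1..A. C t / (of_nat k + of_nat b) ^ t) + c / (of_nat k + of_nat b) ^ s" for k :: nat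
  proof -
    have "(\<Sum>t=1..A. (C(s := C s + c)) t / (of_nat k + of_nat b :: complex) ^ t)
      = (\<Sum>t=1..A. C t / (of_nat k + of_nat b) ^ t + (if t = s then c / (of_nat k + of_nat b) ^ s else 0))"
      by (intro sum.cong) (auto simp: add_divide_distrib)
    then show ?thesis using pf_step sA by (simp add: sum.distrib)
  qed
  ultimately show ?case
  proof (intro exI[of _ "\<lambda>z. U z + V z"] conjI allI impI, goal_cases)
    case 1
    then show ?case using pf_add[OF U(1)] by blast
  next
    case 2
    then show ?case using pf_add[OF U(2)] by blast
  next
    case (3 k)
    then show ?case using U(3)[of k] pf_step.hyps(5)[of "of_nat k"] by (simp del: fun_upd_apply)
  qed
qed

text \<open>Both factors are O(1/k), so the product is O(k^-2): it has no polynomial part and its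
  residues sum to 0. This is why a product cell can be left unflagged.\<close>

lemma pf_mult:
  assumes "pf a f C" "pf b g D"
  obtains H where "pf (\<lambda>x. a x + b x) (\<lambda>z. f z * g z) H" "H 1 = 0"
proof -
  obtain H where H: "mf (\<lambda>x. a x + b x) (\<lambda>z. f z * g z) H"
    using mero_mult[OF mero_pf[OF assms(1)] mero_pf[OF assms(2)]] by (auto simp: mero_def)
  have b2: "decay (\<lambda>z. f z * g z) 2"
    using decay_mult[OF pf_decay[OF assms(1)] pf_decay[OF assms(2)]] by simp
  have pfH: "pf (\<lambda>x. a x + b x) (\<lambda>z. f z * g z) H"
    by (rule mf_proper[OF H decay_mono[OF b2]]) simp
  show ?thesis by (rule that[OF pfH pf_residue_zero[OF pfH b2]])
qed

definition proper_cell :: "bool \<Rightarrow> cell \<Rightarrow> bool" where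
  "proper_cell sep c \<longleftrightarrow> (sep \<longrightarrow> clo c \<le> chi c) \<and>
     (\<exists>a C. pf a (cfn c) C \<and> (\<forall>x. a x \<le> cord c) \<and>
       (sep \<longrightarrow> (\<forall>x. a x > 0 \<longrightarrow> clo c \<le> x \<and> x \<le> chi c)) \<and>
       (\<forall>s. C s \<noteq> 0 \<longrightarrow> s \<in> cexp c \<and> (s = 1 \<longrightarrow> cflag c)))"

definition product_cell :: "bool \<Rightarrow> (complex \<Rightarrow> complex) \<Rightarrow> nat \<Rightarrow> nat \<Rightarrow> nat \<Rightarrow> nat \<Rightarrow> cell" where
  "product_cell sep f A B l h = \<lparr>cfn = f, cord = merge_order sep A B, cflag = False, cexp = UNIV, clo = l, chi = h, csg = 2\<rparr>"

lemma product_cell_simps [simp]: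
  "cfn (product_cell sep f A B l h) = f" "clo (product_cell sep f A B l h) = l" "chi (product_cell sep f A B l h) = h"
  "item_of (product_cell sep f A B l h) = (merge_order sep A B, False, UNIV)"
  by (auto simp: product_cell_def item_of_def)

text \<open>Orders add at common poles; under \<open>sep\<close> at most one of \<open>a x\<close>
  and \<open>b x\<close> is positive at each \<open>x\<close>, so the sum is bounded by the
  maximum.\<close>

lemma proper_product_cell:
  assumes "pf a f C" "pf b g D" "\<And>x. a x \<le> A" "\<And>x. b x \<le> B"
    and "sep \<Longrightarrow> l \<le> h" "\<And>x. sep \<Longrightarrow> a x > 0 \<Longrightarrow> l \<le> x \<and> x \<le> h \<and> b x = 0"
    and "\<And>x. sep \<Longrightarrow> b x > 0 \<Longrightarrow> l \<le> x \<and> x \<le> h"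
  shows "proper_cell sep (product_cell sep (\<lambda>z. f z * g z) A B l h)"
proof -
  obtain H where H: "pf (\<lambda>x. a x + b x) (\<lambda>z. f z * g z) H" "H 1 = 0"
    using pf_mult[OF assms(1,2)] by blast
  have "a x + b x \<le> merge_order sep A B" for x
  proof (cases sep)
    case True
    then show ?thesis using assms(3)[of x] assms(4)[of x] assms(6)[of x] by (cases "a x = 0") (auto simp: merge_order_def)
  next
    case False
    then show ?thesis using assms(3)[of x] assms(4)[of x] by (simp add: merge_order_def)
  qed
  moreover have "l \<le> x \<and> x \<le> h" if sep "a x + b x > 0" for x
    using that assms(6)[of x] assms(7)[of x] by (cases "a x = 0") auto
  ultimately show ?thesis
    unfolding proper_cell_def product_cell_def using H assms(5)
    by (intro conjI exI[of _ "\<lambda>x. a x + b x"] exI[of _ H]) auto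
qed

text \<open>The boundary term of the outermost variable dies in the limit: O(1/N) against a nested
  sum of size O(N^(1/2)).\<close>

lemma pf_nested_sum_null:
  assumes "pf a U C" "\<And>f. f \<in> set fs \<Longrightarrow> decay f 1"
  shows "(\<lambda>N. on_nat U (Suc N) * nested_sum (map on_nat fs) N) \<longlonglongrightarrow> 0"
proof -
  have ex: "\<exists>C. \<forall>k\<ge>1. norm (on_nat f k) \<le> C / real k" if "decay f 1" for f
    using that by (auto simp: decay_def on_nat_def power_int_minus divide_inverse)
  obtain D where D: "D \<ge> 0" "\<And>N. N \<ge> 1 \<Longrightarrow> norm (nested_sum (map on_nat fs) N) \<le> D * sqrt (real N)"
    using nested_sum_sqrt_bound[of "map on_nat fs"] ex assms(2) by auto
  obtain B where B: "\<And>k. k \<ge> 1 \<Longrightarrow> norm (on_nat U k) \<le> B / real k"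
    using ex[OF pf_decay[OF assms(1)]] by auto
  have B0: "B \<ge> 0" using B[of 1] norm_ge_zero[of "on_nat U 1"] by (simp del: norm_ge_zero)
  have "(\<lambda>N. sqrt (inverse (real N))) \<longlonglongrightarrow> sqrt 0"
    by (intro tendsto_intros lim_inverse_n)
  then have lim: "(\<lambda>N. B * D * sqrt (inverse (real N))) \<longlonglongrightarrow> 0"
    using tendsto_mult_left[of "\<lambda>N. sqrt (inverse (real N))" 0 sequentially "B * D"] by simp
  show ?thesis
  proof (rule Lim_null_comparison[OF _ lim], rule eventually_sequentiallyI[of 1])
    fix N :: nat assume N: "1 \<le> N"
    have "norm (on_nat U (Suc N) * nested_sum (map on_nat fs) N) \<le> (B / real (Suc N)) * (D * sqrt (real N))"
      by (rule order_trans[OF norm_mult_ineq mult_mono[OF B D(2)[OF N]]]) (use B0 in auto)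
    also have "\<dots> \<le> (B / real N) * (D * sqrt (real N))"
      using B0 D N by (intro mult_right_mono divide_left_mono) auto
    also have "\<dots> = B * D * (sqrt (real N) / real N)" by simp
    also have "sqrt (real N) / real N = sqrt (inverse (real N))"
      by (simp add: real_sqrt_inverse sqrt_divide_self_eq)
    finally show "norm (on_nat U (Suc N) * nested_sum (map on_nat fs) N) \<le> B * D * sqrt (inverse (real N))" .
  qed
qed

lemma decay_shifted_powers:
  assumes "\<forall>s\<in>set ss. s \<ge> 1" "f \<in> set (shifted_powers ss)"
  shows "decay f 1"
  using assms
proof (induction ss)
  case (Cons s ss)
  have "decay (\<lambda>z. 1 / (z + of_nat (length ss)) ^ s) 1"
    by (rule decay_mono[OF decay_term_power]) (use Cons in auto)
  then show ?case using Cons by auto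
qed auto

end

lemma nested_sum_sum:
  "finite T \<Longrightarrow> nested_sum (xs @ (\<lambda>k. \<Sum>t\<in>T. g t k) # ys) N = (\<Sum>t\<in>T. nested_sum (xs @ g t # ys) N)"
proof (induction T rule: finite_induct)
  case empty
  then show ?case using nested_sum_smult[of xs 0 "\<lambda>_. 0" ys N] by simp
next
  case (insert x T)
  then show ?case using nested_sum_add[of xs "g x" "\<lambda>k. \<Sum>t\<in>T. g t k" ys N] by simp
qed

lemma nested_sum_cong_at:
  assumes "\<And>k. k \<ge> 1 \<Longrightarrow> f k = g k"
  shows "nested_sum (xs @ f # ys) N = nested_sum (xs @ g # ys) N"
  by (rule nested_sum_cong) (use assms in \<open>auto simp: list_all2_append list.rel_refl\<close>)

context subfield
begin

text \<open>The cells \<open>ds\<close> are still to be processed, while the exponents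
  \<open>ss\<close> of the variables to their right are fixed. Under \<open>sep\<close>,
  \<open>length ss \<le> clo (last ds)\<close> puts the target pole at or below all poles of the
  next cell, so moving these poles sweeps only a region that meets neither the other cells'
  intervals nor the poles of the fixed factors.\<close>

lemma represented_proper_cells:
  assumes "\<forall>c\<in>set ds. proper_cell sep c"
    and "sep \<Longrightarrow> sorted_wrt (\<lambda>c d. chi d < clo c) ds"
    and "sep \<Longrightarrow> ds \<noteq> [] \<Longrightarrow> length ss \<le> clo (last ds)"
    and "list_all2 leaf_ok its ss"
    and "map item_of ds @ its \<noteq> [] \<longrightarrow> \<not> fst (snd (hd (map item_of ds @ its)))"
  shows "represented sep (map item_of ds @ its) (nested_sum (map on_nat (map cfn ds @ shifted_powers ss)))"
  using assms
\<comment> \<open>A cell weighs 2 and a fixed exponent 1: turning a cell into an exponent and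
  merging it with either neighbour all lower the measure.\<close>
proof (induction "2 * length ds + length ss" arbitrary: ds ss its rule: less_induct)
  case less
  note IH = less.hyps
  show ?case
  proof (cases ds rule: rev_cases)
    case Nil
    then show ?thesis using represented_leaf[of its ss sep] less.prems by simp
  next
    case (snoc ds' d)
    define A where "A = cord d"
    \<comment> \<open>The poles go to minus the number of variables on the right, as
      \<open>shifted_powers\<close> prescribes.\<close>
    define b where "b = length ss"
    have proper': "\<forall>c\<in>set ds'. proper_cell sep c" and "proper_cell sep d"
      using less.prems(1) by (auto simp: snoc)
    then obtain a C where pf: "pf a (cfn d) C" and aA: "\<And>x. a x \<le> A"
      and supp: "\<And>x. sep \<Longrightarrow> a x > 0 \<Longrightarrow> clo d \<le> x \<and> x \<le> chi d"
      and C: "\<And>s. C s \<noteq> 0 \<Longrightarrow> s \<in> cexp d \<and> (s = 1 \<longrightarrow> cflag d)"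
      and lh: "sep \<Longrightarrow> clo d \<le> chi d"
      unfolding proper_cell_def A_def by blast
    have blo: "sep \<Longrightarrow> b \<le> clo d" using less.prems(3) by (auto simp: snoc b_def)
    have sorted': "sorted_wrt (\<lambda>c d. chi d < clo c) ds'" "\<And>c. c \<in> set ds' \<Longrightarrow> chi d < clo c" if sep
      using less.prems(2)[OF that] by (auto simp: snoc sorted_wrt_append)
    note hd = less.prems(5)
    define aU where "aU = (\<lambda>t. if \<exists>x. a x > 0 \<and> (b \<le> t \<and> t < x \<or> x \<le> t \<and> t < b) then A else 0)"
    define aS where "aS = (\<lambda>t. if \<exists>x. a x > 0 \<and> (b < t \<and> t \<le> x \<or> x < t \<and> t \<le> b) then A else 0)"
    obtain U DU DS where U: "pf aU U DU" "pf aS (\<lambda>z. U (z + 1)) DS"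
      and eq: "\<And>k. k \<ge> 1 \<Longrightarrow> cfn d (of_nat k) =
        (\<Sum>s=1..A. C s / (of_nat k + of_nat b) ^ s) + (U (of_nat k + 1) - U (of_nat k))"
      using pf_telescope[OF pf aA, of b] unfolding aU_def aS_def by blast
    have aUA: "aU t \<le> A" and aSA: "aS t \<le> A" for t by (auto simp: aU_def aS_def)
    \<comment> \<open>Under \<open>sep\<close> every pole of the cell lies at or above
      \<open>b\<close>, so only the upward alternative in \<open>aU\<close> occurs.\<close>
    have suppU: "b \<le> t \<and> t < chi d" if "sep" "aU t > 0" for t
    proof -
      have "\<exists>x. a x > 0 \<and> (b \<le> t \<and> t < x \<or> x \<le> t \<and> t < b)"
        using that(2) unfolding aU_def by (simp only: split: if_split_asm) blast+
      then obtain x where "a x > 0" "b \<le> t \<and> t < x \<or> x \<le> t \<and> t < b" by blast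
      then show ?thesis using supp[of x] blo that by linarith
    qed
    have suppS: "b < t \<and> t \<le> chi d" if "sep" "aS t > 0" for t
    proof -
      have "\<exists>x. a x > 0 \<and> (b < t \<and> t \<le> x \<or> x < t \<and> t \<le> b)"
        using that(2) unfolding aS_def by (simp only: split: if_split_asm) blast+
      then obtain x where "a x > 0" "b < t \<and> t \<le> x \<or> x < t \<and> t \<le> b" by blast
      then show ?thesis using supp[of x] blo that by linarith
    qed
    define xs where "xs = map on_nat (map cfn ds')"
    define ys where "ys = map on_nat (shifted_powers ss)"
    define \<Delta> where "\<Delta> = (\<lambda>k. on_nat U (Suc k) - on_nat U k)"
    have split: "nested_sum (map on_nat (map cfn ds @ shifted_powers ss)) N =
        (\<Sum>s=1..A. C s * nested_sum (xs @ on_nat (\<lambda>z. 1 / (z + of_nat b) ^ s) # ys) N) + nested_sum (xs @ \<Delta> # ys) N" for N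
    proof -
      have "nested_sum (map on_nat (map cfn ds @ shifted_powers ss)) N = nested_sum (xs @ on_nat (cfn d) # ys) N"
        by (simp add: snoc xs_def ys_def)
      also have "\<dots> = nested_sum (xs @ (\<lambda>k. (\<Sum>s=1..A. C s * on_nat (\<lambda>z. 1 / (z + of_nat b) ^ s) k) + \<Delta> k) # ys) N"
        by (rule nested_sum_cong_at) (simp add: eq \<Delta>_def on_nat_def add.commute)
      finally show ?thesis by (simp only: nested_sum_add nested_sum_sum finite_atLeastAtMost nested_sum_smult)
    qed
    have moved: "represented sep (map item_of ds @ its) (\<lambda>N. C s * nested_sum (xs @ on_nat (\<lambda>z. 1 / (z + of_nat b) ^ s) # ys) N)" for s
    proof (cases "C s = 0")
      case True
      then show ?thesis using represented_const[of 0] by simp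
    next
      case False
      have s: "1 \<le> s" "s \<le> A" using pf_coeff_bound[OF pf aA False] by auto
      have "represented sep (map item_of ds' @ (item_of d # its)) (nested_sum (map on_nat (map cfn ds' @ shifted_powers (s # ss))))"
      proof (rule IH)
        show "list_all2 leaf_ok (item_of d # its) (s # ss)"
          using less.prems(4) s C[OF False] by (simp add: leaf_ok_def item_of_def A_def)
        \<comment> \<open>Intervals are nonempty and strictly separated, so one cell further left
          \<open>clo\<close> is larger by at least one, which pays for the added exponent.\<close>
        show "length (s # ss) \<le> clo (last ds')" if sep "ds' \<noteq> []"
          using sorted'(2)[OF that(1), of "last ds'"] that lh blo by (fastforce simp: b_def)
        show "map item_of ds' @ item_of d # its \<noteq> [] \<longrightarrow> \<not> fst (snd (hd (map item_of ds' @ item_of d # its)))"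
          using hd by (simp add: snoc)
        show "2 * length ds' + length (s # ss) < 2 * length ds + length ss" by (simp add: snoc)
      qed (fact proper' sorted')+
      then have "represented sep (map item_of ds @ its) (nested_sum (xs @ on_nat (\<lambda>z. 1 / (z + of_nat b) ^ s) # ys))"
        by (simp add: snoc xs_def ys_def b_def)
      then show ?thesis by (rule represented_smult) (rule pf_coeff_in[OF pf])
    qed
    have down: "represented sep (map item_of ds' @ item_of d # it0 # its0)
        (nested_sum (xs @ (\<lambda>k. on_nat U k * on_nat (\<lambda>z. 1 / (z + of_nat (length ss0)) ^ s0) k) # map on_nat (shifted_powers ss0)))"
      if ss: "ss = s0 # ss0" and its: "its = it0 # its0" for s0 ss0 it0 its0
    proof -
      obtain A0 F0 E0 where it0: "it0 = (A0, F0, E0)" by (cases it0)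
      have s0: "1 \<le> s0" "s0 \<le> A0" using less.prems(4) by (auto simp: ss its it0 leaf_ok_def)
      \<comment> \<open>Under \<open>sep\<close> the negated poles of U lie in [b, chi d), and that
        of the right neighbour is b - 1 = \<open>length ss0\<close>, just below. The poles are
        disjoint and the new interval starts at \<open>length ss0\<close>.\<close>
      define m where "m = product_cell sep (\<lambda>z. U z * (1 / (z + of_nat (length ss0)) ^ s0)) A A0 (length ss0) (chi d)"
      have T: "pf (\<lambda>x. if x = length ss0 then A0 else 0) (\<lambda>z. 1 / (z + of_nat (length ss0)) ^ s0) ((\<lambda>_. 0)(s0 := 1))"
        by (rule pf_term) (use s0 in auto)
      have m: "proper_cell sep m"
        unfolding m_def
      proof (rule proper_product_cell[OF U(1) T aUA], goal_cases)
        case (1 x)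
        then show ?case by simp
      next
        case 2
        then show ?case using lh blo by (simp add: b_def ss)
      next
        case (3 x)
        then show ?case using suppU[of x] by (simp add: b_def ss)
      next
        case (4 x)
        then show ?case using lh blo by (simp add: b_def ss split: if_split_asm)
      qed
      have "represented sep (map item_of (ds' @ [m]) @ its0) (nested_sum (map on_nat (map cfn (ds' @ [m]) @ shifted_powers ss0)))"
      proof (rule IH)
        show "list_all2 leaf_ok its0 ss0" using less.prems(4) by (simp add: ss its)
        show "map item_of (ds' @ [m]) @ its0 \<noteq> [] \<longrightarrow> \<not> fst (snd (hd (map item_of (ds' @ [m]) @ its0)))"
          using hd by (cases ds') (auto simp: snoc m_def)
        show "2 * length (ds' @ [m]) + length ss0 < 2 * length ds + length ss" by (simp add: snoc ss)
        show "\<forall>c\<in>set (ds' @ [m]). proper_cell sep c" using proper' m by simp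
        show "sorted_wrt (\<lambda>c d. chi d < clo c) (ds' @ [m])" if sep
          using sorted'[OF that] by (simp add: sorted_wrt_append m_def)
        show "length ss0 \<le> clo (last (ds' @ [m]))" by (simp add: m_def)
      qed
      then have "represented sep (map item_of ds' @ (merge_order sep A A0, False, UNIV) # its0)
          (nested_sum (map on_nat (map cfn (ds' @ [m]) @ shifted_powers ss0)))"
        by (simp add: m_def)
      then have "represented sep (map item_of ds' @ (A, cflag d, cexp d) # (A0, F0, E0) # its0)
          (nested_sum (map on_nat (map cfn (ds' @ [m]) @ shifted_powers ss0)))"
        by (rule represented_merge) auto
      then show ?thesis
        by (simp add: m_def it0 item_of_def A_def xs_def) (simp add: on_nat_def[abs_def])
    qed
    \<comment> \<open>Four cases, by the presence of a left and a right neighbour: the upper end of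
      the telescope gives a vanishing boundary term or a merge to the left, the lower end gives the
      constant U(1) or a merge to the right.\<close>
    have telescoped: "represented sep (map item_of ds @ its) (nested_sum (xs @ \<Delta> # ys))"
    proof (cases ds' rule: rev_cases)
      case Nil
      show ?thesis
      proof (cases ss)
        case ss: Nil
        have "represented sep (map item_of ds @ its) (\<lambda>N. on_nat U (Suc N) - on_nat U 1)"
          using pf_nested_sum_null[OF U(1), of "[]"] pf_value[OF U(1), of 1]
          by (intro represented_diff represented_null represented_const) (auto simp: on_nat_def)
        then show ?thesis
          by (rule represented_cong) (simp add: xs_def ys_def Nil ss \<Delta>_def nested_sum_telescope_single del: nested_sum.simps)
      next
        case (Cons s0 ss0)
        then obtain it0 its0 where its: "its = it0 # its0" using less.prems(4) by (cases its) auto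
        define g where "g = on_nat (\<lambda>z. 1 / (z + of_nat (length ss0)) ^ s0)"
        have ys: "ys = g # map on_nat (shifted_powers ss0)" by (simp add: ys_def g_def Cons)
        have "represented sep (map item_of ds @ its)
            (\<lambda>N. on_nat U (Suc N) * nested_sum ys N - nested_sum ((\<lambda>k. on_nat U k * g k) # map on_nat (shifted_powers ss0)) N)"
        proof (rule represented_diff)
          show "represented sep (map item_of ds @ its) (\<lambda>N. on_nat U (Suc N) * nested_sum ys N)"
            unfolding ys_def
            by (rule represented_null, rule pf_nested_sum_null[OF U(1)])
               (use decay_shifted_powers leaf_ok_ge_1[OF less.prems(4)] in blast)
          show "represented sep (map item_of ds @ its) (nested_sum ((\<lambda>k. on_nat U k * g k) # map on_nat (shifted_powers ss0)))"
            using down[OF Cons its] by (simp add: g_def snoc Nil its xs_def)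
        qed
        then show ?thesis
          by (rule represented_cong) (simp add: xs_def Nil ys \<Delta>_def nested_sum_telescope del: nested_sum.simps)
      qed
    next
      case snoc': (snoc ds'' d')
      have "proper_cell sep d'" using proper' by (auto simp: snoc')
      then obtain a' C' where pf': "pf a' (cfn d') C'" and aA': "\<And>x. a' x \<le> cord d'"
        and supp': "\<And>x. sep \<Longrightarrow> a' x > 0 \<Longrightarrow> clo d' \<le> x \<and> x \<le> chi d'"
        and C': "\<And>s. C' s \<noteq> 0 \<Longrightarrow> s \<in> cexp d' \<and> (s = 1 \<longrightarrow> cflag d')"
        and lh': "sep \<Longrightarrow> clo d' \<le> chi d'"
        unfolding proper_cell_def by blast
      have sorted'': "sorted_wrt (\<lambda>c d. chi d < clo c) ds''" "\<And>c. c \<in> set ds'' \<Longrightarrow> chi d' < clo c"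
        "chi d < clo d'" if sep
        using sorted'[OF that] by (auto simp: snoc' sorted_wrt_append)
      define xs' where "xs' = map on_nat (map cfn ds'')"
      define f' where "f' = on_nat (cfn d')"
      have xs: "xs = xs' @ [f']" by (simp add: xs_def xs'_def f'_def snoc')
      \<comment> \<open>Under \<open>sep\<close> the negated poles of U(z + 1) lie in
        [b + 1, chi d], those of \<open>d'\<close> strictly above \<open>chi d\<close>; the chosen
        interval covers both.\<close>
      define u where "u = product_cell sep (\<lambda>z. cfn d' z * U (z + 1)) (cord d') A (b + 1) (chi d')"
      have u: "proper_cell sep u"
        unfolding u_def
      proof (rule proper_product_cell[OF pf' U(2) aA' aSA], goal_cases)
        case 1
        then show ?case using sorted''(3) lh lh' blo by fastforce
      next
        case (2 x)
        have "\<not> aS x > 0" using suppS[of x] supp'[of x] sorted''(3) 2 by fastforce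
        then show ?case using supp'[of x] sorted''(3) lh blo 2 by fastforce
      next
        case (3 x)
        then show ?case using suppS[of x] sorted''(3) lh' by fastforce
      qed
      have "represented sep (map item_of (ds'' @ [u]) @ its) (nested_sum (map on_nat (map cfn (ds'' @ [u]) @ shifted_powers ss)))"
      proof (rule IH)
        show "map item_of (ds'' @ [u]) @ its \<noteq> [] \<longrightarrow> \<not> fst (snd (hd (map item_of (ds'' @ [u]) @ its)))"
          using hd by (cases ds'') (auto simp: snoc snoc' u_def)
        show "2 * length (ds'' @ [u]) + length ss < 2 * length ds + length ss" by (simp add: snoc snoc')
        show "\<forall>c\<in>set (ds'' @ [u]). proper_cell sep c" using proper' u by (simp add: snoc')
        show "sorted_wrt (\<lambda>c d. chi d < clo c) (ds'' @ [u])" if sep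
          using sorted''[OF that] by (simp add: sorted_wrt_append u_def)
        show "length ss \<le> clo (last (ds'' @ [u]))" by (simp add: u_def b_def)
      qed (fact less.prems(4))
      then have "represented sep (map item_of ds'' @ (merge_order sep (cord d') A, False, UNIV) # its)
          (nested_sum (map on_nat (map cfn (ds'' @ [u]) @ shifted_powers ss)))"
        by (simp add: u_def)
      then have "represented sep (map item_of ds'' @ (cord d', cflag d', cexp d') # (A, cflag d, cexp d) # its)
          (nested_sum (map on_nat (map cfn (ds'' @ [u]) @ shifted_powers ss)))"
        by (rule represented_merge) auto
      moreover have "map on_nat (map cfn (ds'' @ [u]) @ shifted_powers ss) = xs' @ (\<lambda>k. f' k * on_nat U (Suc k)) # ys"
        by (simp add: xs'_def ys_def f'_def u_def) (simp add: on_nat_def[abs_def] add.commute)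
      ultimately have up: "represented sep (map item_of ds @ its) (nested_sum (xs' @ (\<lambda>k. f' k * on_nat U (Suc k)) # ys))"
        by (simp add: snoc snoc' item_of_def A_def)
      show ?thesis
      proof (cases ss)
        case ss: Nil
        then have its: "its = []" using less.prems(4) by simp
        \<comment> \<open>The leftover, U(1) times the sum without the last variable, has to be
          expressed through the unchanged list of items. Raising the order of \<open>d'\<close> to
          the merge order makes it an instance of \<open>represented_merge\<close>.\<close>
        define e where "e = d'\<lparr>cord := merge_order sep (cord d') A, cexp := UNIV\<rparr>"
        have e: "proper_cell sep e"
          unfolding proper_cell_def
        proof (intro conjI exI)
          show "pf a' (cfn e) C'" using pf' by (simp add: e_def)
          show "\<forall>x. a' x \<le> cord e" using aA' by (auto simp: e_def merge_order_def intro: trans_le_add1 max.coboundedI1)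
        qed (use C' supp' lh' in \<open>auto simp: e_def\<close>)
        have "represented sep (map item_of (ds'' @ [e]) @ []) (nested_sum (map on_nat (map cfn (ds'' @ [e]) @ shifted_powers [])))"
        proof (rule IH)
          show "map item_of (ds'' @ [e]) @ [] \<noteq> [] \<longrightarrow> \<not> fst (snd (hd (map item_of (ds'' @ [e]) @ [])))"
            using hd by (cases ds'') (auto simp: snoc snoc' e_def item_of_def)
          show "2 * length (ds'' @ [e]) + length ([] :: nat list) < 2 * length ds + length ss"
            by (simp add: snoc snoc')
          show "\<forall>c\<in>set (ds'' @ [e]). proper_cell sep c" using proper' e by (simp add: snoc')
          show "sorted_wrt (\<lambda>c d. chi d < clo c) (ds'' @ [e])" if sep
            using sorted''[OF that] by (simp add: sorted_wrt_append e_def)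
        qed simp_all
        then have "represented sep (map item_of ds'' @ (merge_order sep (cord d') A, cflag d', UNIV) # [])
            (nested_sum (map on_nat (map cfn (ds'' @ [e]) @ shifted_powers [])))"
          by (simp add: e_def item_of_def)
        then have "represented sep (map item_of ds'' @ (cord d', cflag d', cexp d') # (A, cflag d, cexp d) # [])
            (nested_sum (map on_nat (map cfn (ds'' @ [e]) @ shifted_powers [])))"
          by (rule represented_merge) auto
        then have "represented sep (map item_of ds @ its) (nested_sum (xs' @ [f']))"
          by (simp add: snoc snoc' its item_of_def A_def xs'_def f'_def e_def)
        then have "represented sep (map item_of ds @ its) (\<lambda>N. nested_sum (xs' @ [\<lambda>k. f' k * on_nat U (Suc k)]) N - on_nat U 1 * nested_sum (xs' @ [f']) N)"
          using up pf_value[OF U(1), of 1]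
          by (intro represented_diff represented_smult) (simp_all add: ys_def ss on_nat_def)
        then show ?thesis
          by (rule represented_cong) (simp add: xs ys_def ss \<Delta>_def nested_sum_telescope_last)
      next
        case (Cons s0 ss0)
        then obtain it0 its0 where its: "its = it0 # its0" using less.prems(4) by (cases its) auto
        define g where "g = on_nat (\<lambda>z. 1 / (z + of_nat (length ss0)) ^ s0)"
        have ys: "ys = g # map on_nat (shifted_powers ss0)" by (simp add: ys_def g_def Cons)
        have "represented sep (map item_of ds @ its) (nested_sum (xs' @ f' # (\<lambda>k. on_nat U k * g k) # map on_nat (shifted_powers ss0)))"
          using down[OF Cons its] by (simp add: g_def snoc its xs)
        then have "represented sep (map item_of ds @ its) (\<lambda>N. nested_sum (xs' @ (\<lambda>k. f' k * on_nat U (Suc k)) # ys) N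
            - nested_sum (xs' @ f' # (\<lambda>k. on_nat U k * g k) # map on_nat (shifted_powers ss0)) N)"
          using up by (intro represented_diff)
        then show ?thesis
          by (rule represented_cong) (simp add: xs ys \<Delta>_def nested_sum_telescope_mid)
      qed
    qed
    have "represented sep (map item_of ds @ its) (\<lambda>N.
        (\<Sum>s=1..A. C s * nested_sum (xs @ on_nat (\<lambda>z. 1 / (z + of_nat b) ^ s) # ys) N) + nested_sum (xs @ \<Delta> # ys) N)"
      by (intro represented_add represented_sum moved telescoped) auto
    then show ?thesis by (rule represented_cong) (rule split)
  qed
qed

end

section \<open>Removal of polynomial parts\<close>

text \<open>The convergence condition \<open>\<sigma>\<^sub>1 + \<dots> + \<sigma>\<^sub>j \<ge> j + 1\<close> for all \<open>j\<close>; \<open>t\<close> accumulates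
  \<open>(\<sigma>\<^sub>1 - 1) + \<dots> + (\<sigma>\<^sub>j - 1)\<close>.\<close>

fun conv_ok :: "int \<Rightarrow> int list \<Rightarrow> bool" where
  "conv_ok t [] \<longleftrightarrow> True"
| "conv_ok t (\<sigma> # \<sigma>s) \<longleftrightarrow> t + \<sigma> \<ge> 2 \<and> conv_ok (t + \<sigma> - 1) \<sigma>s"

lemma conv_ok_append: "conv_ok t (xs @ ys) \<longleftrightarrow> conv_ok t xs \<and> conv_ok (t + (\<Sum>\<sigma>\<leftarrow>xs. \<sigma> - 1)) ys"
  by (induction xs arbitrary: t) (auto simp: algebra_simps)

lemma conv_ok_mono: "conv_ok t xs \<Longrightarrow> t \<le> t' \<Longrightarrow> conv_ok t' xs"
  by (induction xs arbitrary: t t') (simp, fastforce)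

context subfield
begin

text \<open>In contrast to \<open>proper_cell\<close> a polynomial part is allowed, and the flag is
  tied to growth: \<open>csg c \<le> 1\<close> becomes the degree condition counted in (b).\<close>

definition mero_cell :: "bool \<Rightarrow> cell \<Rightarrow> bool" where
  "mero_cell sep c \<longleftrightarrow> (sep \<longrightarrow> clo c \<le> chi c) \<and> decay (cfn c) (csg c) \<and> (cflag c \<longleftrightarrow> csg c \<le> 1) \<and>
     (\<exists>a C. mf a (cfn c) C \<and> (\<forall>x. a x \<le> cord c) \<and>
       (sep \<longrightarrow> (\<forall>x. a x > 0 \<longrightarrow> clo c \<le> x \<and> x \<le> chi c)) \<and> (\<forall>s. C s \<noteq> 0 \<longrightarrow> s \<in> cexp c))"

lemma mero_cell_proper:
  assumes "mero_cell sep c" "csg c \<ge> 1"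
  shows "proper_cell sep c"
proof -
  obtain a C where *: "mf a (cfn c) C" "\<And>x. a x \<le> cord c"
    "sep \<Longrightarrow> (\<forall>x. a x > 0 \<longrightarrow> clo c \<le> x \<and> x \<le> chi c)" "\<And>s. C s \<noteq> 0 \<Longrightarrow> s \<in> cexp c"
    "sep \<Longrightarrow> clo c \<le> chi c" "decay (cfn c) (csg c)" "cflag c \<longleftrightarrow> csg c \<le> 1"
    using assms(1) unfolding mero_cell_def by blast
  have pf: "pf a (cfn c) C" by (rule mf_proper[OF *(1) decay_mono[OF *(6) assms(2)]])
  have "cflag c" if "C 1 \<noteq> 0"
  proof (rule ccontr)
    assume "\<not> cflag c"
    then have "decay (cfn c) 2" using *(7) by (intro decay_mono[OF *(6)]) simp
    then show False using pf_residue_zero[OF pf] that by simp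
  qed
  then show ?thesis unfolding proper_cell_def using pf * by blast
qed

text \<open>A polynomial factor creates no poles, so the interval is kept. The order becomes a free
  parameter because the merge rule of \<open>adm\<close> expects the full merge order there.\<close>

definition poly_product_cell :: "cell \<Rightarrow> (complex \<Rightarrow> complex) \<Rightarrow> nat \<Rightarrow> int \<Rightarrow> cell" where
  "poly_product_cell c f A \<sigma> = c\<lparr>cfn := f, cord := A, cflag := csg c + \<sigma> \<le> 1, cexp := UNIV, csg := csg c + \<sigma>\<rparr>"

lemma poly_product_cell_simps [simp]:
  "cfn (poly_product_cell c f A \<sigma>) = f" "csg (poly_product_cell c f A \<sigma>) = csg c + \<sigma>"
  "clo (poly_product_cell c f A \<sigma>) = clo c" "chi (poly_product_cell c f A \<sigma>) = chi c"
  "item_of (poly_product_cell c f A \<sigma>) = (A, csg c + \<sigma> \<le> 1, UNIV)"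
  by (auto simp: poly_product_cell_def item_of_def)

lemma mero_poly_product_cell:
  assumes "mero_cell sep c" "poly_over B" "decay (poly B) \<sigma>" "cord c \<le> A"
  shows "mero_cell sep (poly_product_cell c (\<lambda>z. cfn c z * poly B z) A \<sigma>)"
proof -
  obtain a C where *: "mf a (cfn c) C" "\<And>x. a x \<le> cord c"
    "sep \<Longrightarrow> (\<forall>x. a x > 0 \<longrightarrow> clo c \<le> x \<and> x \<le> chi c)"
    "sep \<Longrightarrow> clo c \<le> chi c" "decay (cfn c) (csg c)"
    using assms(1) unfolding mero_cell_def by blast
  have "mero a (\<lambda>z. poly B z * cfn c z)"
    using *(1) assms(2) by (intro mero_mult_poly) (auto simp: mero_def)
  then have "mero a (\<lambda>z. cfn c z * poly B z)"
    by (rule mero_cong) simp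
  then obtain D where D: "mf a (\<lambda>z. cfn c z * poly B z) D" by (auto simp: mero_def)
  have "decay (\<lambda>z. cfn c z * poly B z) (csg c + \<sigma>)"
    by (rule decay_mult[OF *(5) assms(3)])
  then show ?thesis
    unfolding mero_cell_def poly_product_cell_def using * D assms(4) by (auto intro: order_trans)
qed

lemma le_merge_order1: "A \<le> merge_order sep A B" and le_merge_order2: "B \<le> merge_order sep A B"
  by (auto simp: merge_order_def)

text \<open>A factor with a polynomial part has exponent at most 0. Since \<open>conv_ok\<close>
  bars such a factor from first place, there is always a left neighbour to absorb its
  antidifference, and no boundary term at infinity arises.\<close>

lemma represented_cells:
  assumes "\<forall>c\<in>set cs. mero_cell sep c"
    and "sep \<Longrightarrow> sorted_wrt (\<lambda>c d. chi d < clo c) cs"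
    and "conv_ok 0 (map csg cs)"
  shows "represented sep (map item_of cs) (nested_sum (map on_nat (map cfn cs)))"
  using assms
\<comment> \<open>Passing to the proper part clears one nonpositive exponent. A merge removes a
  cell; the merged cell may have a nonpositive exponent, but the removed one had it too.\<close>
proof (induction "length cs + length (filter (\<lambda>c. csg c \<le> 0) cs)" arbitrary: cs rule: less_induct)
  case less
  note IH = less.hyps
  show ?case
  proof (cases "\<exists>d\<in>set cs. csg d \<le> 0")
    case False
    have "\<forall>c\<in>set cs. proper_cell sep c"
      using False less.prems(1) mero_cell_proper by fastforce
    moreover have "\<not> fst (snd (hd (map item_of cs)))" if "cs \<noteq> []"
      using that less.prems by (cases cs) (auto simp: item_of_def mero_cell_def)
    ultimately show ?thesis
      using represented_proper_cells[of cs sep "[]" "[]"] less.prems(2) by simp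
  next
    case True
    then obtain xs d ys where cs: "cs = xs @ d # ys" and d0: "csg d \<le> 0"
      by (meson split_list)
    have "xs \<noteq> []" using less.prems(3) d0 by (auto simp: cs)
    then obtain xs' d' where xs: "xs = xs' @ [d']" by (metis rev_exhaust)
    note cells = less.prems(1)[unfolded cs xs]
    have sorted: "sorted_wrt (\<lambda>c d. chi d < clo c) xs'" "\<And>c. c \<in> set xs' \<Longrightarrow> chi d' < clo c"
      "\<And>c. c \<in> set xs' \<Longrightarrow> chi d < clo c" "\<And>c e. c \<in> set xs' \<Longrightarrow> e \<in> set ys \<Longrightarrow> chi e < clo c"
      "chi d < clo d'" "\<And>e. e \<in> set ys \<Longrightarrow> chi e < clo d'" "\<And>e. e \<in> set ys \<Longrightarrow> chi e < clo d"
      "sorted_wrt (\<lambda>c d. chi d < clo c) ys" if sep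
      using less.prems(2)[OF that] by (auto simp: cs xs sorted_wrt_append)
    define t where "t = (\<Sum>\<sigma>\<leftarrow>map csg xs'. \<sigma> - 1)"
    \<comment> \<open>Replacing \<open>d'\<close> and \<open>d\<close> by one cell of exponent csg
      d' + csg d - 1 passes the same value t + csg d' + csg d - 2 on to \<open>ys\<close>: the
      degree lost to the antidifference is paid by the variable saved.\<close>
    have conv: "conv_ok 0 (map csg xs')" "t + csg d' \<ge> 2" "t + csg d' + csg d \<ge> 3"
      "conv_ok (t + csg d' + csg d - 2) (map csg ys)"
      using less.prems(3) by (auto simp: cs xs conv_ok_append t_def algebra_simps)
    have d: "mero_cell sep d" and d': "mero_cell sep d'" using cells by auto
    then obtain a C where mf: "mf a (cfn d) C" and aA: "\<And>x. a x \<le> cord d"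
      and supp: "sep \<Longrightarrow> (\<forall>x. a x > 0 \<longrightarrow> clo d \<le> x \<and> x \<le> chi d)"
      and C: "\<And>s. C s \<noteq> 0 \<Longrightarrow> s \<in> cexp d" and lh: "sep \<Longrightarrow> clo d \<le> chi d"
      and bd: "decay (cfn d) (csg d)" and flag: "cflag d"
      using d0 unfolding mero_cell_def by auto
    define m where "m = nat (- csg d)"
    have m: "csg d = - int m" using d0 by (simp add: m_def)
    obtain q g where q: "poly_over q" "degree q \<le> m" and g: "pf a g C"
      and qg: "\<And>z. nonpole a z \<Longrightarrow> cfn d z = poly q z + g z"
      using mf_split[OF mf bd[unfolded m]] by metis
    obtain B where B: "poly_over B" "degree B \<le> Suc (degree q)" "\<And>z. poly B (z + 1) - poly B z = poly q z"
      using poly_antidifference[OF q(1)] by blast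
    define B1 where "B1 = pcompose B [:1, 1:]"
    have B1: "poly_over B1" "degree B1 \<le> Suc m" "\<And>z. poly B1 z = poly B (z + 1)"
      using B q(2) by (auto simp: B1_def poly_pcompose degree_pcompose add.commute)
    have bB: "decay (poly B) (csg d - 1)" "decay (poly B1) (csg d - 1)"
    proof -
      have m1: "csg d - 1 = - int (Suc m)" by (simp add: m)
      show "decay (poly B) (csg d - 1)" "decay (poly B1) (csg d - 1)"
        unfolding m1 by (rule decay_poly; use B(2) B1(2) q(2) in simp)+
    qed
    have resB1: "on_nat (poly B1) k = on_nat (poly B) (Suc k)" for k
      by (simp add: on_nat_def B1 add.commute)
    define U where "U = map on_nat (map cfn xs')"
    define f where "f = on_nat (cfn d')"
    define V where "V = map on_nat (map cfn ys)"
    define b where "b = on_nat (poly B)"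
    have split: "nested_sum (map on_nat (map cfn cs)) N =
        nested_sum (U @ f # on_nat g # V) N + nested_sum (U @ f # (\<lambda>k. b (Suc k) - b k) # V) N" for N
    proof -
      have "nested_sum (map on_nat (map cfn cs)) N = nested_sum ((U @ [f]) @ on_nat (cfn d) # V) N"
        by (simp add: cs xs U_def V_def f_def)
      also have "\<dots> = nested_sum ((U @ [f]) @ (\<lambda>k. on_nat g k + (b (Suc k) - b k)) # V) N"
        by (rule nested_sum_cong_at) (simp add: qg b_def on_nat_def B(3)[symmetric] add.commute)
      also have "\<dots> = nested_sum ((U @ [f]) @ on_nat g # V) N + nested_sum ((U @ [f]) @ (\<lambda>k. b (Suc k) - b k) # V) N"
        by (rule nested_sum_add)
      finally show ?thesis by simp
    qed
    have proper_part: "represented sep (map item_of cs) (nested_sum (U @ f # on_nat g # V))"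
    proof -
      \<comment> \<open>Exponent 1 is what \<open>pf_decay\<close> grants to any proper fraction,
        and it agrees with the flag of \<open>d\<close>, so the item does not change.\<close>
      define e where "e = d\<lparr>cfn := g, csg := 1\<rparr>"
      have e: "mero_cell sep e"
        unfolding mero_cell_def e_def
        using mf_pf[OF g] aA supp C lh flag pf_decay[OF g] by auto
      have "represented sep (map item_of (xs' @ d' # e # ys)) (nested_sum (map on_nat (map cfn (xs' @ d' # e # ys))))"
      proof (rule IH)
        show "length (xs' @ d' # e # ys) + length (filter (\<lambda>c. csg c \<le> 0) (xs' @ d' # e # ys))
            < length cs + length (filter (\<lambda>c. csg c \<le> 0) cs)"
          using d0 by (simp add: cs xs e_def)
        show "\<forall>c\<in>set (xs' @ d' # e # ys). mero_cell sep c" using cells e by auto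
        show "sorted_wrt (\<lambda>c d. chi d < clo c) (xs' @ d' # e # ys)" if sep
          using sorted[OF that] by (auto simp: sorted_wrt_append e_def)
        show "conv_ok 0 (map csg (xs' @ d' # e # ys))"
          using conv d0 conv_ok_mono[OF conv(4), of "t + csg d' - 1"]
          by (auto simp: conv_ok_append t_def e_def algebra_simps)
      qed
      moreover have "item_of e = item_of d" by (simp add: e_def item_of_def)
      ultimately show ?thesis by (simp add: cs xs U_def V_def f_def e_def)
    qed
    have up: "represented sep (map item_of cs) (nested_sum (U @ (\<lambda>k. f k * b (Suc k)) # V))"
    proof -
      define u where "u = poly_product_cell d' (\<lambda>z. cfn d' z * poly B1 z) (merge_order sep (cord d') (cord d)) (csg d - 1)"
      have u: "mero_cell sep u"
        unfolding u_def by (rule mero_poly_product_cell[OF d' B1(1) bB(2) le_merge_order1])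
      have "represented sep (map item_of (xs' @ u # ys)) (nested_sum (map on_nat (map cfn (xs' @ u # ys))))"
      proof (rule IH)
        show "length (xs' @ u # ys) + length (filter (\<lambda>c. csg c \<le> 0) (xs' @ u # ys))
            < length cs + length (filter (\<lambda>c. csg c \<le> 0) cs)"
          using d0 by (simp add: cs xs)
        show "\<forall>c\<in>set (xs' @ u # ys). mero_cell sep c" using cells u by auto
        show "sorted_wrt (\<lambda>c d. chi d < clo c) (xs' @ u # ys)" if sep
          using sorted[OF that] by (auto simp: sorted_wrt_append u_def)
        show "conv_ok 0 (map csg (xs' @ u # ys))"
          using conv by (auto simp: conv_ok_append t_def u_def algebra_simps)
      qed
      then have "represented sep (map item_of xs' @ (merge_order sep (cord d') (cord d), csg d' + (csg d - 1) \<le> 1, UNIV) # map item_of ys)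
          (nested_sum (map on_nat (map cfn (xs' @ u # ys))))"
        by (simp add: u_def)
      then have "represented sep (map item_of xs' @ (cord d', cflag d', cexp d') # (cord d, cflag d, cexp d) # map item_of ys)
          (nested_sum (map on_nat (map cfn (xs' @ u # ys))))"
        \<comment> \<open>The flag of \<open>d\<close> licenses any flag on the merged cell. If
          \<open>d'\<close> comes first, then t = 0 and \<open>conv(3)\<close> gives the merged cell
          an exponent of at least 2, hence no flag.\<close>
        by (rule represented_merge) (use flag conv(3) in \<open>auto simp: t_def\<close>)
      moreover have "on_nat (cfn u) = (\<lambda>k. f k * b (Suc k))"
        using resB1 by (simp add: u_def f_def b_def) (simp add: on_nat_def[abs_def])
      ultimately show ?thesis by (simp add: cs xs U_def V_def item_of_def)
    qed
    have telescoped: "represented sep (map item_of cs) (nested_sum (U @ f # (\<lambda>k. b (Suc k) - b k) # V))"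
    proof (cases ys)
      case Nil
      \<comment> \<open>The lower end of the telescope leaves \<open>b 1\<close> times the sum
        without \<open>d\<close>. Multiplying \<open>d'\<close> by the polynomial 1 merely relaxes
        its item, so that the shorter sum fits the items of \<open>cs\<close>.\<close>
      define e where "e = poly_product_cell d' (cfn d') (merge_order sep (cord d') (cord d)) 0"
      have "mero_cell sep (poly_product_cell d' (\<lambda>z. cfn d' z * poly 1 z) (merge_order sep (cord d') (cord d)) 0)"
        by (rule mero_poly_product_cell[OF d' _ _ le_merge_order1]) (auto intro: decay_cong[OF decay_const[of 1]])
      then have e: "mero_cell sep e" by (simp add: e_def)
      have "represented sep (map item_of (xs' @ [e])) (nested_sum (map on_nat (map cfn (xs' @ [e]))))"
      proof (rule IH)
        show "length (xs' @ [e]) + length (filter (\<lambda>c. csg c \<le> 0) (xs' @ [e]))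
            < length cs + length (filter (\<lambda>c. csg c \<le> 0) cs)"
          by (simp add: cs xs e_def)
        show "\<forall>c\<in>set (xs' @ [e]). mero_cell sep c" using cells e by auto
        show "sorted_wrt (\<lambda>c d. chi d < clo c) (xs' @ [e])" if sep
          using sorted[OF that] by (auto simp: sorted_wrt_append e_def)
        show "conv_ok 0 (map csg (xs' @ [e]))"
          using conv by (auto simp: conv_ok_append t_def e_def)
      qed
      then have "represented sep (map item_of xs' @ (merge_order sep (cord d') (cord d), csg d' + 0 \<le> 1, UNIV) # [])
          (nested_sum (map on_nat (map cfn (xs' @ [e]))))"
        by (simp add: e_def)
      then have "represented sep (map item_of xs' @ (cord d', cflag d', cexp d') # (cord d, cflag d, cexp d) # [])
          (nested_sum (map on_nat (map cfn (xs' @ [e]))))"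
        by (rule represented_merge) (use d' in \<open>auto simp: mero_cell_def\<close>)
      then have "represented sep (map item_of cs) (nested_sum (U @ [f]))"
        by (simp add: cs xs Nil U_def f_def item_of_def e_def)
      moreover have "b 1 \<in> K"
        using poly_over_value[OF B(1), of 1] by (simp add: b_def on_nat_def)
      ultimately have "represented sep (map item_of cs) (\<lambda>N. nested_sum (U @ [\<lambda>k. f k * b (Suc k)]) N - b 1 * nested_sum (U @ [f]) N)"
        using up by (intro represented_diff represented_smult) (simp_all add: V_def Nil)
      then show ?thesis
        by (rule represented_cong) (simp add: V_def Nil nested_sum_telescope_last)
    next
      case (Cons e ys')
      have e: "mero_cell sep e" using cells Cons by auto
      define w where "w = poly_product_cell e (\<lambda>z. cfn e z * poly B z) (merge_order sep (cord d) (cord e)) (csg d - 1)"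
      have w: "mero_cell sep w"
        unfolding w_def by (rule mero_poly_product_cell[OF e B(1) bB(1) le_merge_order2])
      have "represented sep (map item_of (xs' @ d' # w # ys')) (nested_sum (map on_nat (map cfn (xs' @ d' # w # ys'))))"
      proof (rule IH)
        show "length (xs' @ d' # w # ys') + length (filter (\<lambda>c. csg c \<le> 0) (xs' @ d' # w # ys'))
            < length cs + length (filter (\<lambda>c. csg c \<le> 0) cs)"
          using d0 by (simp add: cs xs Cons)
        show "\<forall>c\<in>set (xs' @ d' # w # ys'). mero_cell sep c" using cells w Cons by auto
        show "sorted_wrt (\<lambda>c d. chi d < clo c) (xs' @ d' # w # ys')" if sep
          using sorted[OF that] by (auto simp: sorted_wrt_append w_def Cons)
        show "conv_ok 0 (map csg (xs' @ d' # w # ys'))"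
          using conv by (auto simp: conv_ok_append t_def w_def Cons algebra_simps)
      qed
      then have "represented sep ((map item_of xs' @ [item_of d']) @ (merge_order sep (cord d) (cord e), csg e + (csg d - 1) \<le> 1, UNIV) # map item_of ys')
          (nested_sum (map on_nat (map cfn (xs' @ d' # w # ys'))))"
        by (simp add: w_def)
      then have "represented sep ((map item_of xs' @ [item_of d']) @ (cord d, cflag d, cexp d) # (cord e, cflag e, cexp e) # map item_of ys')
          (nested_sum (map on_nat (map cfn (xs' @ d' # w # ys'))))"
        by (rule represented_merge) (use flag in auto)
      moreover have "on_nat (cfn w) = (\<lambda>k. b k * on_nat (cfn e) k)"
        by (simp add: w_def b_def) (simp add: on_nat_def[abs_def] mult.commute)
      ultimately have "represented sep (map item_of cs) (nested_sum (U @ f # (\<lambda>k. b k * on_nat (cfn e) k) # map on_nat (map cfn ys')))"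
        by (simp add: cs xs Cons U_def f_def item_of_def)
      then have "represented sep (map item_of cs) (\<lambda>N. nested_sum (U @ (\<lambda>k. f k * b (Suc k)) # V) N
          - nested_sum (U @ f # (\<lambda>k. b k * on_nat (cfn e) k) # map on_nat (map cfn ys')) N)"
        using up by (intro represented_diff)
      then show ?thesis
        by (rule represented_cong) (simp add: V_def Cons nested_sum_telescope_mid)
    qed
    show ?thesis
      by (rule represented_cong[OF represented_add[OF proper_part telescoped]]) (rule split)
  qed
qed

end

section \<open>Extraction of conditions (a) and (b) from \<open>adm\<close>\<close>

lemma adm_length: "adm sep its s \<Longrightarrow> length s \<le> length its"
  by (induction rule: adm.induct) (auto dest: list_all2_lengthD)

text \<open>After a merge the item list is shorter, and \<open>adm_length\<close> then rules out
  full length; hence the parity sets of the original items still apply.\<close>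

lemma adm_full: "adm sep its s \<Longrightarrow> length s = length its \<Longrightarrow> list_all2 leaf_ok its s"
  by (induction rule: adm.induct) (auto dest: adm_length)

lemma adm_ge_1: "adm sep its s \<Longrightarrow> \<forall>x\<in>set s. x \<ge> 1"
  by (induction rule: adm.induct) (auto dest: leaf_ok_ge_1)

lemma adm_hd_ge_2: "adm sep its s \<Longrightarrow> \<not> fst (snd (hd its)) \<Longrightarrow> s \<noteq> [] \<Longrightarrow> hd s \<ge> 2"
proof (induction rule: adm.induct)
  case (adm_leaf its s)
  then show ?case by (cases its; cases s) (auto simp: leaf_ok_def)
next
  case (adm_merge xs A A' F'' ys s F F' E E')
  then show ?case by (cases xs) auto
qed auto

text \<open>Condition (a) in list form: the consecutive blocks exhaust the orders, and their cut
  positions are the l_j.\<close>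

inductive blocks :: "nat list \<Rightarrow> nat list \<Rightarrow> bool" where
  blocks_Nil: "blocks [] []"
| blocks_Cons: "b \<noteq> [] \<Longrightarrow> s \<le> sum_list b \<Longrightarrow> blocks As ss \<Longrightarrow> blocks (b @ As) (s # ss)"

text \<open>The two orders replacing \<open>M\<close> stay in its block, whose sum does not
  decrease.\<close>

lemma blocks_split:
  "blocks Bs s \<Longrightarrow> Bs = xs @ M # ys \<Longrightarrow> M \<le> A + A' \<Longrightarrow> blocks (xs @ A # A' # ys) s"
proof (induction arbitrary: xs rule: blocks.induct)
  case (blocks_Cons b s As ss)
  from blocks_Cons.prems(1) consider
      (inner) v where "b = xs @ M # v" "ys = v @ As"
    | (outer) zs where "xs = b @ zs" "As = zs @ M # ys"
    by (auto simp: append_eq_append_conv2 append_eq_Cons_conv)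
  then show ?case
  proof cases
    case (inner v)
    have "blocks ((xs @ A # A' # v) @ As) (s # ss)"
      using blocks_Cons.hyps blocks_Cons.prems inner by (intro blocks.blocks_Cons) auto
    then show ?thesis by (simp add: inner)
  next
    case (outer zs)
    have "blocks (b @ (zs @ A # A' # ys)) (s # ss)"
      using blocks_Cons outer by (intro blocks.blocks_Cons) auto
    then show ?thesis by (simp add: outer)
  qed
qed simp

lemma adm_blocks: "adm sep its s \<Longrightarrow> s \<noteq> [] \<Longrightarrow> blocks (map fst its) s"
proof (induction rule: adm.induct)
  case (adm_leaf its s)
  then show ?case
  proof (induction rule: list_all2_induct)
    case (Cons it its s ss)
    have "blocks (map fst its) ss" by (cases "ss = []") (use Cons in \<open>auto intro: blocks_Nil\<close>)
    then show ?case using blocks_Cons[of "[fst it]" s] Cons by (auto simp: leaf_ok_def)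
  qed auto
next
  case (adm_merge xs A A' F'' ys s F F' E E')
  then show ?case using blocks_split[OF adm_merge.IH, of "map fst xs" "merge_order sep A A'" "map fst ys" A A']
    by (auto simp: merge_order_def)
qed auto

lemma blocks_boundaries:
  "blocks As s \<Longrightarrow> \<exists>l. l 0 = 0 \<and> l (length s) = length As \<and>
     (\<forall>j<length s. l j < l (Suc j) \<and> l (Suc j) \<le> length As \<and> s ! j \<le> (\<Sum>i = l j..<l (Suc j). As ! i))"
proof (induction rule: blocks.induct)
  case blocks_Nil
  then show ?case by (intro exI[of _ "\<lambda>_. 0"]) auto
next
  case (blocks_Cons b s As ss)
  then obtain l where l: "l 0 = 0" "l (length ss) = length As"
    "\<And>j. j < length ss \<Longrightarrow> l j < l (Suc j) \<and> l (Suc j) \<le> length As \<and> ss ! j \<le> (\<Sum>i = l j..<l (Suc j). As ! i)"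
    by auto
  define l' where "l' = (\<lambda>j. case j of 0 \<Rightarrow> 0 | Suc j' \<Rightarrow> l j' + length b)"
  have "l' j < l' (Suc j) \<and> l' (Suc j) \<le> length (b @ As) \<and> (s # ss) ! j \<le> (\<Sum>i = l' j..<l' (Suc j). (b @ As) ! i)" if "j < length (s # ss)" for j
  proof (cases j)
    case 0
    have "(\<Sum>i = 0..<length b. (b @ As) ! i) = sum_list b"
      by (simp add: sum_list_sum_nth nth_append)
    then show ?thesis using blocks_Cons.hyps by (simp add: 0 l'_def l(1))
  next
    case (Suc j')
    have "(\<Sum>i = l j' + length b..<l (Suc j') + length b. (b @ As) ! i) = (\<Sum>i = l j'..<l (Suc j'). As ! i)"
      by (simp add: sum.shift_bounds_nat_ivl nth_append)
    then show ?thesis using l(3)[of j'] that by (simp add: Suc l'_def)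
  qed
  then show ?case
    by (intro exI[of _ l']) (auto simp: l'_def l)
qed

text \<open>An entry matched with the maximum is matched with the larger of the two orders, and the
  other one is skipped.\<close>

lemma list_emb_split_max:
  "list_emb (\<le>) s Bs \<Longrightarrow> Bs = xs @ max A A' # ys \<Longrightarrow> list_emb (\<le>) s (xs @ A # A' # ys)"
  for A :: "'a::linorder"
proof (induction arbitrary: xs rule: list_emb.induct)
  case (list_emb_Cons s Bs B)
  show ?case
  proof (cases xs)
    case Nil
    then show ?thesis using list_emb_Cons by (auto intro: list_emb.intros)
  next
    case (Cons x xs')
    then show ?thesis using list_emb_Cons by (auto intro: list_emb.intros)
  qed
next
  case (list_emb_Cons2 x B s Bs)
  show ?case
  proof (cases xs)
    case Nil
    then show ?thesis using list_emb_Cons2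
      by (cases "A \<le> A'") (auto simp: max_def intro: list_emb.intros)
  next
    case (Cons x xs')
    then show ?thesis using list_emb_Cons2 by (auto intro: list_emb.intros)
  qed
qed auto

lemma adm_True_emb: "adm True its s \<Longrightarrow> list_emb (\<le>) s (map fst its)"
proof (induction rule: adm.induct)
  case (adm_leaf its s)
  then show ?case
    by (induction rule: list_all2_induct) (auto simp: leaf_ok_def intro: list_emb.intros)
next
  case (adm_merge xs A A' F'' ys s F F' E E')
  then show ?case using list_emb_split_max[OF adm_merge.IH, of "map fst xs" A A' "map fst ys"]
    by (auto simp: merge_order_def)
qed auto

text \<open>In a leaf every 1 sits on a flagged item, and undoing a merge never lowers the number of
  flags.\<close>

lemma adm_count_ones:
  "adm sep its s \<Longrightarrow> length (filter (\<lambda>x. x = 1) s) \<le> length (filter (\<lambda>it. fst (snd it)) its)"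
proof (induction rule: adm.induct)
  case (adm_leaf its s)
  then show ?case
    by (induction rule: list_all2_induct) (auto simp: leaf_ok_def)
qed (auto split: if_splits)

lemma list_emb_indices:
  "list_emb P s As \<Longrightarrow> \<exists>t. strict_mono_on {..<length s} t \<and> (\<forall>j<length s. t j < length As \<and> P (s ! j) (As ! t j))"
proof (induction rule: list_emb.induct)
  case (list_emb_Nil As)
  then show ?case by (auto simp: strict_mono_on_def)
next
  case (list_emb_Cons s As A)
  then obtain t where t: "strict_mono_on {..<length s} t" "\<And>j. j < length s \<Longrightarrow> t j < length As \<and> P (s ! j) (As ! t j)"
    by blast
  then show ?case
    by (intro exI[of _ "\<lambda>j. Suc (t j)"]) (auto simp: strict_mono_on_def)
next
  case (list_emb_Cons2 x A s As)
  then obtain t where t: "strict_mono_on {..<length s} t" "\<And>j. j < length s \<Longrightarrow> t j < length As \<and> P (s ! j) (As ! t j)"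
    by blast
  define t' where "t' = (\<lambda>j. case j of 0 \<Rightarrow> 0 | Suc j' \<Rightarrow> Suc (t j'))"
  have "strict_mono_on {..<length (x # s)} t'"
    using t(1) by (auto simp: strict_mono_on_def t'_def split: nat.splits)
  moreover have "t' j < length (A # As) \<and> P ((x # s) ! j) ((A # As) ! t' j)" if "j < length (x # s)" for j
    using t(2) that list_emb_Cons2 by (cases j) (auto simp: t'_def)
  ultimately show ?case by blast
qed

section \<open>Symmetrised monomials\<close>

lemma power_int_minus_one: "(- 1 :: complex) powi k = (if even k then 1 else - 1)"
  by (cases "k \<ge> 0") (auto simp: power_int_def minus_one_power_iff even_nat_iff)

lemma conv_ok_upt:
  assumes "\<And>j. j \<in> {1..p} \<Longrightarrow> (\<Sum>i=1..j. \<sigma> i) \<ge> int j + 1"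
  shows "conv_ok 0 (map \<sigma> [1..<p + 1])"
  using assms
proof (induction p)
  case (Suc p)
  have "(\<Sum>i\<leftarrow>map \<sigma> [1..<p + 1]. i - 1) = (\<Sum>i=1..p. \<sigma> i) - int p"
    by (induction p) auto
  then show ?case using Suc.IH Suc.prems[of "Suc p"] Suc.prems by (auto simp: conv_ok_append)
qed simp

text \<open>Abel summation: with \<open>T\<^sub>j = \<tau>\<^sub>1 + \<dots> + \<tau>\<^sub>j\<close>, the product of the \<open>k\<^sub>j\<^sup>-\<^sup>\<tau>\<^sup>j\<close> equals
  \<open>k\<^sub>p\<^sup>-\<^sup>T\<^sup>p\<close> times the product of the \<open>(k\<^sub>j / k\<^sub>j\<^sub>+\<^sub>1)\<^sup>-\<^sup>T\<^sup>j\<close> over \<open>j < p\<close>.\<close>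

lemma prod_powi_le_1:
  assumes k: "k \<in> hyp_index p" and T: "\<And>j. j \<in> {1..p} \<Longrightarrow> (\<Sum>i=1..j. \<tau> i) \<ge> (0::int)"
  shows "(\<Prod>j=1..p. real (k j) powi (- \<tau> j)) \<le> 1"
proof (cases "p = 0")
  case False
  have k1: "k j \<ge> 1" if "j \<in> {1..p}" for j
    using k that by (auto simp: hyp_index_def PiE_iff)
  have powi_le: "real b powi (- t) \<le> real a powi (- t)" if "1 \<le> a" "a \<le> b" "t \<ge> 0" for a b t
    using that by (simp add: power_int_def power_mono le_imp_inverse_le flip: power_inverse)
  have "(\<Prod>i=1..j. real (k i) powi (- \<tau> i)) \<le> real (k j) powi (- (\<Sum>i=1..j. \<tau> i))" if "1 \<le> j" "j \<le> p" for j
    using that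
  proof (induction rule: nat_induct_at_least)
    case (Suc j)
    have "(\<Prod>i=1..Suc j. real (k i) powi (- \<tau> i))
        \<le> real (k j) powi (- (\<Sum>i=1..j. \<tau> i)) * real (k (Suc j)) powi (- \<tau> (Suc j))"
      using Suc by (auto intro!: mult_right_mono)
    also have "\<dots> \<le> real (k (Suc j)) powi (- (\<Sum>i=1..j. \<tau> i)) * real (k (Suc j)) powi (- \<tau> (Suc j))"
    proof (intro mult_right_mono powi_le)
      show "k (Suc j) \<le> k j" using k Suc by (auto simp: hyp_index_def)
    qed (use k1 T Suc in auto)
    also have "\<dots> = real (k (Suc j)) powi (- (\<Sum>i=1..Suc j. \<tau> i))"
      using k1[of "Suc j"] Suc by (subst power_int_add[symmetric]) auto
    finally show ?case .
  qed simp
  also have "real (k p) powi (- (\<Sum>i=1..p. \<tau> i)) \<le> 1"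
    using powi_le[of 1 "k p" "\<Sum>i=1..p. \<tau> i"] k1[of p] T[of p] False by simp
  finally show ?thesis using False by simp
qed simp

text \<open>The weights (2, 1, ..., 1) have partial sums j + 1. Once they are peeled off, the
  remaining exponents have nonnegative partial sums, so their product is at most 1 on decreasing
  chains.\<close>

lemma decay_prod_hyp_index:
  assumes decay: "\<And>j. j \<in> {1..p} \<Longrightarrow> decay (f j) (\<sigma> j)"
    and conv: "\<And>j. j \<in> {1..p} \<Longrightarrow> (\<Sum>i=1..j. \<sigma> i) \<ge> int j + 1"
  shows "\<exists>C. \<forall>k\<in>hyp_index p. norm (\<Prod>j=1..p. on_nat (f j) (k j))
    \<le> C * (\<Prod>j=1..p. 1 / real (k j) ^ (if j = 1 then 2 else 1))"
proof -
  define w where "w = (\<lambda>j. if j = (1::nat) then 2 else 1 :: nat)"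
  have "\<exists>C. \<forall>k\<ge>1. norm (on_nat (f j) k) \<le> C * real k powi (- \<sigma> j)" if "j \<in> {1..p}" for j
    using decay[OF that] by (simp add: decay_def on_nat_def)
  then obtain C where C: "\<And>j k. j \<in> {1..p} \<Longrightarrow> k \<ge> 1 \<Longrightarrow> norm (on_nat (f j) k) \<le> C j * real k powi (- \<sigma> j)"
    by metis
  have C0: "C j \<ge> 0" if "j \<in> {1..p}" for j
    using C[OF that, of 1] norm_ge_zero[of "on_nat (f j) 1"] by (simp del: norm_ge_zero)
  have "norm (\<Prod>j=1..p. on_nat (f j) (k j)) \<le> (\<Prod>j=1..p. C j) * (\<Prod>j=1..p. 1 / real (k j) ^ w j)"
    if k: "k \<in> hyp_index p" for k
  proof -
    have k1: "k j \<ge> 1" if "j \<in> {1..p}" for j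
      using k that by (auto simp: hyp_index_def PiE_iff)
    have "norm (\<Prod>j=1..p. on_nat (f j) (k j)) \<le> (\<Prod>j=1..p. C j * real (k j) powi (- \<sigma> j))"
      unfolding prod_norm[symmetric] using C k1 by (intro prod_mono) auto
    also have "\<dots> = (\<Prod>j=1..p. C j * (1 / real (k j) ^ w j)) * (\<Prod>j=1..p. real (k j) powi (- (\<sigma> j - int (w j))))"
      unfolding prod.distrib[symmetric]
    proof (rule prod.cong)
      fix j assume "j \<in> {1..p}"
      then have "real (k j) \<noteq> 0" using k1 by fastforce
      then have "1 / real (k j) ^ w j * real (k j) powi (- (\<sigma> j - int (w j))) = real (k j) powi (- \<sigma> j)"
        by (simp add: power_int_diff power_int_minus field_simps)
      then show "C j * real (k j) powi (- \<sigma> j)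
          = C j * (1 / real (k j) ^ w j) * real (k j) powi (- (\<sigma> j - int (w j)))"
        by (simp only: mult.assoc)
    qed simp
    also have "\<dots> \<le> (\<Prod>j=1..p. C j * (1 / real (k j) ^ w j)) * 1"
    proof (intro mult_left_mono prod_powi_le_1[OF k] prod_nonneg)
      fix j assume j: "j \<in> {1..p}"
      have "(\<Sum>i=1..j. int (w i)) = int j + 1"
        using j by (subst sum.atLeast_Suc_atMost) (auto simp: w_def)
      then show "(\<Sum>i=1..j. \<sigma> i - int (w i)) \<ge> 0"
        using conv[OF j] by (simp add: sum_subtractf)
    qed (use C0 in auto)
    finally show ?thesis by (simp only: prod.distrib mult_1_right)
  qed
  then show ?thesis by (auto simp: w_def)
qed

definition pole_order :: "nat \<Rightarrow> nat \<Rightarrow> nat \<Rightarrow> nat \<Rightarrow> nat" where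
  "pole_order A r n x = (if r \<le> x \<and> x \<le> r + n then A else 0)"

text \<open>One variable's averaged factor over its denominator. The sign \<open>\<epsilon>\<close>
  is the one of \<open>P\<close>; it already includes the (-1)^(A(n+1)) that the denominator
  acquires under reflection, so the ratio itself is multiplied by (-1)^e.\<close>

definition sym_ratio :: "nat \<Rightarrow> nat \<Rightarrow> nat \<Rightarrow> complex \<Rightarrow> nat \<Rightarrow> complex \<Rightarrow> complex" where
  "sym_ratio A r n \<epsilon> d z = (z ^ d + \<epsilon> * (- z - 2 * of_nat r - of_nat n) ^ d) / 2 /
     pochhammer (z + of_nat r) (n + 1) ^ A"

lemma decay_inverse_pochhammer: "decay (\<lambda>z. 1 / pochhammer (z + of_nat r) m) (int m)"
proof (induction m)
  case 0
  then show ?case using decay_const[of 1] by simp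
next
  case (Suc m)
  have "decay (\<lambda>z. 1 / pochhammer (z + of_nat r) m * (1 / (z + of_nat (r + m)))) (int m + 1)"
    by (rule decay_mult[OF Suc decay_term])
  then show ?case by (simp add: pochhammer_Suc add_ac)
qed

lemma decay_sym_ratio: "decay (sym_ratio A r n \<epsilon> d) (int (A * (n + 1)) - int d)"
proof -
  define M :: complex where "M = 2 * of_nat r + of_nat n"
  have "decay (\<lambda>z. (- 1) * z + - M) (- 1)"
    by (intro decay_add decay_smult decay_id decay_mono[OF decay_const]) simp
  then have "decay (\<lambda>z. ((- 1) * z + - M) ^ d) (int d * - 1)" by (rule decay_power)
  then have "decay (\<lambda>z. (1 / 2) * (z ^ d + \<epsilon> * ((- 1) * z + - M) ^ d)) (- int d)"
    using decay_power[OF decay_id, of d] by (intro decay_smult decay_add) simp_all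
  moreover have "decay (\<lambda>z. (1 / pochhammer (z + of_nat r) (n + 1)) ^ A) (int A * int (n + 1))"
    by (rule decay_power[OF decay_inverse_pochhammer])
  ultimately have "decay (\<lambda>z. (1 / 2) * (z ^ d + \<epsilon> * ((- 1) * z + - M) ^ d) *
      (1 / pochhammer (z + of_nat r) (n + 1)) ^ A) (- int d + int A * int (n + 1))"
    by (rule decay_mult)
  moreover have "- int d + int A * int (n + 1) = int (A * (n + 1)) - int d" by (simp add: algebra_simps)
  moreover have "sym_ratio A r n \<epsilon> d = (\<lambda>z. (1 / 2) * (z ^ d + \<epsilon> * ((- 1) * z + - M) ^ d) *
      (1 / pochhammer (z + of_nat r) (n + 1)) ^ A)"
  proof
    fix z
    have "- z - 2 * of_nat r - of_nat n = (- 1) * z + - M" by (simp add: M_def)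
    then show "sym_ratio A r n \<epsilon> d z = (1 / 2) * (z ^ d + \<epsilon> * ((- 1) * z + - M) ^ d) *
        (1 / pochhammer (z + of_nat r) (n + 1)) ^ A"
      unfolding sym_ratio_def by (simp only: power_one_over) simp
  qed
  ultimately show ?thesis by simp
qed

text \<open>The reflection reverses the order of the factors z + r, ..., z + r + n and negates
  each.\<close>

lemma pochhammer_reflect:
  "pochhammer (- z - 2 * of_nat r - of_nat n + of_nat r) (n + 1) = (- 1) ^ (n + 1) * pochhammer (z + of_nat r :: complex) (n + 1)"
  using pochhammer_minus[of "z + of_nat r + of_nat n" "n + 1"] by (simp add: algebra_simps)

context subfield
begin

lemma mero_inverse_pochhammer:
  "mero (\<lambda>x. if r \<le> x \<and> x < r + m then A else 0) (\<lambda>z. 1 / pochhammer (z + of_nat r) m ^ A)"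
proof (induction m)
  case 0
  then show ?case using mero_const[of 1] by simp
next
  case (Suc m)
  have "mero (\<lambda>x. if x = r + m then A else 0) (\<lambda>z. 1 / (z + of_nat (r + m)) ^ A)"
    by (rule mero_term) auto
  from mero_mult[OF Suc this]
  have "mero (\<lambda>x. if r \<le> x \<and> x < r + Suc m then A else 0)
      (\<lambda>z. 1 / pochhammer (z + of_nat r) m ^ A * (1 / (z + of_nat (r + m)) ^ A))"
    by (rule mero_mono) auto
  then show ?case
    by (rule mero_cong) (simp add: pochhammer_Suc power_mult_distrib add_ac)
qed

text \<open>The pole \<open>- x\<close> goes to \<open>- (M - x)\<close>, and a term of order s
  acquires the sign (-1)^s. Since \<open>C\<close> sums over all poles, their permutation leaves
  only this sign.\<close>

lemma mf_reflect:
  assumes sym: "\<And>x. a x > 0 \<Longrightarrow> x \<le> M \<and> a (M - x) = a x" and "mf a f C"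
  shows "mf a (\<lambda>z. f (- z - of_nat M)) (\<lambda>s. (- 1) ^ s * C s)"
proof -
  have eq: "- z - of_nat M + of_nat x = - (z + of_nat (M - x) :: complex)" if "a x > 0" for x z
    using sym[OF that] by (simp add: of_nat_diff)
  have np: "nonpole a (- z - of_nat M)" if "nonpole a z" for z
    unfolding nonpole_def
  proof (intro allI impI)
    fix x assume x: "a x > 0"
    then have "a (M - x) > 0" using sym by simp
    then have "z + of_nat (M - x) \<noteq> 0" by (rule nonpoleD[OF that])
    then show "- z - of_nat M + of_nat x \<noteq> 0" unfolding eq[OF x] neg_equal_0_iff_equal .
  qed
  obtain q g where q: "poly_over q" and g: "pf a g C"
    and f: "\<And>z. nonpole a z \<Longrightarrow> f z = poly q z + g z"
    using assms(2) by (auto simp: mf_def)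
  have "pf a (\<lambda>z. g (- z - of_nat M)) (\<lambda>s. (- 1) ^ s * C s)"
    using g
  proof (induction rule: pf.induct)
    case (pf_zero f)
    then show ?case using pf.pf_zero[of a "\<lambda>z. f (- z - of_nat M)"] np by simp
  next
    case (pf_step f C c s x h)
    have x: "a x > 0" using pf_step.hyps by simp
    have "pf a (\<lambda>z. h (- z - of_nat M)) ((\<lambda>s. (- 1) ^ s * C s)(s := (- 1) ^ s * C s + (- 1) ^ s * c))"
    proof (rule pf.pf_step[OF pf_step.IH _ pf_step.hyps(3)])
      show "(- 1) ^ s * c \<in> K" using pf_step.hyps by (intro K_mult K_power K_minus) auto
      show "s \<le> a (M - x)" using sym[OF x] pf_step.hyps by simp
      fix z assume z: "nonpole a z"
      have "c / (- z - of_nat M + of_nat x) ^ s = (- 1) ^ s * c / (z + of_nat (M - x)) ^ s"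
        unfolding eq[OF x] power_minus[of "z + of_nat (M - x)"] by (cases "even s") auto
      then show "h (- z - of_nat M) = f (- z - of_nat M) + (- 1) ^ s * c / (z + of_nat (M - x)) ^ s"
        using pf_step.hyps(5)[OF np[OF z]] by simp
    qed
    also have "(\<lambda>s. (- 1) ^ s * C s)(s := (- 1) ^ s * C s + (- 1) ^ s * c) = (\<lambda>t. (- 1) ^ t * (C(s := C s + c)) t)"
      by (auto simp: algebra_simps)
    finally show ?case .
  qed
  moreover have "poly_over (pcompose q [:- of_nat M, - 1:])"
    using q by (intro poly_over_pcompose) auto
  ultimately show ?thesis
    unfolding mf_def using f np
    by (intro exI[of _ "pcompose q [:- of_nat M, - 1:]"] exI[of _ "\<lambda>z. g (- z - of_nat M)"])
       (auto simp: poly_pcompose algebra_simps)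
qed

text \<open>Averaging the partial fractions of the plain monomial ratio with their reflection gives
  the coefficients C s (1 + (-1)^(s+e)) / 2, which vanish by construction when s and e differ in
  parity.\<close>

lemma mf_sym_ratio:
  assumes \<epsilon>: "\<epsilon> = (- 1) powi (int (A * (n + 1)) + e)"
  shows "\<exists>C. mf (pole_order A r n) (sym_ratio A r n \<epsilon> d) C \<and> (\<forall>s. C s \<noteq> 0 \<longrightarrow> [int s = e] (mod 2))"
proof -
  define M where "M = 2 * r + n"
  define F where "F = (\<lambda>z. z ^ d / pochhammer (z + of_nat r :: complex) (n + 1) ^ A)"
  define \<eta> :: complex where "\<eta> = (- 1) powi e"
  have \<eta>: "\<epsilon> = \<eta> * (- 1) ^ (A * (n + 1))"
    unfolding \<epsilon> \<eta>_def power_int_minus_one minus_one_power_iff by auto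
  have \<eta>K: "\<eta> \<in> K" by (auto simp: \<eta>_def power_int_minus_one)
  have "mero (pole_order A r n) (\<lambda>z. 1 / pochhammer (z + of_nat r) (n + 1) ^ A)"
    by (rule mero_mono[OF mero_inverse_pochhammer]) (auto simp: pole_order_def)
  from mero_mult_poly[OF this poly_over_monom[of 1 d]]
  have "mero (pole_order A r n) F"
    by (rule mero_cong) (auto simp: F_def poly_monom)
  then obtain C where C: "mf (pole_order A r n) F C" by (auto simp: mero_def)
  have R: "mf (pole_order A r n) (\<lambda>z. F (- z - of_nat M)) (\<lambda>s. (- 1) ^ s * C s)"
    by (rule mf_reflect[OF _ C]) (auto simp: pole_order_def M_def split: if_splits)
  have mf: "mf (pole_order A r n) (\<lambda>z. (1 / 2) * (F z + \<eta> * F (- z - of_nat M)))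
      (\<lambda>s. (1 / 2) * (C s + \<eta> * ((- 1) ^ s * C s)))"
    using \<eta>K by (intro mf_smult mf_add C R) auto
  have "sym_ratio A r n \<epsilon> d z = (1 / 2) * (F z + \<eta> * F (- z - of_nat M))" for z
  proof -
    define D where "D = pochhammer (z + of_nat r) (n + 1)"
    define w where "w = - z - 2 * of_nat r - of_nat n"
    have w: "w = - z - of_nat M" by (simp add: w_def M_def)
    have "F w = w ^ d / ((- 1) ^ (n + 1) * D) ^ A"
      unfolding F_def D_def w_def by (simp only: pochhammer_reflect)
    also have "\<dots> = (- 1) ^ (A * (n + 1)) * (w ^ d / D ^ A)"
      by (simp only: power_mult_distrib power_mult[symmetric] mult.commute[of "n + 1" A])
         (simp add: minus_one_power_iff)
    finally have "\<eta> * F w = \<epsilon> * (w ^ d / D ^ A)" by (simp only: \<eta> mult.assoc)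
    then show ?thesis
      unfolding w[symmetric] sym_ratio_def by (simp add: F_def D_def w_def add_divide_distrib mult.commute)
  qed
  then have "mf (pole_order A r n) (sym_ratio A r n \<epsilon> d) (\<lambda>s. (1 / 2) * (C s + \<eta> * ((- 1) ^ s * C s)))"
    using mf_cong[OF mf] by simp
  moreover have "[int s = e] (mod 2)" if "(1 / 2) * (C s + \<eta> * ((- 1) ^ s * C s)) \<noteq> 0" for s
  proof (rule ccontr)
    assume "\<not> [int s = e] (mod 2)"
    then have "even s \<longleftrightarrow> odd e" unfolding cong_def by presburger
    then have "\<eta> * (- 1) ^ s = - 1" by (auto simp: \<eta>_def power_int_minus_one)
    then have "\<eta> * ((- 1) ^ s * C s) = - C s" by (simp only: mult.assoc[symmetric]) simp
    then show False using that by simp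
  qed
  ultimately show ?thesis by blast
qed

end

text \<open>Single monomials are not invariant under the reflections, but \<open>P\<close> is, up to
  sign; so \<open>P\<close> is the average of itself and \<open>\<epsilon> i\<close> times its i-th
  reflection. Doing this variable by variable symmetrises every factor of every monomial.\<close>

lemma peval_symmetrize:
  assumes keys: "\<And>m. m \<in> Poly_Mapping.keys P \<Longrightarrow> Poly_Mapping.keys m \<subseteq> {1..p}"
    and sym: "\<And>i x. i \<in> {1..p} \<Longrightarrow>
      peval P (x(i := - x i - 2 * of_nat (r i) - of_nat (n i))) = \<epsilon> i * peval P x"
    and \<epsilon>: "\<And>i. \<epsilon> i * \<epsilon> i = 1"
  shows "peval P x = (\<Sum>m\<in>Poly_Mapping.keys P. Poly_Mapping.lookup P m *
     (\<Prod>i=1..p. (x i ^ Poly_Mapping.lookup m i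
       + \<epsilon> i * (- x i - 2 * of_nat (r i) - of_nat (n i)) ^ Poly_Mapping.lookup m i) / 2))"
proof -
  define \<tau> where "\<tau> = (\<lambda>i z. - z - 2 * of_nat (r i) - of_nat (n i) :: complex)"
  define Q where "Q = (\<lambda>m i z. (z ^ Poly_Mapping.lookup m i + \<epsilon> i * \<tau> i z ^ Poly_Mapping.lookup m i) / 2)"
  \<comment> \<open>Variables in \<open>I\<close> are already averaged, the others still enter as
    plain powers.\<close>
  define G where "G = (\<lambda>I x. \<Sum>m\<in>Poly_Mapping.keys P. Poly_Mapping.lookup P m *
     ((\<Prod>i\<in>I. Q m i (x i)) * (\<Prod>i\<in>{1..p} - I. x i ^ Poly_Mapping.lookup m i)))"
  have "peval P x = G I x" if "I \<subseteq> {1..p}" for I x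
  proof -
    have "finite I" using that finite_subset by blast
    then show ?thesis using that
    proof (induction I arbitrary: x rule: finite_induct)
      case empty
      show ?case
        unfolding peval_def G_def
      proof (intro sum.cong refl arg_cong2[where f = "(*)"])
        fix m assume m: "m \<in> Poly_Mapping.keys P"
        have "(\<Prod>i\<in>Poly_Mapping.keys m. x i ^ Poly_Mapping.lookup m i)
            = (\<Prod>i\<in>{1..p}. x i ^ Poly_Mapping.lookup m i)"
          by (rule prod.mono_neutral_left) (use keys[OF m] in \<open>auto simp: in_keys_iff\<close>)
        then show "(\<Prod>i\<in>Poly_Mapping.keys m. x i ^ Poly_Mapping.lookup m i)
            = (\<Prod>i\<in>{}. Q m i (x i)) * (\<Prod>i\<in>{1..p} - {}. x i ^ Poly_Mapping.lookup m i)"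
          by simp
      qed
    next
      case (insert a I)
      have a: "a \<in> {1..p}" and IH: "\<And>y. peval P y = G I y" using insert by auto
      define R where "R = (\<lambda>m. (\<Prod>i\<in>I. Q m i (x i)) * (\<Prod>i\<in>{1..p} - insert a I. x i ^ Poly_Mapping.lookup m i))"
      \<comment> \<open>Coordinate \<open>a\<close> still enters as a plain power; isolating it
        allows the induction hypothesis to be used at \<open>x\<close> and at its reflection
        simultaneously.\<close>
      have GI: "G I (x(a := y)) = (\<Sum>m\<in>Poly_Mapping.keys P. Poly_Mapping.lookup P m * (y ^ Poly_Mapping.lookup m a * R m))" for y
      proof -
        have "(\<Prod>i\<in>I. Q m i ((x(a := y)) i)) * (\<Prod>i\<in>{1..p} - I. (x(a := y)) i ^ Poly_Mapping.lookup m i)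
            = y ^ Poly_Mapping.lookup m a * R m" for m
        proof -
          have 1: "(\<Prod>i\<in>I. Q m i ((x(a := y)) i)) = (\<Prod>i\<in>I. Q m i (x i))"
            using insert.hyps by (intro prod.cong) auto
          have 2: "{1..p} - I = insert a ({1..p} - insert a I)" using a insert.hyps by auto
          have 3: "(\<Prod>i\<in>insert a ({1..p} - insert a I). (x(a := y)) i ^ Poly_Mapping.lookup m i)
              = y ^ Poly_Mapping.lookup m a * (\<Prod>i\<in>{1..p} - insert a I. x i ^ Poly_Mapping.lookup m i)"
          proof -
            have "(\<Prod>i\<in>{1..p} - insert a I. (x(a := y)) i ^ Poly_Mapping.lookup m i)
                = (\<Prod>i\<in>{1..p} - insert a I. x i ^ Poly_Mapping.lookup m i)"
              by (rule prod.cong) auto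
            then show ?thesis by (subst prod.insert) simp_all
          qed
          show ?thesis unfolding 1 2 3 R_def by (simp only: mult_ac)
        qed
        then show ?thesis by (simp only: G_def)
      qed
      have "G (insert a I) x = (\<Sum>m\<in>Poly_Mapping.keys P. Poly_Mapping.lookup P m * (Q m a (x a) * R m))"
        using insert.hyps by (simp add: G_def R_def mult.assoc)
      also have "\<dots> = (G I (x(a := x a)) + \<epsilon> a * G I (x(a := \<tau> a (x a)))) / 2"
        unfolding GI sum_distrib_left sum.distrib[symmetric] sum_divide_distrib
        by (intro sum.cong) (simp_all add: Q_def field_simps)
      also have "\<dots> = (peval P x + \<epsilon> a * (\<epsilon> a * peval P x)) / 2"
        using sym[OF a, of x] by (simp add: IH[symmetric] \<tau>_def)
      also have "\<dots> = peval P x" by (simp add: mult.assoc[symmetric] \<epsilon>)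
      finally show ?case by simp
    qed
  qed
  from this[of "{1..p}"] show ?thesis by (simp add: G_def Q_def \<tau>_def)
qed

lemma (in subfield) adm_admissible:
  assumes adm: "adm sep (map (\<lambda>i. (A i, F i, E i)) [1..<p + 1]) s" and F1: "p \<ge> 1 \<Longrightarrow> \<not> F 1"
  shows "length s \<le> p" "\<And>j. j \<in> {1..length s} \<Longrightarrow> s ! (j - 1) \<ge> 1" "s \<noteq> [] \<Longrightarrow> s ! 0 \<ge> 2"
    and "length s = p \<Longrightarrow> i \<in> {1..p} \<Longrightarrow> s ! (i - 1) \<in> E i"
    and "length s \<ge> 1 \<Longrightarrow> \<exists>l :: nat \<Rightarrow> nat. l 0 = 1 \<and> l (length s) = p + 1 \<and>
           (\<forall>j\<in>{1..length s}. l (j - 1) < l j) \<and>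
           (\<forall>j\<in>{1..length s}. s ! (j - 1) \<le> (\<Sum>i = l (j - 1)..<l j. A i))"
    and "sep \<Longrightarrow> \<exists>t :: nat \<Rightarrow> nat. strict_mono_on {1..length s} t \<and> t ` {1..length s} \<subseteq> {1..p} \<and>
              (\<forall>j\<in>{1..length s}. 1 \<le> s ! (j - 1) \<and> s ! (j - 1) \<le> A (t j))"
    and "card {j \<in> {1..length s}. s ! (j - 1) = 1} \<le> card {i \<in> {1..p}. F i}"
proof -
  define its where "its = map (\<lambda>i. (A i, F i, E i)) [1..<p + 1]"
  have adm': "adm sep its s" using adm by (simp only: its_def)
  have len: "length its = p" by (simp add: its_def del: upt_Suc)
  have nth: "its ! i = (A (Suc i), F (Suc i), E (Suc i))" if "i < p" for i
    using that by (simp add: its_def nth_append del: upt_Suc)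
  have fsts: "map fst its = map A [1..<p + 1]" by (simp add: its_def del: upt_Suc)
  have nthA: "map fst its ! i = A (Suc i)" if "i < p" for i
    using that by (simp add: nth len)
  show "length s \<le> p" using adm_length[OF adm'] len by simp
  show ge1: "s ! (j - 1) \<ge> 1" if "j \<in> {1..length s}" for j
  proof -
    have "s ! (j - 1) \<in> set s" using that by (intro nth_mem) auto
    then show ?thesis using adm_ge_1[OF adm'] by blast
  qed
  show "s ! 0 \<ge> 2" if "s \<noteq> []"
  proof -
    have "p \<ge> 1" using \<open>length s \<le> p\<close> that by (cases s) auto
    then have "\<not> fst (snd (hd its))" using F1 nth[of 0] len by (subst hd_conv_nth) auto
    then have "hd s \<ge> 2" using adm_hd_ge_2[OF adm'] that by blast
    then show ?thesis using that by (simp add: hd_conv_nth)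
  qed
  show "s ! (i - 1) \<in> E i" if "length s = p" "i \<in> {1..p}"
  proof -
    have "list_all2 leaf_ok its s" using adm_full[OF adm'] that len by simp
    then have "leaf_ok (its ! (i - 1)) (s ! (i - 1))"
      by (rule list_all2_nthD) (use that len in auto)
    then show ?thesis using nth[of "i - 1"] that by (auto simp: leaf_ok_def)
  qed
  show "\<exists>l :: nat \<Rightarrow> nat. l 0 = 1 \<and> l (length s) = p + 1 \<and>
           (\<forall>j\<in>{1..length s}. l (j - 1) < l j) \<and>
           (\<forall>j\<in>{1..length s}. s ! (j - 1) \<le> (\<Sum>i = l (j - 1)..<l j. A i))" if "length s \<ge> 1"
  proof -
    have "s \<noteq> []" using that by auto
    then obtain l where l: "l 0 = 0" "l (length s) = p"
      "\<And>j. j < length s \<Longrightarrow> l j < l (Suc j) \<and> l (Suc j) \<le> p \<and> s ! j \<le> (\<Sum>i = l j..<l (Suc j). map fst its ! i)"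
      using blocks_boundaries[OF adm_blocks[OF adm']] len by auto
    have eq: "(\<Sum>i = l j..<l (Suc j). map fst its ! i) = (\<Sum>i = l j + 1..<l (Suc j) + 1. A i)" if "j < length s" for j
    proof -
      have "(\<Sum>i = l j..<l (Suc j). map fst its ! i) = (\<Sum>i = l j..<l (Suc j). A (Suc i))"
        using l(3)[OF that] by (intro sum.cong refl nthA) auto
      then show ?thesis by (simp only: sum.shift_bounds_Suc_ivl Suc_eq_plus1[symmetric])
    qed
    have "l (j - 1) + 1 < l j + 1 \<and> s ! (j - 1) \<le> (\<Sum>i = l (j - 1) + 1..<l j + 1. A i)" if "j \<in> {1..length s}" for j
    proof -
      have j: "j - 1 < length s" "Suc (j - 1) = j" using that by auto
      show ?thesis using l(3)[OF j(1)] eq[OF j(1)] unfolding j(2) by simp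
    qed
    then show ?thesis using l(1,2) by (intro exI[of _ "\<lambda>j. l j + 1"]) simp
  qed
  show "\<exists>t :: nat \<Rightarrow> nat. strict_mono_on {1..length s} t \<and> t ` {1..length s} \<subseteq> {1..p} \<and>
              (\<forall>j\<in>{1..length s}. 1 \<le> s ! (j - 1) \<and> s ! (j - 1) \<le> A (t j))" if sep
  proof -
    have "adm True its s" using adm' that by simp
    then obtain t where t: "strict_mono_on {..<length s} t"
      "\<And>j. j < length s \<Longrightarrow> t j < p \<and> s ! j \<le> map fst its ! t j"
      using list_emb_indices[OF adm_True_emb[of its s]] len by auto
    have t': "t (j - 1) < p \<and> s ! (j - 1) \<le> A (Suc (t (j - 1)))" if "j \<in> {1..length s}" for j
      using t(2)[of "j - 1"] nthA[of "t (j - 1)"] that by auto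
    have "strict_mono_on {1..length s} (\<lambda>j. Suc (t (j - 1)))"
    proof (rule strict_mono_onI)
      fix i j assume "i \<in> {1..length s}" "j \<in> {1..length s}" "i < j"
      then show "Suc (t (i - 1)) < Suc (t (j - 1))"
        using strict_mono_onD[OF t(1), of "i - 1" "j - 1"] by auto
    qed
    then show ?thesis using t' ge1 by (intro exI[of _ "\<lambda>j. Suc (t (j - 1))"]) (auto simp: Suc_le_eq)
  qed
  have card: "card {i \<in> {1..m}. Q i} = length (filter Q [1..<m + 1])" for m :: nat and Q
  proof -
    have "{i \<in> {1..m}. Q i} = set (filter Q [1..<m + 1])" by auto
    then show ?thesis by (simp only: distinct_card distinct_filter distinct_upt)
  qed
  have s: "s = map (\<lambda>j. s ! (j - 1)) [1..<length s + 1]"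
    by (rule nth_equalityI) (auto simp del: upt_Suc)
  have "card {j \<in> {1..length s}. s ! (j - 1) = 1} = length (filter (\<lambda>x. x = 1) s)"
    unfolding card by (subst (3) s) (simp add: filter_map o_def del: upt_Suc)
  also have "\<dots> \<le> length (filter (\<lambda>it. fst (snd it)) its)" by (rule adm_count_ones[OF adm'])
  also have "\<dots> = card {i \<in> {1..p}. F i}"
    unfolding card by (simp add: its_def filter_map o_def del: upt_Suc)
  finally show "card {j \<in> {1..length s}. s ! (j - 1) = 1} \<le> card {i \<in> {1..p}. F i}" .
qed

section \<open>Assembly of the representation\<close>

lemma has_sum_finite_sum:
  fixes f :: "'a \<Rightarrow> 'b \<Rightarrow> 'c::topological_comm_monoid_add"
  shows "(\<And>t. t \<in> T \<Longrightarrow> (f t has_sum a t) A) \<Longrightarrow> ((\<lambda>x. \<Sum>t\<in>T. f t x) has_sum (\<Sum>t\<in>T. a t)) A"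
  by (induction T rule: infinite_finite_induct) (auto intro: has_sum_add has_sum_0)

theorem theorem3p3:
  fixes K :: "complex set" and p :: nat and A n r :: "nat \<Rightarrow> nat" and e :: "nat \<Rightarrow> int"
    and P :: cpoly
  assumes "complex_subfield K"
    and "p \<ge> 1"
    and "P \<in> polys_over K p"
    and "\<And>j. j \<in> {1..p} \<Longrightarrow>
      (\<Sum>i=1..j. deg_in i P) \<le> ereal (real (\<Sum>i=1..j. A i * (n i + 1)) - real j - 1)"
    and "\<And>i x. i \<in> {1..p} \<Longrightarrow>
      peval P (x(i := - x i - 2 * of_nat (r i) - of_nat (n i))) =
        (-1) powi (int (A i * (n i + 1)) + e i) * peval P x"
  shows "hyp_term p A n r P summable_on hyp_index p \<and>
    (\<exists>lam. admissible_representation K p A n r P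
        (\<Sum>\<^sub>\<infinity> k \<in> hyp_index p. hyp_term p A n r P k) lam \<and>
      (\<forall>s. length s = p \<and> lam s \<noteq> 0 \<longrightarrow> (\<forall>i\<in>{1..p}. [int (s ! (i - 1)) = e i] (mod 2))))"
proof -
  interpret subfield K by unfold_locales (fact assms(1))
  define sep where "sep \<longleftrightarrow> (\<forall>i\<in>{1..<p}. r i \<ge> r (i + 1) + n (i + 1) + 1)"
  define \<epsilon> :: "nat \<Rightarrow> complex" where "\<epsilon> = (\<lambda>i. (-1) powi (int (A i * (n i + 1)) + e i))"
  define keys where "keys = Poly_Mapping.keys P"
  define c where "c = Poly_Mapping.lookup P"
  define d where "d = (Poly_Mapping.lookup :: (nat \<Rightarrow>\<^sub>0 nat) \<Rightarrow> nat \<Rightarrow> nat)"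
  define f where "f = (\<lambda>m i. sym_ratio (A i) (r i) (n i) (\<epsilon> i) (d m i))"
  define \<sigma> where "\<sigma> = (\<lambda>m i. int (A i * (n i + 1)) - int (d m i))"
  define D where "D = (\<lambda>i. deg_in i P \<ge> ereal (real (A i * (n i + 1)) - 1))"
  define E where "E = (\<lambda>i. {s. [int s = e i] (mod 2)})"
  \<comment> \<open>All requirements on a tuple in one predicate, so that the combinations found for
    single monomials can be added without losing any of them.\<close>
  define G where "G = (\<lambda>s :: nat list. length s \<le> p \<and> (\<forall>j\<in>{1..length s}. s ! (j - 1) \<ge> 1) \<and> (s \<noteq> [] \<longrightarrow> s ! 0 \<ge> 2) \<and>
     (length s \<ge> 1 \<longrightarrow>
        (\<exists>l :: nat \<Rightarrow> nat. l 0 = 1 \<and> l (length s) = p + 1 \<and>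
           (\<forall>j\<in>{1..length s}. l (j - 1) < l j) \<and>
           (\<forall>j\<in>{1..length s}. s ! (j - 1) \<le> (\<Sum>i = l (j - 1)..<l j. A i))) \<and>
        (sep \<longrightarrow>
           (\<exists>t :: nat \<Rightarrow> nat. strict_mono_on {1..length s} t \<and> t ` {1..length s} \<subseteq> {1..p} \<and>
              (\<forall>j\<in>{1..length s}. 1 \<le> s ! (j - 1) \<and> s ! (j - 1) \<le> A (t j))) \<and>
           card {j \<in> {1..length s}. s ! (j - 1) = 1} \<le> card {i \<in> {1..p}. D i})) \<and>
     (length s = p \<longrightarrow> (\<forall>i\<in>{1..p}. [int (s ! (i - 1)) = e i] (mod 2))))"
  have cK: "c m \<in> K" and keys_sub: "m \<in> keys \<Longrightarrow> Poly_Mapping.keys m \<subseteq> {1..p}" for m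
    using assms(3) by (auto simp: polys_over_def c_def keys_def)
  have deg: "ereal (real (d m i)) \<le> deg_in i P" if "m \<in> keys" for m i
    unfolding deg_in_def d_def using that by (intro SUP_upper) (simp add: keys_def)
  \<comment> \<open>The exponents of a monomial are at most the partial degrees of \<open>P\<close>,
    so the degree hypothesis passes to each monomial.\<close>
  have conv: "(\<Sum>i=1..j. \<sigma> m i) \<ge> int j + 1" if "m \<in> keys" "j \<in> {1..p}" for m j
  proof -
    have "ereal (\<Sum>i=1..j. real (d m i)) \<le> (\<Sum>i=1..j. deg_in i P)"
      unfolding sum_ereal[symmetric] by (intro sum_mono deg that)
    also have "\<dots> \<le> ereal (real (\<Sum>i=1..j. A i * (n i + 1)) - real j - 1)" by (rule assms(4)[OF that(2)])
    finally have "real (\<Sum>i=1..j. d m i) \<le> real (\<Sum>i=1..j. A i * (n i + 1)) - real j - 1" by simp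
    then have "int (\<Sum>i=1..j. d m i) + int j + 1 \<le> int (\<Sum>i=1..j. A i * (n i + 1))" by linarith
    then show ?thesis unfolding \<sigma>_def sum_subtractf by simp
  qed
  have \<epsilon>2: "\<epsilon> i * \<epsilon> i = 1" for i by (simp add: \<epsilon>_def power_int_minus_one)
  have term_eq: "hyp_term p A n r P k = (\<Sum>m\<in>keys. c m * (\<Prod>i=1..p. on_nat (f m i) (k i)))" for k
  proof -
    have "peval P (\<lambda>i. of_nat (k i)) = (\<Sum>m\<in>keys. c m * (\<Prod>i=1..p. (of_nat (k i) ^ d m i
       + \<epsilon> i * (- of_nat (k i) - 2 * of_nat (r i) - of_nat (n i)) ^ d m i) / 2))"
      unfolding keys_def c_def d_def
      by (rule peval_symmetrize) (use keys_sub assms(5) \<epsilon>2 in \<open>auto simp: keys_def \<epsilon>_def\<close>)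
    then show ?thesis
      unfolding hyp_term_def
      by (simp only: sum_divide_distrib times_divide_eq_right[symmetric] prod_dividef[symmetric])
         (simp add: f_def sym_ratio_def on_nat_def)
  qed
  have decay: "\<exists>C. \<forall>k\<in>hyp_index p. norm (\<Prod>j=1..p. on_nat (f m j) (k j))
      \<le> C * (\<Prod>j=1..p. 1 / real (k j) ^ (if j = 1 then 2 else 1))" if "m \<in> keys" for m
    by (rule decay_prod_hyp_index[of _ _ "\<sigma> m"]) (use decay_sym_ratio conv[OF that] in \<open>auto simp: f_def \<sigma>_def\<close>)
  have summable: "(\<lambda>k. \<Prod>i=1..p. on_nat (f m i) (k i)) summable_on hyp_index p"
    and lim: "(\<lambda>N. nested_sum (map (\<lambda>i. on_nat (f m i)) [1..<p + 1]) N) \<longlonglongrightarrow> (\<Sum>\<^sub>\<infinity>k\<in>hyp_index p. \<Prod>i=1..p. on_nat (f m i) (k i))"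
    if "m \<in> keys" for m
    using decay[OF that] prod_hyp_index_nested_sum[of p "\<lambda>i. on_nat (f m i)"] by blast+
  have mono: "zspan G (\<Sum>\<^sub>\<infinity>k\<in>hyp_index p. \<Prod>i=1..p. on_nat (f m i) (k i))" if m: "m \<in> keys" for m
  proof -
    \<comment> \<open>The negated poles of the i-th factor are r_i, ..., r_i + n_i; the hypothesis
      of (b) makes these intervals strictly decreasing in i.\<close>
    define cell where "cell = (\<lambda>i. \<lparr>cfn = f m i, cord = A i, cflag = \<sigma> m i \<le> 1, cexp = E i,
      clo = r i, chi = r i + n i, csg = \<sigma> m i\<rparr>)"
    have "mero_cell sep (cell i)" for i
    proof -
      obtain C where C: "mf (pole_order (A i) (r i) (n i)) (f m i) C" "\<And>s. C s \<noteq> 0 \<Longrightarrow> s \<in> E i"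
        using mf_sym_ratio[of "\<epsilon> i" "A i" "n i" "e i" "r i" "d m i"] by (auto simp: f_def E_def \<epsilon>_def)
      have "decay (f m i) (\<sigma> m i)" unfolding f_def \<sigma>_def by (rule decay_sym_ratio)
      then show ?thesis
        unfolding mero_cell_def cell_def using C
        by (auto intro!: exI[of _ "pole_order (A i) (r i) (n i)"] exI[of _ C] simp: pole_order_def split: if_split_asm)
    qed
    moreover have "sorted_wrt (\<lambda>c d. chi d < clo c) (map cell [1..<p + 1])" if sep
    proof -
      have "r j + n j < r i" if "1 \<le> i" "i < j" "j \<le> p" for i j
      proof -
        have gap: "r (Suc l) + n (Suc l) < r l" if "1 \<le> l" "l < p" for l
          using bspec[OF \<open>sep\<close>[unfolded sep_def], of l] that by simp
        have "Suc i \<le> j" using that by simp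
        then show ?thesis using \<open>j \<le> p\<close>
        proof (induction rule: dec_induct)
          case base
          then show ?case using gap[of i] that by simp
        next
          case (step l)
          then show ?case using gap[of l] by simp
        qed
      qed
      then show ?thesis by (auto simp: sorted_wrt_map sorted_wrt_iff_nth_less cell_def simp del: upt_Suc)
    qed
    moreover have "conv_ok 0 (map csg (map cell [1..<p + 1]))"
      using conv_ok_upt[of p "\<sigma> m"] conv[OF m] by (simp add: cell_def o_def del: upt_Suc)
    ultimately have "represented sep (map item_of (map cell [1..<p + 1])) (nested_sum (map on_nat (map cfn (map cell [1..<p + 1]))))"
      by (intro represented_cells) auto
    moreover have "map item_of (map cell [1..<p + 1]) = map (\<lambda>i. (A i, \<sigma> m i \<le> 1, E i)) [1..<p + 1]"
      by (simp add: cell_def item_of_def o_def del: upt_Suc)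
    moreover have "map on_nat (map cfn (map cell [1..<p + 1])) = map (\<lambda>i. on_nat (f m i)) [1..<p + 1]"
      by (simp add: cell_def o_def del: upt_Suc)
    ultimately obtain S where S: "zspan (adm sep (map (\<lambda>i. (A i, \<sigma> m i \<le> 1, E i)) [1..<p + 1])) S"
      "nested_sum (map (\<lambda>i. on_nat (f m i)) [1..<p + 1]) \<longlonglongrightarrow> S"
      unfolding represented_def by metis
    have "S = (\<Sum>\<^sub>\<infinity>k\<in>hyp_index p. \<Prod>i=1..p. on_nat (f m i) (k i))"
      using LIMSEQ_unique S(2) lim[OF m] by blast
    moreover have "G s" if s: "adm sep (map (\<lambda>i. (A i, \<sigma> m i \<le> 1, E i)) [1..<p + 1]) s" for s
    proof -
      \<comment> \<open>The case j = 1 of \<open>conv\<close>: the first exponent is at least 2,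
        which finally yields s_1 >= 2.\<close>
      have "\<not> \<sigma> m 1 \<le> 1" using conv[OF m, of 1] assms(2) by simp
      note adm = adm_admissible[OF s this]
      \<comment> \<open>A flag means that the exponent of k_i in the monomial is at least A_i (n_i +
        1) - 1, so the flags are among the indices counted in (b).\<close>
      have "D i" if "\<sigma> m i \<le> 1" for i
      proof -
        have "A i * (n i + 1) \<le> d m i + 1" using that unfolding \<sigma>_def by linarith
        then have "real (A i * (n i + 1)) \<le> real (d m i + 1)" by (rule of_nat_mono)
        then have "ereal (real (A i * (n i + 1)) - 1) \<le> ereal (real (d m i))"
          unfolding ereal_less_eq by linarith
        then show ?thesis unfolding D_def using deg[OF m] order_trans by blast
      qed
      then have "card {i \<in> {1..p}. \<sigma> m i \<le> 1} \<le> card {i \<in> {1..p}. D i}"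
        by (intro card_mono) auto
      then show ?thesis
        unfolding G_def using adm by (auto simp: E_def)
    qed
    ultimately show ?thesis using zspan_mono S(1) by blast
  qed
  have sum: "(hyp_term p A n r P has_sum
      (\<Sum>m\<in>keys. c m * (\<Sum>\<^sub>\<infinity>k\<in>hyp_index p. \<Prod>i=1..p. on_nat (f m i) (k i)))) (hyp_index p)"
    unfolding term_eq[abs_def]
    by (intro has_sum_finite_sum has_sum_cmult_right has_sum_infsum summable)
  then have sm: "hyp_term p A n r P summable_on hyp_index p"
    by (rule has_sum_imp_summable)
  have "(\<Sum>\<^sub>\<infinity>k\<in>hyp_index p. hyp_term p A n r P k)
      = (\<Sum>m\<in>keys. c m * (\<Sum>\<^sub>\<infinity>k\<in>hyp_index p. \<Prod>i=1..p. on_nat (f m i) (k i)))"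
    by (rule infsumI[OF sum])
  also have "zspan G \<dots>" by (intro zspan_sum zspan_smult mono cK)
  finally obtain lam where lam: "\<And>s. lam s \<in> K" "finite {s. lam s \<noteq> 0}" "\<And>s. lam s \<noteq> 0 \<Longrightarrow> G s"
    "(\<Sum>\<^sub>\<infinity>k\<in>hyp_index p. hyp_term p A n r P k) = (\<Sum>s | lam s \<noteq> 0. lam s * of_real (mzeta s))"
    by (auto simp: zspan_def)
  have "admissible_representation K p A n r P (\<Sum>\<^sub>\<infinity>k\<in>hyp_index p. hyp_term p A n r P k) lam"
    unfolding admissible_representation_def sep_def[symmetric]
  proof (intro conjI allI impI)
    fix s assume "lam s \<noteq> 0 \<and> 1 \<le> length s"
    then have s: "G s" "1 \<le> length s" using lam by auto
    show "\<exists>l :: nat \<Rightarrow> nat. l 0 = 1 \<and> l (length s) = p + 1 \<and>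
           (\<forall>j\<in>{1..length s}. l (j - 1) < l j) \<and>
           (\<forall>j\<in>{1..length s}. s ! (j - 1) \<le> (\<Sum>i = l (j - 1)..<l j. A i))"
      using s unfolding G_def by blast
    assume sep
    then show "\<exists>t :: nat \<Rightarrow> nat. strict_mono_on {1..length s} t \<and> t ` {1..length s} \<subseteq> {1..p} \<and>
              (\<forall>j\<in>{1..length s}. 1 \<le> s ! (j - 1) \<and> s ! (j - 1) \<le> A (t j))"
      and "card {j \<in> {1..length s}. s ! (j - 1) = 1} \<le>
             card {i \<in> {1..p}. deg_in i P \<ge> ereal (real (A i * (n i + 1)) - 1)}"
      using s unfolding G_def D_def by blast+
  qed (use lam in \<open>simp_all add: G_def\<close>)
  moreover have "\<forall>s. length s = p \<and> lam s \<noteq> 0 \<longrightarrow> (\<forall>i\<in>{1..p}. [int (s ! (i - 1)) = e i] (mod 2))"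
    using lam(3) unfolding G_def by blast
  ultimately show ?thesis using sm by blast
qed

end
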